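(* Let $k$ be a number field or one of its completions, $\mathbb{O}$ an octonion algebra over $k$, and let $(A,E,\lambda)$ be a triple consisting of a quadratic étale $k$-algebra $A$ (with non-trivial involution $\sigma$) which embeds in $\mathbb{O}$, a cubic étale $k$-algebra $E$, and $\lambda\in E^\times/\bigl(N_{E\otimes_kA/E}((E\otimes_kA)^\times)\mathrm{Aut}_k(E)\bigr)$, such that the $A$-Hermitian form $\mathrm{Tr}_{E\otimes_kA/A}(\lambda x\sigma(y))$ on $E\otimes_kA$ has discriminant $1$ and is positive definite (respectively indefinite) at all real places of $k$ where $\mathbb{O}$ is definite (respectively split). Then at each real place $\nu$ of $k$ the restrictions on $A$, $E$ and the signature of $\lambda$ are as follows. \begin{itemize} \item If $\mathbb{O}$ is definite at $\nu$, then $A$ is CM at $\nu$ and $E$ is totally real at $\nu$. Moreover, $\lambda$ is positive at all the real places of $E$ over $\nu$. \item If $\mathbb{O}$ is indefinite at $\nu$, then $A$ is arbitrary and $E$ is arbitrary. Furthermore: \begin{itemize} \item if $A$ is CM at $\nu$ and $E$ is totally real at $\nu$, then $\lambda$ is positive at a unique place of $E$ over $\nu$; \item if $A$ is CM at $\nu$ and $E$ is not totally real at $\nu$, then $\lambda$ is negative at the unique real place of $E$ over $\nu$ (equivalently, the renormalized element $\delta_{E/k}\lambda$ is positive at that place); \item if $A$ is totally real at $\nu$, then the choice of $\lambda$ at $\nu$ is irrelevant (the norm map from $E\otimes_kA$ to $E$ is surjective at $\nu$). \end{itemize} \end{itemize}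
   Context: $\mathbb{O}$ is definite (resp. indefinite, equivalently split) at a real place $\nu$ if its norm form is definite (resp. of signature $(4,4)$) over $k_\nu$. $A$ is CM at $\nu$ if $A\otimes_kk_\nu\simeq\mathbb{C}$ and totally real at $\nu$ if $A\otimes_kk_\nu\simeq k_\nu\times k_\nu$; $E$ is totally real at $\nu$ if $E\otimes_kk_\nu\simeq k_\nu^3$ and not totally real if $E\otimes_kk_\nu\simeq k_\nu\times\mathbb{C}$. The quotient defining $\lambda$ is the set of $\mathrm{Aut}_k(E)$-orbits on $E^\times/N_{E\otimes_kA/E}((E\otimes_kA)^\times)$; signs of $\lambda$ at real places of $E$ over $\nu$ are considered for a representative, and when $A$ is CM at $\nu$ they are well defined up to the action of $\mathrm{Aut}_k(E)$. The discriminant of an $A$-Hermitian form is the class in $k^\times/N_{A/k}(A^\times)$ of its Gram determinant; $\delta_{E/k}$ is the discriminant of $E/k$. Definiteness of the form at $\nu$ is considered when $A$ is CM at $\nu$; at real places where $A$ splits the indefiniteness condition imposes nothing. *)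

theory Defs
  imports "HOL-Analysis.Analysis" "HOL-Algebra.Algebraic_Closure_Type"
begin

section \<open>Product rings\<close>

instance vec :: (comm_ring_1, finite) comm_ring_1 ..

instantiation prod :: (times, times) times
begin
definition times_prod_def: "x * y = (fst x * fst y, snd x * snd y)"
instance ..
end

instantiation prod :: (one, one) one
begin
definition one_prod_def: "1 = (1, 1)"
instance ..
end

instance prod :: (comm_ring_1, comm_ring_1) comm_ring_1
  by standard (auto simp: times_prod_def one_prod_def prod_eq_iff algebra_simps)


section \<open>Number fields, their completions, and real places\<close>

definition ring_hom_map :: "('r::comm_ring_1 \<Rightarrow> 's::comm_ring_1) \<Rightarrow> bool" where
  "ring_hom_map f \<longleftrightarrow> f 1 = 1 \<and> (\<forall>x y. f (x + y) = f x + f y) \<and> (\<forall>x y. f (x * y) = f x * f y)"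

definition number_field :: "('k::field_char_0) set \<Rightarrow> bool" where
  "number_field F \<longleftrightarrow>
     0 \<in> F \<and> 1 \<in> F \<and>
     (\<forall>x\<in>F. \<forall>y\<in>F. x - y \<in> F \<and> x * y \<in> F) \<and> (\<forall>x\<in>F. inverse x \<in> F) \<and>
     (\<exists>B. finite B \<and> B \<subseteq> F \<and>
        (\<forall>x\<in>F. \<exists>c :: 'k \<Rightarrow> rat. x = (\<Sum>b\<in>B. of_rat (c b) * b)))"

definition absolute_value :: "('k::field \<Rightarrow> real) \<Rightarrow> bool" where
  "absolute_value w \<longleftrightarrow>
     (\<forall>x. w x \<ge> 0) \<and> (\<forall>x. w x = 0 \<longleftrightarrow> x = 0) \<and>
     (\<forall>x y. w (x * y) = w x * w y) \<and> (\<forall>x y. w (x + y) \<le> w x + w y) \<and>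
     (\<exists>x. x \<noteq> 0 \<and> w x \<noteq> 1)"

text \<open>The type is a completion of a number field if it is complete for a non-trivial absolute
  value and contains a number field as a dense subfield.\<close>

definition number_field_or_completion :: "('k::field_char_0) itself \<Rightarrow> bool" where
  "number_field_or_completion _ \<longleftrightarrow>
     number_field (UNIV :: 'k set) \<or>
     (\<exists>(F :: 'k set) w. number_field F \<and> absolute_value w \<and>
        (\<forall>x. \<forall>\<epsilon>>0. \<exists>y\<in>F. w (x - y) < \<epsilon>) \<and>
        (\<forall>s :: nat \<Rightarrow> 'k.
           (\<forall>\<epsilon>>0. \<exists>N. \<forall>m\<ge>N. \<forall>n\<ge>N. w (s m - s n) < \<epsilon>) \<longrightarrow>
           (\<exists>l. (\<lambda>n. w (s n - l)) \<longlonglongrightarrow> 0)))"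

text \<open>A real place is given by its embedding into the real numbers.  This also covers
  completions: one isomorphic to the reals has exactly one such embedding (its only place),
  the complex and the non-archimedean ones have none.\<close>

definition real_place :: "('k::field \<Rightarrow> real) \<Rightarrow> bool" where
  "real_place \<nu> \<longleftrightarrow> ring_hom_map \<nu>"

text \<open>Here an algebra over \<open>K\<close> is a commutative ring with its structure map from \<open>K\<close>.  The real
  places over \<open>\<nu>\<close> of an etale algebra (those of its field factors) are the extensions of \<open>\<nu>\<close> to
  ring homomorphisms into the reals.\<close>

definition real_places_over ::
    "('k::field \<Rightarrow> 'e::comm_ring_1) \<Rightarrow> ('k \<Rightarrow> real) \<Rightarrow> ('e \<Rightarrow> real) set" where
  "real_places_over \<phi> \<nu> = {\<tau>. ring_hom_map \<tau> \<and> (\<forall>c. \<tau> (\<phi> c) = \<nu> c)}"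


section \<open>Tensor products and etale algebras\<close>

text \<open>\<open>R\<close> with the maps \<open>iA\<close> and \<open>iB\<close> is the tensor product of the algebras \<open>A\<close> and \<open>B\<close> over the
  field \<open>K\<close>: the last two clauses say that the canonical map, sending the tensor of \<open>a\<close> and \<open>b\<close>
  to \<open>iA a * iB b\<close>, is surjective and injective.\<close>

definition is_tensor_product ::
    "('k::field \<Rightarrow> 'a::comm_ring_1) \<Rightarrow> ('k \<Rightarrow> 'b::comm_ring_1) \<Rightarrow>
     ('a \<Rightarrow> 'r::comm_ring_1) \<Rightarrow> ('b \<Rightarrow> 'r) \<Rightarrow> bool" where
  "is_tensor_product \<phi>A \<phi>B iA iB \<longleftrightarrow>
     ring_hom_map \<phi>A \<and> ring_hom_map \<phi>B \<and> ring_hom_map iA \<and> ring_hom_map iB \<and>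
     (\<forall>c. iA (\<phi>A c) = iB (\<phi>B c)) \<and>
     (\<forall>t. \<exists>(n::nat) a b. t = (\<Sum>m<n. iA (a m) * iB (b m))) \<and>
     (\<forall>(n::nat) a b.
        (\<forall>c. (\<Sum>m<n. \<phi>A (c m) * a m) = 0 \<longrightarrow> (\<forall>m<n. c m = 0)) \<longrightarrow>
        (\<Sum>m<n. iA (a m) * iB (b m)) = 0 \<longrightarrow> (\<forall>m<n. b m = 0))"

text \<open>Etale of degree \<open>CARD('n)\<close>: split by the algebraic closure.\<close>

definition etale_algebra :: "('n::finite) itself \<Rightarrow> ('k::field \<Rightarrow> 'a::comm_ring_1) \<Rightarrow> bool" where
  "etale_algebra _ \<phi> \<longleftrightarrow>
     (\<exists>f :: 'a \<Rightarrow> 'k alg_closure ^ 'n. is_tensor_product \<phi> to_ac f (\<lambda>z. \<chi> i. z))"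

definition quadratic_CM_at :: "('k::field \<Rightarrow> 'a::comm_ring_1) \<Rightarrow> ('k \<Rightarrow> real) \<Rightarrow> bool" where
  "quadratic_CM_at \<phi> \<nu> \<longleftrightarrow> (\<exists>f :: 'a \<Rightarrow> complex. is_tensor_product \<phi> \<nu> f of_real)"

definition quadratic_totally_real_at ::
    "('k::field \<Rightarrow> 'a::comm_ring_1) \<Rightarrow> ('k \<Rightarrow> real) \<Rightarrow> bool" where
  "quadratic_totally_real_at \<phi> \<nu> \<longleftrightarrow>
     (\<exists>f :: 'a \<Rightarrow> real \<times> real. is_tensor_product \<phi> \<nu> f (\<lambda>r. (r, r)))"

definition cubic_totally_real_at ::
    "('k::field \<Rightarrow> 'e::comm_ring_1) \<Rightarrow> ('k \<Rightarrow> real) \<Rightarrow> bool" where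
  "cubic_totally_real_at \<phi> \<nu> \<longleftrightarrow>
     (\<exists>f :: 'e \<Rightarrow> real ^ 3. is_tensor_product \<phi> \<nu> f (\<lambda>r. \<chi> i. r))"

definition cubic_not_totally_real_at ::
    "('k::field \<Rightarrow> 'e::comm_ring_1) \<Rightarrow> ('k \<Rightarrow> real) \<Rightarrow> bool" where
  "cubic_not_totally_real_at \<phi> \<nu> \<longleftrightarrow>
     (\<exists>f :: 'e \<Rightarrow> real \<times> complex. is_tensor_product \<phi> \<nu> f (\<lambda>r. (r, of_real r)))"

definition nontrivial_involution ::
    "('k::field \<Rightarrow> 'a::comm_ring_1) \<Rightarrow> ('a \<Rightarrow> 'a) \<Rightarrow> bool" where
  "nontrivial_involution \<phi> \<sigma> \<longleftrightarrow>
     ring_hom_map \<sigma> \<and> (\<forall>c. \<sigma> (\<phi> c) = \<phi> c) \<and> (\<forall>x. \<sigma> (\<sigma> x) = x) \<and> \<sigma> \<noteq> id"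

definition algebra_automorphism ::
    "('k::field \<Rightarrow> 'e::comm_ring_1) \<Rightarrow> ('e \<Rightarrow> 'e) \<Rightarrow> bool" where
  "algebra_automorphism \<phi> \<alpha> \<longleftrightarrow> ring_hom_map \<alpha> \<and> (\<forall>c. \<alpha> (\<phi> c) = \<phi> c) \<and> bij \<alpha>"


section \<open>Trace, norm and discriminant of free algebras\<close>

definition is_basis ::
    "('r::comm_ring_1 \<Rightarrow> 'm \<Rightarrow> 'm::ab_group_add) \<Rightarrow> ('n::finite \<Rightarrow> 'm) \<Rightarrow> bool" where
  "is_basis s b \<longleftrightarrow> (\<forall>x. \<exists>!c. x = (\<Sum>i\<in>UNIV. s (c i) (b i)))"

definition coords ::
    "('r::comm_ring_1 \<Rightarrow> 'm \<Rightarrow> 'm::ab_group_add) \<Rightarrow> ('n::finite \<Rightarrow> 'm) \<Rightarrow> 'm \<Rightarrow> 'n \<Rightarrow> 'r" where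
  "coords s b x = (THE c. x = (\<Sum>i\<in>UNIV. s (c i) (b i)))"

definition act :: "('r::comm_ring_1 \<Rightarrow> 's::comm_ring_1) \<Rightarrow> 'r \<Rightarrow> 's \<Rightarrow> 's" where
  "act \<phi> c x = \<phi> c * x"

definition mult_matrix ::
    "('r::comm_ring_1 \<Rightarrow> 's::comm_ring_1) \<Rightarrow> ('n::finite \<Rightarrow> 's) \<Rightarrow> 's \<Rightarrow> 'r ^ 'n ^ 'n" where
  "mult_matrix \<phi> b x = (\<chi> i j. coords (act \<phi>) b (x * b j) i)"

text \<open>The rank \<open>CARD('n)\<close> of the free algebra is passed as a type; the values do not depend on
  the chosen basis.\<close>

definition alg_trace ::
    "('n::finite) itself \<Rightarrow> ('r::comm_ring_1 \<Rightarrow> 's::comm_ring_1) \<Rightarrow> 's \<Rightarrow> 'r" where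
  "alg_trace _ \<phi> x = trace (mult_matrix \<phi> (SOME b :: 'n \<Rightarrow> 's. is_basis (act \<phi>) b) x)"

definition alg_norm ::
    "('n::finite) itself \<Rightarrow> ('r::comm_ring_1 \<Rightarrow> 's::comm_ring_1) \<Rightarrow> 's \<Rightarrow> 'r" where
  "alg_norm _ \<phi> x = det (mult_matrix \<phi> (SOME b :: 'n \<Rightarrow> 's. is_basis (act \<phi>) b) x)"

definition alg_disc :: "('r::comm_ring_1 \<Rightarrow> 's::comm_ring_1) \<Rightarrow> ('n::finite \<Rightarrow> 's) \<Rightarrow> 'r" where
  "alg_disc \<phi> b = det (\<chi> i j. alg_trace TYPE('n) \<phi> (b i * b j))"


section \<open>Octonion algebras\<close>

text \<open>An octonion algebra is an eight-dimensional composition algebra with unit.  The norm form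
  is determined by the multiplication; it is made part of the data for convenience.\<close>

record ('k, 'o) octonions =
  oct_scale :: "'k \<Rightarrow> 'o \<Rightarrow> 'o"
  oct_mult :: "'o \<Rightarrow> 'o \<Rightarrow> 'o"
  oct_one :: "'o"
  oct_norm :: "'o \<Rightarrow> 'k"

definition oct_polar :: "('k::field, 'o::ab_group_add) octonions \<Rightarrow> 'o \<Rightarrow> 'o \<Rightarrow> 'k" where
  "oct_polar Oc x y = oct_norm Oc (x + y) - oct_norm Oc x - oct_norm Oc y"

definition octonion_algebra :: "('k::field_char_0, 'o::ab_group_add) octonions \<Rightarrow> bool" where
  "octonion_algebra Oc \<longleftrightarrow>
     vector_space (oct_scale Oc) \<and>
     (\<exists>b :: 8 \<Rightarrow> 'o. is_basis (oct_scale Oc) b) \<and>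
     (\<forall>x. Vector_Spaces.linear (oct_scale Oc) (oct_scale Oc) (\<lambda>y. oct_mult Oc x y)) \<and>
     (\<forall>y. Vector_Spaces.linear (oct_scale Oc) (oct_scale Oc) (\<lambda>x. oct_mult Oc x y)) \<and>
     (\<forall>x. oct_mult Oc (oct_one Oc) x = x \<and> oct_mult Oc x (oct_one Oc) = x) \<and>
     (\<forall>c x. oct_norm Oc (oct_scale Oc c x) = c\<^sup>2 * oct_norm Oc x) \<and>
     (\<forall>x. Vector_Spaces.linear (oct_scale Oc) (*) (\<lambda>y. oct_polar Oc x y)) \<and>
     (\<forall>x. (\<forall>y. oct_polar Oc x y = 0) \<longrightarrow> x = 0) \<and>
     (\<forall>x y. oct_norm Oc (oct_mult Oc x y) = oct_norm Oc x * oct_norm Oc y)"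

definition embeds_in_octonions ::
    "('k::field \<Rightarrow> 'a::comm_ring_1) \<Rightarrow> ('k, 'o::ab_group_add) octonions \<Rightarrow> bool" where
  "embeds_in_octonions \<phi> Oc \<longleftrightarrow>
     (\<exists>f. inj f \<and> f 1 = oct_one Oc \<and> (\<forall>x y. f (x + y) = f x + f y) \<and>
          (\<forall>c x. f (\<phi> c * x) = oct_scale Oc c (f x)) \<and>
          (\<forall>x y. f (x * y) = oct_mult Oc (f x) (f y)))"

text \<open>The base change to the reals along \<open>\<nu>\<close>, in coordinates: the structure constants and the
  Gram matrix of the polar form with respect to a basis are mapped by \<open>\<nu>\<close>.  The norm is half the
  polar form on the diagonal.\<close>

definition octonions_at ::
    "('k::field, 'o::ab_group_add) octonions \<Rightarrow> ('k \<Rightarrow> real) \<Rightarrow> (real, real ^ 8) octonions" where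
  "octonions_at Oc \<nu> =
     (let b = (SOME b :: 8 \<Rightarrow> 'o. is_basis (oct_scale Oc) b) in
      \<lparr> oct_scale = (*\<^sub>R),
        oct_mult = (\<lambda>x y. \<chi> l. \<Sum>i\<in>UNIV. \<Sum>j\<in>UNIV.
          x $ i * y $ j * \<nu> (coords (oct_scale Oc) b (oct_mult Oc (b i) (b j)) l)),
        oct_one = (\<chi> l. \<nu> (coords (oct_scale Oc) b (oct_one Oc) l)),
        oct_norm = (\<lambda>x. (\<Sum>i\<in>UNIV. \<Sum>j\<in>UNIV.
          x $ i * x $ j * \<nu> (oct_polar Oc (b i) (b j))) / 2) \<rparr>)"

definition definite_form :: "(real ^ 'n \<Rightarrow> real) \<Rightarrow> bool" where
  "definite_form q \<longleftrightarrow> (\<forall>x. x \<noteq> 0 \<longrightarrow> q x > 0) \<or> (\<forall>x. x \<noteq> 0 \<longrightarrow> q x < 0)"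

definition has_signature :: "(real ^ 'n \<Rightarrow> real) \<Rightarrow> nat \<times> nat \<Rightarrow> bool" where
  "has_signature q pm \<longleftrightarrow>
     (\<exists>(u :: 'n \<Rightarrow> real ^ 'n) d. is_basis (*\<^sub>R) u \<and>
        (\<forall>x. q (\<Sum>i\<in>UNIV. x i *\<^sub>R u i) = (\<Sum>i\<in>UNIV. d i * (x i)\<^sup>2)) \<and>
        card {i. d i > 0} = fst pm \<and> card {i. d i < 0} = snd pm)"

definition oct_definite_at ::
    "('k::field, 'o::ab_group_add) octonions \<Rightarrow> ('k \<Rightarrow> real) \<Rightarrow> bool" where
  "oct_definite_at Oc \<nu> \<longleftrightarrow> definite_form (oct_norm (octonions_at Oc \<nu>))"

definition oct_split_at ::
    "('k::field, 'o::ab_group_add) octonions \<Rightarrow> ('k \<Rightarrow> real) \<Rightarrow> bool" where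
  "oct_split_at Oc \<nu> \<longleftrightarrow> has_signature (oct_norm (octonions_at Oc \<nu>)) (4, 4)"


section \<open>The Hermitian form\<close>

text \<open>In this section \<open>iE\<close> and \<open>iA\<close> are the maps from \<open>E\<close> and \<open>A\<close> to their tensor product.  The
  involution of \<open>A\<close> is extended to the tensor product by the identity on \<open>E\<close>.\<close>

definition sigma_ext ::
    "('e::comm_ring_1 \<Rightarrow> 't::comm_ring_1) \<Rightarrow> ('a::comm_ring_1 \<Rightarrow> 't) \<Rightarrow> ('a \<Rightarrow> 'a) \<Rightarrow> 't \<Rightarrow> 't" where
  "sigma_ext iE iA \<sigma> =
     (THE s. ring_hom_map s \<and> (\<forall>e. s (iE e) = iE e) \<and> (\<forall>a. s (iA a) = iA (\<sigma> a)))"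

definition herm_form ::
    "('e::comm_ring_1 \<Rightarrow> 't::comm_ring_1) \<Rightarrow> ('a::comm_ring_1 \<Rightarrow> 't) \<Rightarrow> ('a \<Rightarrow> 'a) \<Rightarrow> 'e \<Rightarrow>
     't \<Rightarrow> 't \<Rightarrow> 'a" where
  "herm_form iE iA \<sigma> l x y = alg_trace TYPE(3) iA (iE l * x * sigma_ext iE iA \<sigma> y)"

definition norm_class :: "('k::field \<Rightarrow> 'a::comm_ring_1) \<Rightarrow> 'k \<Rightarrow> 'k set" where
  "norm_class \<phi> c = {c * alg_norm TYPE(2) \<phi> a | a. a dvd 1}"

definition herm_has_disc ::
    "('k::field \<Rightarrow> 'a::comm_ring_1) \<Rightarrow> ('a \<Rightarrow> 't::comm_ring_1) \<Rightarrow> ('t \<Rightarrow> 't \<Rightarrow> 'a) \<Rightarrow> 'k \<Rightarrow> bool" where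
  "herm_has_disc \<phi> iA h c \<longleftrightarrow>
     (\<exists>(b :: 3 \<Rightarrow> 't) d. is_basis (act iA) b \<and> d \<noteq> 0 \<and> \<phi> d = det (\<chi> i j. h (b i) (b j)) \<and>
        norm_class \<phi> d = norm_class \<phi> c)"

text \<open>The diagonal values at \<open>v\<close> of the extension of a Hermitian form along \<open>f\<close>, in coordinates
  with respect to \<open>b\<close>; they are real, so taking the real part loses nothing.\<close>

definition herm_value ::
    "('a \<Rightarrow> complex) \<Rightarrow> ('t \<Rightarrow> 't \<Rightarrow> 'a) \<Rightarrow> ('n::finite \<Rightarrow> 't) \<Rightarrow> complex ^ 'n \<Rightarrow> real" where
  "herm_value f h b v = Re (\<Sum>i\<in>UNIV. \<Sum>j\<in>UNIV. v $ i * cnj (v $ j) * f (h (b i) (b j)))"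

text \<open>Both notions impose a condition only if \<open>A\<close> is CM at \<open>\<nu>\<close>.\<close>

definition herm_pos_def_at ::
    "('k::field \<Rightarrow> 'a::comm_ring_1) \<Rightarrow> ('a \<Rightarrow> 't::comm_ring_1) \<Rightarrow> ('t \<Rightarrow> 't \<Rightarrow> 'a) \<Rightarrow>
     ('k \<Rightarrow> real) \<Rightarrow> bool" where
  "herm_pos_def_at \<phi> iA h \<nu> \<longleftrightarrow>
     (\<forall>f :: 'a \<Rightarrow> complex. is_tensor_product \<phi> \<nu> f of_real \<longrightarrow>
        (\<exists>b :: 3 \<Rightarrow> 't. is_basis (act iA) b \<and> (\<forall>v. v \<noteq> 0 \<longrightarrow> herm_value f h b v > 0)))"

definition herm_indefinite_at ::
    "('k::field \<Rightarrow> 'a::comm_ring_1) \<Rightarrow> ('a \<Rightarrow> 't::comm_ring_1) \<Rightarrow> ('t \<Rightarrow> 't \<Rightarrow> 'a) \<Rightarrow>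
     ('k \<Rightarrow> real) \<Rightarrow> bool" where
  "herm_indefinite_at \<phi> iA h \<nu> \<longleftrightarrow>
     (\<forall>f :: 'a \<Rightarrow> complex. is_tensor_product \<phi> \<nu> f of_real \<longrightarrow>
        (\<exists>b :: 3 \<Rightarrow> 't. is_basis (act iA) b \<and>
           (\<exists>v. herm_value f h b v > 0) \<and> (\<exists>v. herm_value f h b v < 0)))"


section \<open>The triples\<close>

text \<open>Two units of \<open>E\<close> are related if they have the same orbit under the automorphisms of \<open>E\<close>
  in the group of units modulo norms; \<open>iE\<close> is the map from \<open>E\<close> to its tensor product with \<open>A\<close>.\<close>

definition lambda_rel ::
    "('k::field \<Rightarrow> 'e::comm_ring_1) \<Rightarrow> ('e \<Rightarrow> 't::comm_ring_1) \<Rightarrow> ('e \<times> 'e) set" where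
  "lambda_rel \<phi>E iE =
     {(x, y). x dvd 1 \<and>
        (\<exists>\<alpha> u. algebra_automorphism \<phi>E \<alpha> \<and> u dvd 1 \<and> y = \<alpha> x * alg_norm TYPE(2) iE u)}"

definition lambda_classes ::
    "('k::field \<Rightarrow> 'e::comm_ring_1) \<Rightarrow> ('e \<Rightarrow> 't::comm_ring_1) \<Rightarrow> 'e set set" where
  "lambda_classes \<phi>E iE = {x. x dvd 1} // lambda_rel \<phi>E iE"

text \<open>The conditions on the Hermitian form do not depend on the representative \<open>l\<close>.\<close>

definition octonion_triple ::
    "('k::field_char_0, 'o::ab_group_add) octonions \<Rightarrow>
     ('k \<Rightarrow> 'a::comm_ring_1) \<Rightarrow> ('a \<Rightarrow> 'a) \<Rightarrow> ('k \<Rightarrow> 'e::comm_ring_1) \<Rightarrow>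
     ('e \<Rightarrow> 't::comm_ring_1) \<Rightarrow> ('a \<Rightarrow> 't) \<Rightarrow> 'e set \<Rightarrow> bool" where
  "octonion_triple Oc \<phi>A \<sigma> \<phi>E iE iA \<Lambda> \<longleftrightarrow>
     etale_algebra TYPE(2) \<phi>A \<and> nontrivial_involution \<phi>A \<sigma> \<and> embeds_in_octonions \<phi>A Oc \<and>
     etale_algebra TYPE(3) \<phi>E \<and>
     is_tensor_product \<phi>E \<phi>A iE iA \<and>
     \<Lambda> \<in> lambda_classes \<phi>E iE \<and>
     (\<exists>l\<in>\<Lambda>.
        herm_has_disc \<phi>A iA (herm_form iE iA \<sigma> l) 1 \<and>
        (\<forall>\<nu>. real_place \<nu> \<longrightarrow>
           (oct_definite_at Oc \<nu> \<longrightarrow> herm_pos_def_at \<phi>A iA (herm_form iE iA \<sigma> l) \<nu>) \<and>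
           (oct_split_at Oc \<nu> \<longrightarrow> herm_indefinite_at \<phi>A iA (herm_form iE iA \<sigma> l) \<nu>)))"

end

theory Submission
  imports Defs
begin

text \<open>
  Fix a real place \<open>\<nu>\<close> of \<open>k\<close>.  Completing the square writes \<open>A\<close> as \<open>k[s]\<close> with \<open>s^2 = d\<close>, and \<open>A\<close> is
  CM or totally real at \<open>\<nu>\<close> according to the sign of \<open>\<nu> d\<close>.  A primitive element writes \<open>E\<close> as
  \<open>k[X]\<close> modulo a separable cubic, so \<open>E\<close> has three complex places \<open>\<rho> r\<close> over \<open>\<nu>\<close>, permuted by complex
  conjugation through a permutation \<open>c\<close>, which is the identity if \<open>E\<close> is totally real at \<open>\<nu>\<close> and a
  transposition otherwise (\<open>cubic_real_or_not\<close>).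

  Suppose that \<open>A\<close> is CM at \<open>\<nu>\<close>.  Each \<open>\<rho> r\<close> and the embedding of \<open>A\<close> into the complex numbers combine
  to a homomorphism \<open>g r\<close> on the tensor product, and in these coordinates the Hermitian form becomes
  \<open>\<Sum> r. \<rho> r \<lambda> * g r x * cnj (g (c r) y)\<close> (\<open>herm_at\<close>).  Its Gram determinants are therefore
  \<open>sign c * (\<Prod> r. \<rho> r \<lambda>)\<close> times an absolute square (\<open>det_gram\<close>).  Norms from \<open>A\<close> are positive at \<open>\<nu>\<close>, so
  discriminant one says that \<open>sign c * (\<Prod> r. \<rho> r \<lambda>)\<close> is positive.  If \<open>E\<close> is totally real, the number of
  negative values of \<open>\<lambda>\<close> is then zero or two, which are the definite and the indefinite form.  If \<open>E\<close> is
  not totally real, the conjugate values multiply to a positive number, so the real value of \<open>\<lambda>\<close> is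
  negative, and the form is isotropic and cannot be definite.  The same determinant formula for the
  trace form shows that the discriminant of \<open>E\<close> is negative.  All this passes to the other
  representatives of the class of \<open>\<lambda>\<close>, because norms from the tensor product are positive at the
  real places of \<open>E\<close> over \<open>\<nu>\<close>, and automorphisms of \<open>E\<close> permute those places
  (\<open>lambda_class_signs\<close>).

  The octonions enter through the quadratic equation of an element of a composition algebra.  It makes
  the image of \<open>s\<close> a pure octonion of norm \<open>- d\<close>.  If the norm form is definite at \<open>\<nu>\<close>, it is positive,
  so \<open>\<nu> d\<close> is negative and \<open>A\<close> is CM (\<open>definite_quadratic\<close>).  If it is split, then the pure octonions of
  the base change represent every non-zero real number, so every quadratic etale algebra over the
  reals embeds (\<open>split_represents\<close>); with \<open>\<lambda> = (1, -1, -1)\<close> or \<open>(-1, 1)\<close> it forms a triple with any cubic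
  one (\<open>real_triple_exists\<close>).  Polynomial identities reach the base change because \<open>k\<close> contains the
  rational numbers, which are dense in the reals.

  If \<open>A\<close> is totally real at \<open>\<nu>\<close>, then \<open>d\<close> is a square after base change and the norm form is a product
  of two linear forms, so it represents everything (\<open>split_norm_surjective\<close>).
\<close>

(* The coefficient notation of power series clashes with the components of vectors, and constants for
   other encodings of polynomials clash with those of the polynomial type. *)
unbundle no Formal_Power_Series.fps_syntax
hide_const (open) Polynomials.degree Polynomials.lead_coeff up_ring.coeff up_ring.monom

section \<open>Ring homomorphisms and bases\<close>

lemma ring_hom_mapI:
  "f 1 = 1 \<Longrightarrow> (\<And>x y. f (x + y) = f x + f y) \<Longrightarrow> (\<And>x y. f (x * y) = f x * f y) \<Longrightarrow> ring_hom_map f"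
  by (simp add: ring_hom_map_def)

lemma
  assumes "ring_hom_map f"
  shows rh_1: "f 1 = 1" and rh_add: "f (x + y) = f x + f y" and rh_mult: "f (x * y) = f x * f y"
  using assms by (auto simp: ring_hom_map_def)

lemma rh_0: assumes "ring_hom_map f" shows "f 0 = 0"
  using rh_add[OF assms, of 0 0] by simp

lemma rh_minus: assumes "ring_hom_map f" shows "f (- x) = - f x"
  using rh_add[OF assms, of x "- x"] rh_0[OF assms] by (simp add: eq_neg_iff_add_eq_0 add.commute)

lemma rh_diff: assumes "ring_hom_map f" shows "f (x - y) = f x - f y"
  using rh_add[OF assms, of x "- y"] rh_minus[OF assms, of y] by simp

lemma rh_sum: assumes "ring_hom_map f" shows "f (sum g A) = (\<Sum>i\<in>A. f (g i))"
  by (induction A rule: infinite_finite_induct) (auto simp: rh_0[OF assms] rh_add[OF assms])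

lemma rh_prod: assumes "ring_hom_map f" shows "f (prod g A) = (\<Prod>i\<in>A. f (g i))"
  by (induction A rule: infinite_finite_induct) (auto simp: rh_1[OF assms] rh_mult[OF assms])

lemma rh_power: assumes "ring_hom_map f" shows "f (x ^ n) = f x ^ n"
  by (induction n) (auto simp: rh_1[OF assms] rh_mult[OF assms])

lemma rh_of_nat: assumes "ring_hom_map f" shows "f (of_nat n) = of_nat n"
  by (induction n) (auto simp: rh_0[OF assms] rh_1[OF assms] rh_add[OF assms])

lemma rh_numeral: assumes "ring_hom_map f" shows "f (numeral n) = numeral n"
  using rh_of_nat[OF assms, of "numeral n"] by simp

lemma rh_unit: assumes "ring_hom_map f" "x dvd 1" shows "f x dvd 1"
  using assms(2) rh_mult[OF assms(1)] rh_1[OF assms(1)] by (metis dvd_def)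

lemma rh_det: assumes "ring_hom_map h"
  shows "h (det (A :: 'r::comm_ring_1 ^ 'n ^ 'n)) = det (\<chi> i j. h (A $ i $ j))"
  by (simp add: det_def rh_sum[OF assms] rh_mult[OF assms] rh_prod[OF assms])
     (intro sum.cong refl arg_cong2[where f = "(*)"];
      auto simp: sign_def rh_1[OF assms] rh_minus[OF assms])

lemma rh_trace: assumes "ring_hom_map h"
  shows "h (trace (A :: 'r::comm_ring_1 ^ 'n ^ 'n)) = trace (\<chi> i j. h (A $ i $ j))"
  by (simp add: trace_def rh_sum[OF assms])

lemmas rh_simps = rh_0 rh_1 rh_add rh_mult rh_minus rh_diff rh_sum rh_power rh_numeral

lemma rh_compose: "ring_hom_map f \<Longrightarrow> ring_hom_map g \<Longrightarrow> ring_hom_map (\<lambda>x. g (f x))"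
  by (simp add: ring_hom_map_def)

lemma rh_id: "ring_hom_map (\<lambda>x. x)"
  by (simp add: ring_hom_map_def)

lemma rh_cnj: "ring_hom_map cnj"
  by (simp add: ring_hom_map_def)

lemma rh_of_real: "ring_hom_map (of_real :: real \<Rightarrow> complex)"
  by (simp add: ring_hom_map_def)

lemma rh_const_vec: "ring_hom_map (\<lambda>z. \<chi> (i::'n::finite). (z :: 'r::comm_ring_1))"
  by (simp add: ring_hom_map_def vec_eq_iff)

lemma rh_component: "ring_hom_map (\<lambda>v :: 'r::comm_ring_1 ^ 'n. v $ i)"
  by (simp add: ring_hom_map_def)

lemma rh_field_eq_0:
  fixes f :: "'k::field \<Rightarrow> 'r::comm_ring_1"
  assumes "ring_hom_map f" shows "f x = 0 \<longleftrightarrow> x = 0"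
proof
  assume "f x = 0"
  show "x = 0"
  proof (rule ccontr)
    assume "x \<noteq> 0"
    then have "f 1 = f x * f (inverse x)"
      using rh_mult[OF assms, of x "inverse x"] by simp
    then show False using \<open>f x = 0\<close> rh_1[OF assms] by simp
  qed
qed (simp add: rh_0[OF assms])

lemma is_basis_act_iff:
  fixes b :: "'n::finite \<Rightarrow> 's::comm_ring_1"
  assumes "ring_hom_map \<phi>"
  shows "is_basis (act \<phi>) b \<longleftrightarrow>
    (\<forall>x. \<exists>c. x = (\<Sum>i\<in>UNIV. \<phi> (c i) * b i)) \<and>
    (\<forall>c. (\<Sum>i\<in>UNIV. \<phi> (c i) * b i) = 0 \<longrightarrow> (\<forall>i. c i = 0))"
    (is "_ \<longleftrightarrow> ?S \<and> ?I")
proof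
  assume B: "is_basis (act \<phi>) b"
  have ?S using B unfolding is_basis_def act_def by blast
  moreover have ?I
  proof (intro allI impI)
    fix c i assume c: "(\<Sum>i\<in>UNIV. \<phi> (c i) * b i) = 0"
    have "\<exists>!c. 0 = (\<Sum>i\<in>UNIV. \<phi> (c i) * b i)"
      using spec[OF B[unfolded is_basis_def act_def], of 0] .
    then obtain d where d: "\<forall>c. 0 = (\<Sum>i\<in>UNIV. \<phi> (c i) * b i) \<longrightarrow> c = d"
      by (elim ex1E) (rule that, assumption)
    have "c = d" using c by (intro d[rule_format]) simp
    moreover have "(\<lambda>_. 0) = d" by (intro d[rule_format]) (simp add: rh_0[OF assms])
    ultimately show "c i = 0" by metis
  qed
  ultimately show "?S \<and> ?I" by blast
next
  assume SI: "?S \<and> ?I"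
  show "is_basis (act \<phi>) b"
    unfolding is_basis_def act_def
  proof
    fix x
    show "\<exists>!c. x = (\<Sum>i\<in>UNIV. \<phi> (c i) * b i)"
    proof (rule ex_ex1I)
      show "\<exists>c. x = (\<Sum>i\<in>UNIV. \<phi> (c i) * b i)" using SI by blast
      fix c d assume "x = (\<Sum>i\<in>UNIV. \<phi> (c i) * b i)" "x = (\<Sum>i\<in>UNIV. \<phi> (d i) * b i)"
      then have "(\<Sum>i\<in>UNIV. \<phi> (c i - d i) * b i) = 0"
        by (simp add: rh_diff[OF assms] left_diff_distrib sum_subtractf)
      then have "\<forall>i. c i - d i = 0" using conjunct2[OF SI, rule_format, of "\<lambda>i. c i - d i"] by simp
      then show "c = d" by auto
    qed
  qed
qed

lemma basis_span:
  assumes "is_basis (act \<phi>) b" obtains c where "x = (\<Sum>i\<in>UNIV. \<phi> (c i) * b i)"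
  using assms unfolding is_basis_def act_def by blast

lemma basis_indep:
  assumes "ring_hom_map \<phi>" "is_basis (act \<phi>) b" "(\<Sum>i\<in>UNIV. \<phi> (c i) * b i) = 0"
  shows "c i = 0"
  using assms is_basis_act_iff by blast

lemma coords_eq:
  assumes "is_basis s b" shows "x = (\<Sum>i\<in>UNIV. s (coords s b x i) (b i))"
  unfolding coords_def by (rule theI'[OF spec[OF assms[unfolded is_basis_def], of x]])

lemma coords_unique:
  assumes "is_basis s b" "x = (\<Sum>i\<in>UNIV. s (c i) (b i))" shows "coords s b x = c"
  unfolding coords_def
  by (rule the1_equality[OF spec[OF assms(1)[unfolded is_basis_def], of x]]) (rule assms(2))

lemma coords_act:
  assumes "is_basis (act \<phi>) b" shows "x = (\<Sum>i\<in>UNIV. \<phi> (coords (act \<phi>) b x i) * b i)"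
  using coords_eq[OF assms, of x] by (simp add: act_def)

lemma coords_act_unique:
  assumes "is_basis (act \<phi>) b" "x = (\<Sum>i\<in>UNIV. \<phi> (c i) * b i)" shows "coords (act \<phi>) b x = c"
  using coords_unique[OF assms(1), of x c] assms(2) by (simp add: act_def)

lemma mult_matrix_column:
  assumes "is_basis (act \<phi>) b"
  shows "x * b j = (\<Sum>i\<in>UNIV. \<phi> (mult_matrix \<phi> b x $ i $ j) * b i)"
  using coords_act[OF assms, of "x * b j"] by (simp add: mult_matrix_def)

lemma mult_matrix_eqI:
  assumes "is_basis (act \<phi>) b" "\<And>j. x * b j = (\<Sum>i\<in>UNIV. \<phi> (M $ i $ j) * b i)"
  shows "mult_matrix \<phi> b x = M"
  unfolding mult_matrix_def using coords_act_unique[OF assms(1) assms(2)] by (simp add: vec_eq_iff)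

text \<open>The family whose coordinates are the columns of \<open>M\<close>, so that matrix identities can be read off
  from identities between families.\<close>

definition comb :: "('r::comm_ring_1 \<Rightarrow> 's::comm_ring_1) \<Rightarrow> ('n::finite \<Rightarrow> 's) \<Rightarrow> 'r ^ 'n ^ 'n \<Rightarrow> 'n \<Rightarrow> 's" where
  "comb \<phi> b M j = (\<Sum>i\<in>UNIV. \<phi> (M $ i $ j) * b i)"

lemma comb_comb:
  assumes \<phi>: "ring_hom_map \<phi>" shows "comb \<phi> (comb \<phi> b M) N = comb \<phi> b (M ** N)"
proof
  fix j
  have "comb \<phi> (comb \<phi> b M) N j = (\<Sum>i\<in>UNIV. \<Sum>m\<in>UNIV. \<phi> (N $ i $ j) * (\<phi> (M $ m $ i) * b m))"
    by (simp add: comb_def sum_distrib_left)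
  also have "\<dots> = (\<Sum>m\<in>UNIV. \<Sum>i\<in>UNIV. \<phi> (N $ i $ j) * (\<phi> (M $ m $ i) * b m))" by (rule sum.swap)
  also have "\<dots> = comb \<phi> b (M ** N) j"
    by (simp add: comb_def matrix_matrix_mult_def rh_simps[OF \<phi>] sum_distrib_left sum_distrib_right mult_ac)
  finally show "comb \<phi> (comb \<phi> b M) N j = comb \<phi> b (M ** N) j" .
qed

lemma comb_inj:
  assumes "is_basis (act \<phi>) b" "comb \<phi> b M = comb \<phi> b N" shows "M = N"
proof -
  have "coords (act \<phi>) b (comb \<phi> b P j) = (\<lambda>i. P $ i $ j)" for P j
    by (rule coords_act_unique[OF assms(1)]) (rule comb_def)
  then have "(\<lambda>i. M $ i $ j) = (\<lambda>i. N $ i $ j)" for j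
    using assms(2) by metis
  then show ?thesis by (simp add: vec_eq_iff fun_eq_iff)
qed

lemma comb_coords:
  assumes "is_basis (act \<phi>) b" shows "comb \<phi> b (\<chi> i j. coords (act \<phi>) b (x j) i) = x"
  using coords_act[OF assms] by (simp add: comb_def fun_eq_iff)

text \<open>The trace and the norm of a free algebra are defined through an arbitrarily chosen basis.  A
  change of basis conjugates the multiplication matrices, so every basis computes them.\<close>

lemma mult_matrix_conj:
  fixes b b' :: "'n::finite \<Rightarrow> 's::comm_ring_1"
  assumes \<phi>: "ring_hom_map \<phi>" and b: "is_basis (act \<phi>) b" and b': "is_basis (act \<phi>) b'"
  obtains M N where "M ** N = mat 1" "N ** M = mat 1"
    "\<And>x. mult_matrix \<phi> b' x = N ** mult_matrix \<phi> b x ** M"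
proof -
  obtain M N where M: "comb \<phi> b M = b'" and N: "comb \<phi> b' N = b"
    using comb_coords[OF b, of b'] comb_coords[OF b', of b] by blast
  have one: "comb \<phi> y (mat 1) = y" for y
    by (simp add: comb_def mat_def if_distrib[of \<phi>] rh_simps[OF \<phi>] if_distrib[of "\<lambda>x. x * _"] fun_eq_iff cong: if_cong)
  have MN: "M ** N = mat 1" by (rule comb_inj[OF b]) (simp add: comb_comb[OF \<phi>, symmetric] M N one)
  have NM: "N ** M = mat 1" by (rule comb_inj[OF b']) (simp add: comb_comb[OF \<phi>, symmetric] M N one)
  have "mult_matrix \<phi> b' x = N ** mult_matrix \<phi> b x ** M" for x
  proof -
    have mm: "comb \<phi> y (mult_matrix \<phi> y x) = (\<lambda>j. x * y j)" if "is_basis (act \<phi>) y" for y :: "'n \<Rightarrow> 's"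
      by (rule ext) (simp only: comb_def, rule mult_matrix_column[OF that, symmetric])
    have "comb \<phi> b (M ** mult_matrix \<phi> b' x) = (\<lambda>j. x * comb \<phi> b M j)"
      by (simp only: comb_comb[OF \<phi>, symmetric] M mm[OF b'])
    also have "\<dots> = comb \<phi> (\<lambda>j. x * b j) M" by (simp add: comb_def sum_distrib_left mult_ac fun_eq_iff)
    also have "\<dots> = comb \<phi> b (mult_matrix \<phi> b x ** M)" by (simp only: mm[OF b, symmetric] comb_comb[OF \<phi>])
    finally have "M ** mult_matrix \<phi> b' x = mult_matrix \<phi> b x ** M" by (rule comb_inj[OF b])
    then have "N ** (M ** mult_matrix \<phi> b' x) = N ** (mult_matrix \<phi> b x ** M)" by simp
    then show ?thesis by (simp add: matrix_mul_assoc NM)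
  qed
  then show ?thesis using that MN NM by blast
qed

lemma alg_trace_eq:
  fixes b :: "'n::finite \<Rightarrow> 's::comm_ring_1"
  assumes \<phi>: "ring_hom_map \<phi>" and b: "is_basis (act \<phi>) b"
  shows "alg_trace TYPE('n) \<phi> x = trace (mult_matrix \<phi> b x)"
proof -
  have b': "is_basis (act \<phi>) (SOME b :: 'n \<Rightarrow> 's. is_basis (act \<phi>) b)"
    by (rule someI[of "is_basis (act \<phi>)", OF b])
  obtain M N where MN: "M ** N = mat 1" "N ** M = mat 1"
    "\<And>x. mult_matrix \<phi> (SOME b :: 'n \<Rightarrow> 's. is_basis (act \<phi>) b) x = N ** mult_matrix \<phi> b x ** M"
    using mult_matrix_conj[OF \<phi> b b'] by blast
  have "trace (N ** mult_matrix \<phi> b x ** M) = trace (M ** (N ** mult_matrix \<phi> b x))"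
    by (rule trace_mul_sym)
  then show ?thesis
    unfolding alg_trace_def MN(3) by (simp add: matrix_mul_assoc MN)
qed

lemma alg_norm_eq:
  fixes b :: "'n::finite \<Rightarrow> 's::comm_ring_1"
  assumes \<phi>: "ring_hom_map \<phi>" and b: "is_basis (act \<phi>) b"
  shows "alg_norm TYPE('n) \<phi> x = det (mult_matrix \<phi> b x)"
proof -
  have b': "is_basis (act \<phi>) (SOME b :: 'n \<Rightarrow> 's. is_basis (act \<phi>) b)"
    by (rule someI[of "is_basis (act \<phi>)", OF b])
  obtain M N where MN: "M ** N = mat 1" "N ** M = mat 1"
    "\<And>x. mult_matrix \<phi> (SOME b :: 'n \<Rightarrow> 's. is_basis (act \<phi>) b) x = N ** mult_matrix \<phi> b x ** M"
    using mult_matrix_conj[OF \<phi> b b'] by blast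
  have "det M * det N = 1" using arg_cong[OF MN(1), of det] by (simp add: det_mul)
  then have "det N * (d * det M) = d" for d
    by (simp add: mult.left_commute mult.commute)
  then show ?thesis
    unfolding alg_norm_def MN(3) by (simp add: det_mul mult.assoc)
qed

text \<open>Homomorphisms \<open>g r\<close> to a field that split the algebra diagonalise its multiplication matrices:
  the diagonalising matrix consists of their values on a basis.  Traces at a place of the base field
  are read off from the places of the algebra in this way.\<close>

lemma alg_trace_split:
  fixes b :: "'n::finite \<Rightarrow> 's::comm_ring_1"
  assumes \<phi>: "ring_hom_map \<phi>" and b: "is_basis (act \<phi>) b"
    and h: "ring_hom_map h" and g: "\<And>r. ring_hom_map (g r)" "\<And>r c. g r (\<phi> c) = h c"
    and G: "det (\<chi> i r. g r (b i)) \<noteq> (0 :: 'f::field)"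
  shows "h (alg_trace TYPE('n) \<phi> x) = (\<Sum>r\<in>UNIV. g r x)"
proof -
  define Y where "Y = (\<chi> i j. h (mult_matrix \<phi> b x $ i $ j))"
  define P :: "'f^'n^'n" where "P = (\<chi> r i. g r (b i))"
  define L :: "'f^'n^'n" where "L = (\<chi> i j. if i = j then g i x else 0)"
  have "P ** Y = L ** P"
  proof -
    have "(P ** Y) $ r $ j = (L ** P) $ r $ j" for r j
    proof -
      have "(P ** Y) $ r $ j = g r (\<Sum>i\<in>UNIV. \<phi> (mult_matrix \<phi> b x $ i $ j) * b i)"
        by (simp add: P_def Y_def matrix_matrix_mult_def rh_simps[OF g(1)] g(2) mult.commute)
      also have "\<dots> = g r x * g r (b j)"
        using mult_matrix_column[OF b, of x j] rh_mult[OF g(1)] by metis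
      also have "\<dots> = (L ** P) $ r $ j"
        by (simp add: L_def P_def matrix_matrix_mult_def if_distrib[of "\<lambda>x. x * _"] cong: if_cong)
      finally show ?thesis .
    qed
    then show ?thesis by (simp add: vec_eq_iff)
  qed
  moreover have "det P \<noteq> 0"
  proof -
    have "P = transpose (\<chi> i r. g r (b i))" by (simp add: P_def transpose_def)
    then show ?thesis using G by (simp add: det_transpose)
  qed
  then obtain Q where Q: "Q ** P = mat 1" "P ** Q = mat 1"
    using invertible_det_nz[of P] unfolding invertible_def by blast
  ultimately have "Q ** (P ** Y) = Q ** (L ** P)" by simp
  then have "Y = Q ** (L ** P)" by (simp add: matrix_mul_assoc Q)
  then have "trace Y = trace ((L ** P) ** Q)" by (simp only: trace_mul_sym[of Q])
  also have "\<dots> = trace L" by (simp add: matrix_mul_assoc[symmetric] Q)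
  finally show ?thesis
    using rh_trace[OF h, of "mult_matrix \<phi> b x"]
    by (simp add: alg_trace_eq[OF \<phi> b] Y_def L_def trace_def)
qed

lemma alg_trace_base_change:
  fixes b :: "'n::finite \<Rightarrow> 's::comm_ring_1"
  assumes \<phi>: "ring_hom_map \<phi>" and b: "is_basis (act \<phi>) b"
    and \<psi>: "ring_hom_map \<psi>" and gb: "is_basis (act \<psi>) (\<lambda>i. g (b i))"
    and h: "ring_hom_map h" and g: "ring_hom_map g" "\<And>c. g (\<phi> c) = \<psi> (h c)"
  shows "alg_trace TYPE('n) \<psi> (g x) = h (alg_trace TYPE('n) \<phi> x)"
proof -
  have "mult_matrix \<psi> (\<lambda>i. g (b i)) (g x) = (\<chi> i j. h (mult_matrix \<phi> b x $ i $ j))"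
  proof (rule mult_matrix_eqI[OF gb])
    fix j
    have "g x * g (b j) = g (\<Sum>i\<in>UNIV. \<phi> (mult_matrix \<phi> b x $ i $ j) * b i)"
      using mult_matrix_column[OF b, of x j] rh_mult[OF g(1)] by metis
    also have "\<dots> = (\<Sum>i\<in>UNIV. \<psi> (h (mult_matrix \<phi> b x $ i $ j)) * g (b i))"
      by (simp add: rh_simps[OF g(1)] g(2))
    finally show "g x * g (b j) = (\<Sum>i\<in>UNIV. \<psi> ((\<chi> i j. h (mult_matrix \<phi> b x $ i $ j)) $ i $ j) * g (b i))"
      by simp
  qed
  then show ?thesis
    using alg_trace_eq[OF \<psi> gb] alg_trace_eq[OF \<phi> b] rh_trace[OF h] by metis
qed

section \<open>Tensor products\<close>

lemma
  assumes "is_tensor_product \<phi>A \<phi>B iA iB"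
  shows tp_rhA: "ring_hom_map \<phi>A" and tp_rhB: "ring_hom_map \<phi>B"
    and tp_rh1: "ring_hom_map iA" and tp_rh2: "ring_hom_map iB"
    and tp_compat: "iA (\<phi>A c) = iB (\<phi>B c)"
    and tp_generated: "\<exists>(n::nat) a b. t = (\<Sum>m<n. iA (a m) * iB (b m))"
  using assms unfolding is_tensor_product_def by auto

lemma tp_independent:
  fixes a :: "'n::finite \<Rightarrow> 'a::comm_ring_1"
  assumes tp: "is_tensor_product \<phi>A \<phi>B iA iB"
    and ind: "\<And>c. (\<Sum>i\<in>UNIV. \<phi>A (c i) * a i) = 0 \<Longrightarrow> \<forall>i. c i = 0"
    and eq: "(\<Sum>i\<in>UNIV. iA (a i) * iB (b i)) = 0"
  shows "b i = 0"
proof -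
  obtain e where e: "bij_betw e {0..<CARD('n)} (UNIV :: 'n set)"
    using ex_bij_betw_nat_finite[of "UNIV :: 'n set"] by auto
  then have e: "bij_betw e {..<CARD('n)} (UNIV :: 'n set)" by (simp add: lessThan_atLeast0)
  have re: "(\<Sum>m<CARD('n). f (e m)) = sum f UNIV" for f :: "'n \<Rightarrow> 'z::comm_monoid_add"
    by (rule sum.reindex_bij_betw[OF e])
  have "(\<forall>c. (\<Sum>m<CARD('n). \<phi>A (c m) * a (e m)) = 0 \<longrightarrow> (\<forall>m<CARD('n). c m = 0))"
  proof (intro allI impI)
    fix c m assume s: "(\<Sum>m<CARD('n). \<phi>A (c m) * a (e m)) = 0" and m: "m < CARD('n)"
    define d where "d = (\<lambda>i. c (inv_into {..<CARD('n)} e i))"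
    have d: "d (e m) = c m" if "m < CARD('n)" for m
      using e that by (simp add: d_def bij_betw_def)
    have "(\<Sum>i\<in>UNIV. \<phi>A (d i) * a i) = (\<Sum>m<CARD('n). \<phi>A (d (e m)) * a (e m))"
      by (simp add: re[of "\<lambda>i. \<phi>A (d i) * a i"])
    also have "\<dots> = 0" using s d by simp
    finally have "d (e m) = 0" using ind by blast
    then show "c m = 0" using d m by simp
  qed
  moreover have "(\<Sum>m<CARD('n). iA (a (e m)) * iB (b (e m))) = 0"
    using eq re[of "\<lambda>i. iA (a i) * iB (b i)"] by simp
  ultimately have "\<forall>m<CARD('n). b (e m) = 0"
    using tp unfolding is_tensor_product_def
    by (elim conjE) (drule spec[of _ "CARD('n)"], drule spec[of _ "\<lambda>m. a (e m)"], drule spec[of _ "\<lambda>m. b (e m)"], simp)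
  moreover obtain m where "m < CARD('n)" "e m = i"
    using e unfolding bij_betw_def by (metis UNIV_I imageE lessThan_iff)
  ultimately show ?thesis by blast
qed

lemma tp_basis:
  fixes b :: "'n::finite \<Rightarrow> 'a::comm_ring_1"
  assumes tp: "is_tensor_product \<phi>A \<phi>B iA iB" and b: "is_basis (act \<phi>A) b"
  shows "is_basis (act iB) (\<lambda>i. iA (b i))"
proof (subst is_basis_act_iff[OF tp_rh2[OF tp]], intro conjI allI impI)
  fix t
  obtain n :: nat and a \<beta> where t: "t = (\<Sum>m<n. iA (a m) * iB (\<beta> m))"
    using tp_generated[OF tp] by blast
  have a: "iA x * iB y = (\<Sum>i\<in>UNIV. iB (\<phi>B (coords (act \<phi>A) b x i) * y) * iA (b i))" for x y
  proof -
    have "iA x = iA (\<Sum>i\<in>UNIV. \<phi>A (coords (act \<phi>A) b x i) * b i)" using coords_act[OF b, of x] by simp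
    also have "\<dots> = (\<Sum>i\<in>UNIV. iB (\<phi>B (coords (act \<phi>A) b x i)) * iA (b i))"
      by (simp add: rh_simps[OF tp_rh1[OF tp]] tp_compat[OF tp])
    finally show ?thesis by (simp add: sum_distrib_left sum_distrib_right rh_simps[OF tp_rh2[OF tp]] mult_ac)
  qed
  have "t = (\<Sum>i\<in>UNIV. iB (\<Sum>m<n. \<phi>B (coords (act \<phi>A) b (a m) i) * \<beta> m) * iA (b i))"
    by (simp add: t a) (subst sum.swap, simp add: rh_simps[OF tp_rh2[OF tp]] sum_distrib_right)
  then show "\<exists>c. t = (\<Sum>i\<in>UNIV. iB (c i) * iA (b i))"
    by (rule exI[of _ "\<lambda>i. \<Sum>m<n. \<phi>B (coords (act \<phi>A) b (a m) i) * \<beta> m"])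
next
  fix c i assume "(\<Sum>i\<in>UNIV. iB (c i) * iA (b i)) = 0"
  then have "(\<Sum>i\<in>UNIV. iA (b i) * iB (c i)) = 0" by (simp add: mult.commute)
  then show "c i = 0"
    using tp_independent[OF tp] basis_indep[OF tp_rhA[OF tp] b] by blast
qed

text \<open>The definition of a tensor product treats the factors differently.  Expanding the coefficients of a
  vanishing combination in a basis of the first factor reduces the second factor to the defining
  independence property.\<close>

lemma tp_basis_right:
  fixes b :: "'n::finite \<Rightarrow> 'a::comm_ring_1" and c :: "'m::finite \<Rightarrow> 'b::comm_ring_1"
  assumes tp: "is_tensor_product \<phi>A \<phi>B iA iB" and b: "is_basis (act \<phi>A) b"
    and c: "is_basis (act \<phi>B) c"
  shows "is_basis (act iA) (\<lambda>j. iB (c j))"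
proof -
  note h1 = tp_rh1[OF tp] and h2 = tp_rh2[OF tp]
  show ?thesis
  proof (subst is_basis_act_iff[OF h1], intro conjI allI impI)
    fix t
    obtain y where t: "t = (\<Sum>i\<in>UNIV. iB (y i) * iA (b i))" by (rule basis_span[OF tp_basis[OF tp b]])
    let ?y = "\<lambda>i j. coords (act \<phi>B) c (y i) j"
    have "iB (y i) = iB (\<Sum>j\<in>UNIV. \<phi>B (?y i j) * c j)" for i using coords_act[OF c, of "y i"] by simp
    then have "t = (\<Sum>i\<in>UNIV. \<Sum>j\<in>UNIV. iA (\<phi>A (?y i j) * b i) * iB (c j))"
      by (simp add: t rh_simps[OF h1] rh_simps[OF h2] tp_compat[OF tp] sum_distrib_right sum_distrib_left mult_ac)
    then have "t = (\<Sum>j\<in>UNIV. iA (\<Sum>i\<in>UNIV. \<phi>A (?y i j) * b i) * iB (c j))"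
      by (subst (asm) sum.swap) (simp add: rh_simps[OF h1] sum_distrib_right)
    then show "\<exists>d. t = (\<Sum>j\<in>UNIV. iA (d j) * iB (c j))"
      by (rule exI[of _ "\<lambda>j. \<Sum>i\<in>UNIV. \<phi>A (?y i j) * b i"])
  next
    fix d j assume eq: "(\<Sum>j\<in>UNIV. iA (d j) * iB (c j)) = 0"
    let ?x = "\<lambda>j i. coords (act \<phi>A) b (d j) i"
    have "iA (d j) = iA (\<Sum>i\<in>UNIV. \<phi>A (?x j i) * b i)" for j using coords_act[OF b, of "d j"] by simp
    then have "(\<Sum>j\<in>UNIV. \<Sum>i\<in>UNIV. iA (b i) * iB (\<phi>B (?x j i) * c j)) = 0"
      using eq by (simp add: rh_simps[OF h1] rh_simps[OF h2] tp_compat[OF tp] sum_distrib_right sum_distrib_left mult_ac)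
    then have "(\<Sum>i\<in>UNIV. iA (b i) * iB (\<Sum>j\<in>UNIV. \<phi>B (?x j i) * c j)) = 0"
      by (subst (asm) sum.swap) (simp add: rh_simps[OF h2] sum_distrib_left)
    then have "(\<Sum>j\<in>UNIV. \<phi>B (?x j i) * c j) = 0" for i
      by (rule tp_independent[OF tp, rotated]) (use basis_indep[OF tp_rhA[OF tp] b] in blast)
    then have "?x j i = 0" for i
      using basis_indep[OF tp_rhB[OF tp] c, of "\<lambda>j. ?x j i"] by blast
    then show "d j = 0"
      using coords_act[OF b, of "d j"] by (simp add: rh_simps[OF tp_rhA[OF tp]])
  qed
qed

lemma vector_space_act: "ring_hom_map (\<phi> :: 'k::field \<Rightarrow> 'a::comm_ring_1) \<Longrightarrow> vector_space (act \<phi>)"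
  by unfold_locales (auto simp: act_def rh_simps algebra_simps)

lemma dual_functional:
  fixes \<phi> :: "'k::field \<Rightarrow> 'a::comm_ring_1" and a :: "nat \<Rightarrow> 'a"
  assumes \<phi>: "ring_hom_map \<phi>"
    and ind: "\<forall>c. (\<Sum>m<n. \<phi> (c m) * a m) = 0 \<longrightarrow> (\<forall>m<n. c m = 0)" and l: "l < n"
  obtains g where "Vector_Spaces.linear (act \<phi>) (*) g" "\<And>m. m < n \<Longrightarrow> g (a m) = (if m = l then 1 else 0)"
proof -
  interpret V: vector_space "act \<phi>" by (rule vector_space_act[OF \<phi>])
  interpret W: vector_space "(*) :: 'k \<Rightarrow> 'k \<Rightarrow> 'k"
    by unfold_locales (auto simp: algebra_simps)
  interpret P: vector_space_pair "act \<phi>" "(*) :: 'k \<Rightarrow> 'k \<Rightarrow> 'k" ..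
  have inj: "inj_on a {..<n}"
  proof (rule inj_onI, rule ccontr)
    fix i j assume ij: "i \<in> {..<n}" "j \<in> {..<n}" "a i = a j" "i \<noteq> j"
    define c where "c = (\<lambda>m. if m = i then 1 else if m = j then -1 else (0::'k))"
    have "(\<Sum>m<n. \<phi> (c m) * a m) = (\<Sum>m\<in>{i,j}. \<phi> (c m) * a m)"
      using ij by (intro sum.mono_neutral_right) (auto simp: c_def rh_simps[OF \<phi>])
    also have "\<dots> = 0" using ij by (simp add: c_def rh_simps[OF \<phi>])
    finally have "c i = 0" using ind ij by blast
    then show False by (simp add: c_def)
  qed
  have "V.independent (a ` {..<n})"
  proof (rule V.independent_if_scalars_zero)
    fix u x assume "(\<Sum>x\<in>a ` {..<n}. act \<phi> (u x) x) = 0" and x: "x \<in> a ` {..<n}"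
    then have "(\<Sum>m<n. \<phi> (u (a m)) * a m) = 0"
      by (simp add: sum.reindex[OF inj] act_def)
    then have "\<forall>m<n. u (a m) = 0" using ind[rule_format, of "\<lambda>m. u (a m)"] by simp
    then show "u x = 0" using x by auto
  qed simp
  from P.linear_independent_extend[OF this, of "\<lambda>x. if x = a l then 1 else 0"]
  obtain g where "Vector_Spaces.linear (act \<phi>) (*) g"
    "\<forall>x\<in>a ` {..<n}. g x = (if x = a l then 1 else 0)" by blast
  moreover have "a m = a l \<longleftrightarrow> m = l" if "m < n" for m
    using inj l that by (auto dest: inj_onD)
  ultimately show ?thesis using that by auto
qed

text \<open>A tensor product over a field is recognised on one basis.  The point is that linear independence
  survives the extension of scalars: a linearly independent family has dual functionals, and their
  values on the basis can be mapped to the larger ring.\<close>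

lemma tp_from_basis:
  fixes b :: "'n::finite \<Rightarrow> 'a::comm_ring_1" and \<phi>A :: "'k::field \<Rightarrow> 'a"
  assumes h: "ring_hom_map \<phi>A" "ring_hom_map \<phi>B" "ring_hom_map iA" "ring_hom_map iB"
    and c: "\<And>c. iA (\<phi>A c) = iB (\<phi>B c)"
    and b: "is_basis (act \<phi>A) b" and ib: "is_basis (act iB) (\<lambda>i. iA (b i))"
  shows "is_tensor_product \<phi>A \<phi>B iA iB"
  unfolding is_tensor_product_def
proof (intro conjI allI impI h c)
  fix t
  obtain d where d: "t = (\<Sum>i\<in>UNIV. iB (d i) * iA (b i))" using basis_span[OF ib] .
  obtain e where e: "bij_betw e {0..<CARD('n)} (UNIV :: 'n set)"
    using ex_bij_betw_nat_finite[of "UNIV :: 'n set"] by auto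
  then have e: "bij_betw e {..<CARD('n)} (UNIV :: 'n set)" by (simp add: lessThan_atLeast0)
  have "t = (\<Sum>m<CARD('n). iA (b (e m)) * iB (d (e m)))"
    using sum.reindex_bij_betw[OF e, of "\<lambda>i. iB (d i) * iA (b i)"] d by (simp add: mult.commute)
  then show "\<exists>(n::nat) a b. t = (\<Sum>m<n. iA (a m) * iB (b m))"
    by (intro exI[of _ "CARD('n)"] exI[of _ "\<lambda>m. b (e m)"] exI[of _ "\<lambda>m. d (e m)"])
next
  fix n :: nat and a \<beta> l
  assume ind: "\<forall>c. (\<Sum>m<n. \<phi>A (c m) * a m) = 0 \<longrightarrow> (\<forall>m<n. c m = 0)"
    and eq: "(\<Sum>m<n. iA (a m) * iB (\<beta> m)) = 0" and l: "l < n"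
  obtain g where g: "Vector_Spaces.linear (act \<phi>A) (*) g" "\<And>m. m < n \<Longrightarrow> g (a m) = (if m = l then 1 else 0)"
    using dual_functional[OF h(1) ind l] by blast
  interpret g: Vector_Spaces.linear "act \<phi>A" "(*)" g by (rule g(1))
  let ?x = "\<lambda>m i. coords (act \<phi>A) b (a m) i"
  have a: "a m = (\<Sum>i\<in>UNIV. \<phi>A (?x m i) * b i)" for m by (rule coords_act[OF b])
  have "iA (a m) = (\<Sum>i\<in>UNIV. iB (\<phi>B (?x m i)) * iA (b i))" for m
    by (subst a) (simp add: rh_simps[OF h(3)] c)
  then have "(\<Sum>m<n. \<Sum>i\<in>UNIV. iB (\<phi>B (?x m i) * \<beta> m) * iA (b i)) = 0"
    using eq by (simp add: sum_distrib_left sum_distrib_right rh_simps[OF h(4)] mult_ac)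
  then have "(\<Sum>i\<in>UNIV. iB (\<Sum>m<n. \<phi>B (?x m i) * \<beta> m) * iA (b i)) = 0"
    by (subst (asm) sum.swap) (simp add: sum_distrib_right rh_simps[OF h(4)])
  then have 0: "(\<Sum>m<n. \<phi>B (?x m i) * \<beta> m) = 0" for i
    by (rule basis_indep[OF h(4) ib])
  have ga: "g (a m) = (\<Sum>i\<in>UNIV. ?x m i * g (b i))" for m
    by (subst a) (simp add: g.sum g.scale[unfolded act_def])
  have "\<beta> l = (\<Sum>m<n. \<phi>B (g (a m)) * \<beta> m)"
    using g(2) l by (simp add: if_distrib[of \<phi>B] if_distrib[of "\<lambda>x. x * _"] rh_simps[OF h(2)] cong: if_cong)
  also have "\<dots> = (\<Sum>m<n. \<Sum>i\<in>UNIV. \<phi>B (g (b i)) * (\<phi>B (?x m i) * \<beta> m))"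
    by (simp add: ga rh_simps[OF h(2)] sum_distrib_left sum_distrib_right mult_ac)
  also have "\<dots> = (\<Sum>i\<in>UNIV. \<phi>B (g (b i)) * (\<Sum>m<n. \<phi>B (?x m i) * \<beta> m))"
    by (subst sum.swap) (simp add: sum_distrib_left)
  also have "\<dots> = 0" by (simp add: 0)
  finally show "\<beta> l = 0" .
qed

text \<open>The universal property.  The homomorphism is defined by coordinates with respect to a basis of the
  first factor, and it is multiplicative because it is so on the generating pure tensors.\<close>

lemma tp_universal:
  fixes b :: "'n::finite \<Rightarrow> 'a::comm_ring_1"
  assumes tp: "is_tensor_product \<phi>A \<phi>B iA iB" and b: "is_basis (act \<phi>A) b"
    and p: "ring_hom_map p" and q: "ring_hom_map q" and pq: "\<And>c. p (\<phi>A c) = q (\<phi>B c)"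
  obtains g where "ring_hom_map g" "\<And>x. g (iA x) = p x" "\<And>y. g (iB y) = q y"
proof -
  note B = tp_basis[OF tp b]
  note h1 = tp_rh1[OF tp] and h2 = tp_rh2[OF tp]
  define g where "g t = (\<Sum>i\<in>UNIV. q (coords (act iB) (\<lambda>i. iA (b i)) t i) * p (b i))" for t
  have gI: "g t = (\<Sum>i\<in>UNIV. q (d i) * p (b i))" if "t = (\<Sum>i\<in>UNIV. iB (d i) * iA (b i))" for t d
    using coords_act_unique[OF B that] by (simp add: g_def)
  have add: "g (s + t) = g s + g t" for s t
  proof -
    obtain d e where "s = (\<Sum>i\<in>UNIV. iB (d i) * iA (b i))" "t = (\<Sum>i\<in>UNIV. iB (e i) * iA (b i))"
      using basis_span[OF B] by metis
    then show ?thesis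
      using gI[of s d] gI[of t e] gI[of "s + t" "\<lambda>i. d i + e i"]
      by (simp add: rh_simps[OF h2] rh_simps[OF q] distrib_right sum.distrib)
  qed
  have pure: "g (iA x * iB y) = p x * q y" for x y
  proof -
    have x: "x = (\<Sum>i\<in>UNIV. \<phi>A (coords (act \<phi>A) b x i) * b i)" by (rule coords_act[OF b])
    have "iA x * iB y = (\<Sum>i\<in>UNIV. iB (\<phi>B (coords (act \<phi>A) b x i) * y) * iA (b i))"
      by (subst x) (simp add: rh_simps[OF h1] rh_simps[OF h2] tp_compat[OF tp] sum_distrib_left sum_distrib_right mult_ac)
    then have "g (iA x * iB y) = (\<Sum>i\<in>UNIV. q (\<phi>B (coords (act \<phi>A) b x i) * y) * p (b i))" by (rule gI)
    also have "\<dots> = p (\<Sum>i\<in>UNIV. \<phi>A (coords (act \<phi>A) b x i) * b i) * q y"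
      by (simp add: rh_simps[OF p] rh_simps[OF q] pq sum_distrib_left sum_distrib_right mult_ac)
    finally show ?thesis using x by simp
  qed
  have g0: "g 0 = 0" using add[of 0 0] by simp
  have gsum: "g (sum f A) = (\<Sum>i\<in>A. g (f i))" for f :: "nat \<Rightarrow> _" and A
    by (induction A rule: infinite_finite_induct) (auto simp: g0 add)
  have mult: "g (s * t) = g s * g t" for s t
  proof -
    obtain n :: nat and a \<beta> where s: "s = (\<Sum>m<n. iA (a m) * iB (\<beta> m))" using tp_generated[OF tp] by blast
    obtain n' :: nat and a' \<beta>' where t: "t = (\<Sum>m<n'. iA (a' m) * iB (\<beta>' m))" using tp_generated[OF tp] by blast
    have "s * t = (\<Sum>m<n. \<Sum>l<n'. iA (a m * a' l) * iB (\<beta> m * \<beta>' l))"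
      unfolding s t sum_product
      by (intro sum.cong refl) (simp add: rh_simps[OF h1] rh_simps[OF h2] mult_ac)
    then have "g (s * t) = (\<Sum>m<n. \<Sum>l<n'. (p (a m) * q (\<beta> m)) * (p (a' l) * q (\<beta>' l)))"
      by (simp add: gsum pure rh_simps[OF p] rh_simps[OF q] mult_ac)
    also have "\<dots> = g s * g t" by (simp add: s t gsum pure sum_product)
    finally show ?thesis .
  qed
  have 1: "g (iA x) = p x" for x using pure[of x 1] by (simp add: rh_1[OF h2] rh_1[OF q])
  have 2: "g (iB y) = q y" for y using pure[of 1 y] by (simp add: rh_1[OF h1] rh_1[OF p])
  have "g 1 = 1" using 1[of 1] by (simp add: rh_1[OF h1] rh_1[OF p])
  then have "ring_hom_map g" using add mult by (intro ring_hom_mapI) auto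
  then show ?thesis using that 1 2 by blast
qed

lemma tp_hom_eq:
  assumes tp: "is_tensor_product \<phi>A \<phi>B iA iB" and g: "ring_hom_map g" "ring_hom_map g'"
    and "\<And>x. g (iA x) = g' (iA x)" "\<And>y. g (iB y) = g' (iB y)"
  shows "g t = g' t"
proof -
  obtain n :: nat and a \<beta> where "t = (\<Sum>m<n. iA (a m) * iB (\<beta> m))" using tp_generated[OF tp] by blast
  then show ?thesis using assms(4,5) by (simp add: rh_simps[OF g(1)] rh_simps[OF g(2)])
qed

section \<open>Etale algebras\<close>

lemma finite_bad_multiples:
  fixes u u' v v' :: "'f::field_char_0"
  assumes "u \<noteq> u' \<or> v \<noteq> v'"
  shows "finite {c::nat. u + of_nat c * v = u' + of_nat c * v'}"
proof (cases "v = v'")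
  case True
  then have "{c::nat. u + of_nat c * v = u' + of_nat c * v'} = {}" using assms by auto
  then show ?thesis by (simp only: finite.emptyI)
next
  case False
  have "c = c'" if "u + of_nat c * v = u' + of_nat c * v'" "u + of_nat c' * v = u' + of_nat c' * v'" for c c' :: nat
  proof -
    have "(of_nat c - of_nat c') * (v - v') = (u + of_nat c * v) - (u + of_nat c' * v) - (u' + of_nat c * v') + (u' + of_nat c' * v')"
      by (simp add: algebra_simps)
    also have "\<dots> = 0" using that by simp
    finally show ?thesis using False by simp
  qed
  then have "{c::nat. u + of_nat c * v = u' + of_nat c * v'} \<subseteq> {SOME c. u + of_nat c * v = u' + of_nat c * v'}"
    by (metis (mono_tags, lifting) CollectD insertI1 someI subsetI)
  then show ?thesis by (rule finite_subset) simp
qed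

text \<open>An etale algebra has a primitive element: the finitely many coincidences between the split
  coordinates of \<open>\<xi> + c * w\<close> are avoided by some natural number \<open>c\<close>.\<close>

lemma etale_separating:
  fixes \<phi> :: "'k::field_char_0 \<Rightarrow> 'a::comm_ring_1"
  assumes "is_tensor_product \<phi> to_ac f (\<lambda>z. \<chi> (i::'n::finite). z)"
  obtains \<xi> where "inj (\<lambda>i. f \<xi> $ i)"
proof -
  note f = tp_rh1[OF assms]
  define F where "F i x = f x $ i" for i x
  have F: "ring_hom_map (F i)" for i
    unfolding F_def by (rule rh_compose[OF f rh_component])
  have F\<phi>: "F i (\<phi> c) = to_ac c" for i c by (simp add: F_def tp_compat[OF assms])
  have sep: "\<exists>e. F i e \<noteq> F j e" if "i \<noteq> j" for i j
  proof (rule ccontr)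
    assume eq: "\<nexists>e. F i e \<noteq> F j e"
    have "t $ i = t $ j" for t :: "'k alg_closure ^ 'n"
    proof -
      obtain n :: nat and a \<beta> where "t = (\<Sum>m<n. f (a m) * (\<chi> i. \<beta> m))"
        using tp_generated[OF assms] by blast
      then show ?thesis using eq by (simp add: F_def)
    qed
    from this[of "axis i 1"] show False using that by (simp add: axis_def)
  qed
  have "\<exists>\<xi>. \<forall>(i,j)\<in>S. F i \<xi> \<noteq> F j \<xi>" if "finite S" "\<forall>(i,j)\<in>S. i \<noteq> j" for S
    using that
  proof (induction S rule: finite_induct)
    case (insert p S)
    obtain \<xi> where \<xi>: "\<forall>(i,j)\<in>S. F i \<xi> \<noteq> F j \<xi>" using insert by auto
    obtain w where w: "F (fst p) w \<noteq> F (snd p) w" using sep[of "fst p" "snd p"] insert by auto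
    define bad where "bad = (\<lambda>q. {c::nat. F (fst q) \<xi> + of_nat c * F (fst q) w = F (snd q) \<xi> + of_nat c * F (snd q) w})"
    have "finite (bad q)" if "q \<in> insert p S" for q
      unfolding bad_def using that \<xi> w by (intro finite_bad_multiples) auto
    then have "finite (\<Union>q\<in>insert p S. bad q)" using insert.hyps by blast
    then obtain c where c: "c \<notin> (\<Union>q\<in>insert p S. bad q)" using ex_new_if_finite infinite_UNIV_nat by blast
    have "F i (\<xi> + \<phi> (of_nat c) * w) = F i \<xi> + of_nat c * F i w" for i
      by (simp add: rh_simps[OF F] F\<phi>)
    then have "\<forall>(i,j)\<in>insert p S. F i (\<xi> + \<phi> (of_nat c) * w) \<noteq> F j (\<xi> + \<phi> (of_nat c) * w)"
      using c by (auto simp: bad_def)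
    then show ?case by blast
  qed auto
  from this[of "{(i,j). i \<noteq> j}"] obtain \<xi> where "\<forall>(i,j)\<in>{(i,j). i \<noteq> j}. F i \<xi> \<noteq> F j \<xi>" by auto
  then have "inj (\<lambda>i. f \<xi> $ i)" by (auto simp: inj_on_def F_def)
  then show ?thesis using that by blast
qed

lemma poly_eq_sum_less:
  fixes p :: "'f::field poly"
  assumes "degree p < n" shows "poly p x = (\<Sum>m<n. coeff p m * x ^ m)"
proof -
  have "poly p x = (\<Sum>m\<le>degree p. coeff p m * x ^ m)" by (rule poly_altdef)
  also have "\<dots> = (\<Sum>m<n. coeff p m * x ^ m)"
    using assms by (intro sum.mono_neutral_left) (auto simp: coeff_eq_0)
  finally show ?thesis .
qed

lemma interpolation:
  fixes v :: "'f::field \<Rightarrow> 'f"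
  assumes "finite S" "S \<noteq> {}"
  shows "\<exists>p. degree p < card S \<and> (\<forall>x\<in>S. poly p x = v x)"
  using assms
proof (induction S rule: finite_ne_induct)
  case (singleton a)
  then show ?case by (intro exI[of _ "[:v a:]"]) auto
next
  case (insert a S)
  then obtain p where p: "degree p < card S" "\<forall>x\<in>S. poly p x = v x" by auto
  define q where "q = (\<Prod>x\<in>S. [:-x, 1:])"
  have "degree q \<le> card S"
    unfolding q_def by (rule order.trans[OF degree_prod_sum_le]) (use insert in auto)
  have qa: "poly q a \<noteq> 0" using insert by (auto simp: q_def poly_prod)
  have qS: "poly q x = 0" if "x \<in> S" for x using insert that by (auto simp: q_def poly_prod)
  define r where "r = p + [:(v a - poly p a) / poly q a:] * q"
  have "degree r \<le> card S"
    unfolding r_def using p(1) \<open>degree q \<le> card S\<close> by (intro degree_add_le) (auto intro: order.trans[OF degree_mult_le])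
  moreover have "poly r x = v x" if "x \<in> insert a S" for x
    using that p(2) qa qS by (auto simp: r_def)
  ultimately show ?case using insert by (intro exI[of _ r]) auto
qed

text \<open>The powers of a primitive element below the degree are a basis.  They are independent because a
  polynomial of smaller degree does not vanish at all the coordinates of \<open>\<xi>\<close>.  They span: by
  interpolation the split image of \<open>x\<close> is a combination of theirs over the algebraic closure, and a
  dependence over the closure comes from one over the base field.\<close>

lemma etale_powers:
  fixes \<phi> :: "'k::field_char_0 \<Rightarrow> 'a::comm_ring_1"
  assumes tp: "is_tensor_product \<phi> to_ac f (\<lambda>z. \<chi> (i::'n::finite). z)"
    and inj: "inj (\<lambda>i. f \<xi> $ i)"
  shows "(\<Sum>m<CARD('n). \<phi> (c m) * \<xi> ^ m) = 0 \<Longrightarrow> m < CARD('n) \<Longrightarrow> c m = 0"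
    and "\<exists>c. x = (\<Sum>m<CARD('n). \<phi> (c m) * \<xi> ^ m)"
proof -
  note f = tp_rh1[OF tp]
  define F where "F i x = f x $ i" for i x
  have F: "ring_hom_map (F i)" for i
    unfolding F_def by (rule rh_compose[OF f rh_component])
  have F\<phi>: "F i (\<phi> c) = to_ac c" for i c by (simp add: F_def tp_compat[OF tp])
  have card: "card (range (\<lambda>i. F i \<xi>)) = CARD('n)"
    using inj by (simp add: F_def card_image)
  show ind: "c m = 0" if 0: "(\<Sum>m<CARD('n). \<phi> (c m) * \<xi> ^ m) = 0" and m: "m < CARD('n)" for c m
  proof -
    define q where "q = (\<Sum>m<CARD('n). monom (to_ac (c m)) m)"
    have dq: "degree q < CARD('n)"
    proof -
      have "degree q \<le> CARD('n) - 1" unfolding q_def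
        by (rule degree_sum_le) (auto intro!: order.trans[OF degree_monom_le])
      moreover have "CARD('n) > 0" by simp
      ultimately show ?thesis by linarith
    qed
    have "poly q (F i \<xi>) = F i (\<Sum>m<CARD('n). \<phi> (c m) * \<xi> ^ m)" for i
      by (simp add: q_def poly_sum poly_monom rh_simps[OF F] F\<phi>)
    then have "range (\<lambda>i. F i \<xi>) \<subseteq> {x. poly q x = 0}" using 0 by (auto simp: rh_0[OF F])
    then have "q = 0"
      using card_mono[OF poly_roots_finite[of q], of "range (\<lambda>i. F i \<xi>)"] card_poly_roots_bound[of q] dq card
      by fastforce
    then have "coeff q m = 0" by simp
    then show "c m = 0" using m by (simp add: q_def coeff_sum if_distrib cong: if_cong)
  qed
  show "\<exists>c. x = (\<Sum>m<CARD('n). \<phi> (c m) * \<xi> ^ m)"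
  proof -
    obtain p where p: "degree p < CARD('n)" "\<forall>z\<in>range (\<lambda>i. F i \<xi>). poly p z = F (inv_into UNIV (\<lambda>i. F i \<xi>) z) x"
      using interpolation[of "range (\<lambda>i. F i \<xi>)" "\<lambda>z. F (inv_into UNIV (\<lambda>i. F i \<xi>) z) x"] card by auto
    have inj': "inj (\<lambda>i. F i \<xi>)" using inj by (simp add: F_def)
    have p': "poly p (F i \<xi>) = F i x" for i
      using p(2) inv_f_f[OF inj', of i] by auto
    define a where "a = (\<lambda>m. if m < CARD('n) then \<xi> ^ m else x)"
    define \<beta> where "\<beta> = (\<lambda>m. if m < CARD('n) then coeff p m else -1)"
    have "(\<Sum>m<Suc (CARD('n)). f (a m) * (\<chi> i. \<beta> m)) = 0"
    proof -
      have "(\<Sum>m<Suc (CARD('n)). f (a m) * (\<chi> i. \<beta> m)) $ i = poly p (F i \<xi>) - F i x" for i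
      proof -
        have "(\<Sum>m<Suc (CARD('n)). f (a m) * (\<chi> i. \<beta> m)) $ i = (\<Sum>m<CARD('n). F i (\<xi> ^ m) * coeff p m) - F i x"
          by (simp add: a_def \<beta>_def F_def)
        also have "\<dots> = poly p (F i \<xi>) - F i x"
          by (simp add: poly_eq_sum_less[OF p(1)] rh_power[OF F] mult.commute)
        finally show ?thesis .
      qed
      then show ?thesis by (simp add: vec_eq_iff p' del: sum.lessThan_Suc)
    qed
    moreover have "\<not> (\<forall>m<Suc (CARD('n)). \<beta> m = 0)" by (auto simp: \<beta>_def intro!: exI[of _ "CARD('n)"])
    ultimately have "\<not> (\<forall>c. (\<Sum>m<Suc (CARD('n)). \<phi> (c m) * a m) = 0 \<longrightarrow> (\<forall>m<Suc (CARD('n)). c m = 0))"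
      using tp unfolding is_tensor_product_def by (elim conjE) (drule spec[of _ "Suc (CARD('n))"], drule spec[of _ a], drule spec[of _ \<beta>], blast)
    then obtain c l where c: "(\<Sum>m<Suc (CARD('n)). \<phi> (c m) * a m) = 0" "l < Suc (CARD('n))" "c l \<noteq> 0" by blast
    let ?n = "CARD('n)"
    have c1: "(\<Sum>m<?n. \<phi> (c m) * \<xi> ^ m) + \<phi> (c ?n) * x = 0" using c(1) by (simp add: a_def)
    have cn: "c ?n \<noteq> 0"
    proof
      assume "c ?n = 0"
      then have "(\<Sum>m<?n. \<phi> (c m) * \<xi> ^ m) = 0" using c1 by (simp add: rh_0[OF tp_rhA[OF tp]])
      then have "c l = 0" if "l < ?n" for l using ind that by blast
      then show False using c(2,3) \<open>c ?n = 0\<close> less_Suc_eq by metis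
    qed
    have "\<phi> (inverse (c ?n)) * \<phi> (c ?n) = 1"
      using cn rh_mult[OF tp_rhA[OF tp], of "inverse (c ?n)" "c ?n"] rh_1[OF tp_rhA[OF tp]] by simp
    then have "x = \<phi> (inverse (c ?n)) * (\<phi> (c ?n) * x)" by (simp add: mult.assoc[symmetric])
    also have "\<phi> (c ?n) * x = - (\<Sum>m<?n. \<phi> (c m) * \<xi> ^ m)" using c1 by (simp add: eq_neg_iff_add_eq_0 add.commute)
    also have "\<phi> (inverse (c ?n)) * \<dots> = (\<Sum>m<?n. \<phi> (- inverse (c ?n) * c m) * \<xi> ^ m)"
      by (simp add: rh_simps[OF tp_rhA[OF tp]] sum_distrib_left sum_negf mult_ac)
    finally show ?thesis by (rule exI[of _ "\<lambda>m. - inverse (c ?n) * c m"])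
  qed
qed

section \<open>Quadratic algebras\<close>

definition quad_basis :: "'a::comm_ring_1 \<Rightarrow> 2 \<Rightarrow> 'a" where
  "quad_basis s = (\<lambda>i. if i = 1 then 1 else s)"

lemma sum_quad_basis: "(\<Sum>i\<in>UNIV. \<phi> (c i) * quad_basis s i) = \<phi> (c 1) + \<phi> (c 2) * s"
  by (simp add: sum_2 quad_basis_def)

lemma ex_fun_2: "(\<exists>c :: 2 \<Rightarrow> 'b. P (c 1) (c 2)) \<longleftrightarrow> (\<exists>x y. P x y)"
proof
  assume "\<exists>x y. P x y"
  then obtain x y where "P x y" by blast
  then show "\<exists>c :: 2 \<Rightarrow> 'b. P (c 1) (c 2)" by (intro exI[of _ "\<lambda>i. if i = 1 then x else y"]) simp
qed blast

lemma quad_basis_iff: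
  assumes "ring_hom_map \<phi>"
  shows "is_basis (act \<phi>) (quad_basis s) \<longleftrightarrow>
    (\<forall>x. \<exists>a b. x = \<phi> a + \<phi> b * s) \<and> (\<forall>a b. \<phi> a + \<phi> b * s = 0 \<longrightarrow> a = 0 \<and> b = 0)"
proof -
  have "(\<forall>c :: 2 \<Rightarrow> 'a. \<phi> (c 1) + \<phi> (c 2) * s = 0 \<longrightarrow> (\<forall>i. c i = 0)) \<longleftrightarrow>
      (\<forall>a b. \<phi> a + \<phi> b * s = 0 \<longrightarrow> a = 0 \<and> b = 0)"
    using ex_fun_2[of "\<lambda>a b. \<phi> a + \<phi> b * s = 0 \<and> \<not> (a = 0 \<and> b = 0)"] by (auto simp: forall_2)
  moreover have "(\<exists>c :: 2 \<Rightarrow> 'a. x = \<phi> (c 1) + \<phi> (c 2) * s) \<longleftrightarrow> (\<exists>a b. x = \<phi> a + \<phi> b * s)" for x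
    by (rule ex_fun_2)
  ultimately show ?thesis
    by (simp add: is_basis_act_iff[OF assms] sum_quad_basis)
qed

lemma quad_repr:
  assumes "is_basis (act \<phi>) (quad_basis s)"
  obtains a b where "x = \<phi> a + \<phi> b * s"
  using basis_span[OF assms, of x] unfolding sum_quad_basis by metis

lemma quad_zero:
  assumes "ring_hom_map \<phi>" "is_basis (act \<phi>) (quad_basis s)" "\<phi> a + \<phi> b * s = 0"
  shows "a = 0" "b = 0"
  using assms quad_basis_iff by blast+

lemma quad_mult:
  assumes \<phi>: "ring_hom_map \<phi>" and s: "s * s = \<phi> d"
  shows "(\<phi> x + \<phi> y * s) * (\<phi> x' + \<phi> y' * s) = \<phi> (x * x' + d * (y * y')) + \<phi> (x * y' + y * x') * s"
proof -
  have "(\<phi> x + \<phi> y * s) * (\<phi> x' + \<phi> y' * s) =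
      \<phi> x * \<phi> x' + s * s * (\<phi> y * \<phi> y') + (\<phi> x * \<phi> y' + \<phi> y * \<phi> x') * s"
    by (simp add: algebra_simps)
  then show ?thesis by (simp add: s rh_add[OF \<phi>] rh_mult[OF \<phi>])
qed

lemma quad_norm:
  assumes \<phi>: "ring_hom_map \<phi>" and b: "is_basis (act \<phi>) (quad_basis s)" and s: "s * s = \<phi> d"
  shows "alg_norm TYPE(2) \<phi> (\<phi> x + \<phi> y * s) = x * x - d * (y * y)"
proof -
  define M where "M = (\<chi> (i::2) (j::2). if i = 1 then (if j = 1 then x else d * y) else (if j = 1 then y else x))"
  have "mult_matrix \<phi> (quad_basis s) (\<phi> x + \<phi> y * s) = M"
  proof (rule mult_matrix_eqI[OF b])
    fix j :: 2
    have "(\<phi> x + \<phi> y * s) * s = \<phi> x * s + \<phi> y * (s * s)" by (simp add: algebra_simps)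
    then have "(\<phi> x + \<phi> y * s) * quad_basis s j = \<phi> (M $ 1 $ j) + \<phi> (M $ 2 $ j) * s"
      using exhaust_2[of j] by (auto simp: quad_basis_def M_def s rh_simps[OF \<phi>] mult.commute)
    then show "(\<phi> x + \<phi> y * s) * quad_basis s j = (\<Sum>i\<in>UNIV. \<phi> (M $ i $ j) * quad_basis s i)"
      by (simp add: sum_2 quad_basis_def)
  qed
  then show ?thesis by (simp add: alg_norm_eq[OF \<phi> b] det_2 M_def mult_ac)
qed

lemma quad_norm_unit:
  assumes \<phi>: "ring_hom_map \<phi>" and b: "is_basis (act \<phi>) (quad_basis s)" and s: "s * s = \<phi> d"
    and u: "u dvd 1"
  shows "alg_norm TYPE(2) \<phi> u dvd 1"
proof -
  obtain x y where xy: "u = \<phi> x + \<phi> y * s" by (rule quad_repr[OF b])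
  obtain v where "1 = u * v" using u by (rule dvdE)
  moreover obtain x' y' where v: "v = \<phi> x' + \<phi> y' * s" by (rule quad_repr[OF b])
  ultimately have "1 = \<phi> (x * x' + d * (y * y')) + \<phi> (x * y' + y * x') * s"
    by (simp only: xy quad_mult[OF \<phi> s])
  then have "\<phi> (x * x' + d * (y * y') - 1) + \<phi> (x * y' + y * x') * s = 0"
    by (simp add: rh_diff[OF \<phi>] rh_1[OF \<phi>] diff_add_eq)
  from quad_zero[OF \<phi> b this] have e: "x * x' + d * (y * y') = 1" "x * y' + y * x' = 0" by auto
  have "(x * x - d * (y * y)) * (x' * x' - d * (y' * y')) =
      (x * x' + d * (y * y'))\<^sup>2 - d * (x * y' + y * x')\<^sup>2"
    by (simp add: power2_eq_square algebra_simps)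
  also have "\<dots> = 1" by (simp add: e)
  finally show ?thesis unfolding xy quad_norm[OF \<phi> b s] by (metis dvd_triv_left)
qed

text \<open>Complete the square in the equation of a primitive element.  If \<open>d\<close> were zero, both coordinates of
  the primitive element would agree.\<close>

lemma etale_quadratic:
  fixes \<phi> :: "'k::field_char_0 \<Rightarrow> 'a::comm_ring_1"
  assumes "etale_algebra TYPE(2) \<phi>"
  obtains s d where "ring_hom_map \<phi>" "is_basis (act \<phi>) (quad_basis s)" "s * s = \<phi> d" "d \<noteq> 0"
proof -
  obtain f :: "'a \<Rightarrow> 'k alg_closure ^ 2" where tp: "is_tensor_product \<phi> to_ac f (\<lambda>z. \<chi> i. z)"
    using assms unfolding etale_algebra_def by blast
  note \<phi> = tp_rhA[OF tp] and f = tp_rh1[OF tp]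
  obtain \<xi> where inj: "inj (\<lambda>i. f \<xi> $ i)" by (rule etale_separating[OF tp])
  note P = etale_powers[OF tp inj]
  have ind: "x = 0 \<and> y = 0" if "\<phi> x + \<phi> y * \<xi> = 0" for x y
    using P(1)[of "\<lambda>m. if m = 0 then x else y" 0] P(1)[of "\<lambda>m. if m = 0 then x else y" 1] that
    by (simp add: numeral_2_eq_2)
  have span: "\<exists>x y. t = \<phi> x + \<phi> y * \<xi>" for t
    using P(2)[of t] by (auto simp: numeral_2_eq_2)
  obtain p q where pq: "\<xi> * \<xi> = \<phi> q + \<phi> p * \<xi>" using span by blast
  define s where "s = \<xi> - \<phi> (p / 2)"
  define d where "d = q + p * p / 4"
  have \<xi>: "\<xi> = s + \<phi> (p / 2)" by (simp add: s_def)
  have "s * s = \<xi> * \<xi> - (\<phi> (p/2) + \<phi> (p/2)) * \<xi> + \<phi> (p/2) * \<phi> (p/2)" by (simp add: s_def algebra_simps)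
  also have "\<phi> (p/2) + \<phi> (p/2) = \<phi> p" by (simp add: rh_add[OF \<phi>, symmetric])
  finally have ss: "s * s = \<phi> d"
    by (simp add: pq d_def rh_simps[OF \<phi>, symmetric])
  have "is_basis (act \<phi>) (quad_basis s)"
  proof (subst quad_basis_iff[OF \<phi>], intro conjI allI impI)
    fix x
    obtain a b where "x = \<phi> a + \<phi> b * \<xi>" using span by blast
    then have "x = \<phi> (a + b * (p / 2)) + \<phi> b * s"
      unfolding rh_add[OF \<phi>] rh_mult[OF \<phi>] \<xi> by (simp only: algebra_simps)
    then show "\<exists>a b. x = \<phi> a + \<phi> b * s" by blast
  next
    fix a b assume "\<phi> a + \<phi> b * s = 0"
    then have "\<phi> (a - b * (p / 2)) + \<phi> b * \<xi> = 0"
      unfolding rh_diff[OF \<phi>] rh_mult[OF \<phi>] s_def by (simp only: algebra_simps)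
    from ind[OF this] show "a = 0" "b = 0" by auto
  qed
  moreover have "d \<noteq> 0"
  proof
    assume "d = 0"
    then have "f s * f s = 0" by (simp add: rh_mult[OF f, symmetric] ss rh_0[OF \<phi>] rh_0[OF f])
    then have "(f s * f s) $ i = 0" for i by simp
    then have "f s $ i = 0" for i by simp
    then have coord: "f \<xi> $ i = to_ac (p / 2)" for i
      by (simp add: \<xi> rh_add[OF f] tp_compat[OF tp])
    have "f \<xi> $ 1 = f \<xi> $ 2" by (simp only: coord)
    then have "(1::2) = 2" by (rule injD[OF inj])
    then show False by simp
  qed
  ultimately show ?thesis using that \<phi> ss by blast
qed

text \<open>The image of \<open>s\<close> is a square root of \<open>d\<close>, and it lies outside the base field because an involution
  that fixes the base field is injective.  The only square roots of this kind are \<open>s\<close> and \<open>- s\<close>.\<close>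

lemma involution_root:
  fixes \<phi> :: "'k::field_char_0 \<Rightarrow> 'a::comm_ring_1"
  assumes \<phi>: "ring_hom_map \<phi>" and b: "is_basis (act \<phi>) (quad_basis s)" and s: "s * s = \<phi> d"
    and \<sigma>: "nontrivial_involution \<phi> \<sigma>"
  shows "\<sigma> s = - s"
proof -
  have h: "ring_hom_map \<sigma>" and fixed: "\<And>c. \<sigma> (\<phi> c) = \<phi> c" and inv: "\<And>x. \<sigma> (\<sigma> x) = x"
    and "\<sigma> \<noteq> id" using \<sigma> by (auto simp: nontrivial_involution_def)
  obtain x y where xy: "\<sigma> s = \<phi> x + \<phi> y * s" by (rule quad_repr[OF b])
  have "\<sigma> s * \<sigma> s = \<phi> d" using s fixed rh_mult[OF h] by metis
  then have "\<phi> (x * x + d * (y * y) - d) + \<phi> (x * y + y * x) * s = 0"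
    unfolding xy quad_mult[OF \<phi> s] by (simp add: rh_diff[OF \<phi>] diff_add_eq)
  from quad_zero[OF \<phi> b this] have e: "x * x + d * (y * y) = d" "x * y = 0" by auto
  have "y \<noteq> 0"
  proof
    assume "y = 0"
    then have "\<sigma> s = \<phi> x" using xy by (simp add: rh_0[OF \<phi>])
    then have "s = \<phi> x" using inv[of s] fixed by metis
    then have "\<phi> (- x) + \<phi> 1 * s = 0" by (simp add: rh_simps[OF \<phi>])
    then show False using quad_zero(2)[OF \<phi> b] by (metis one_neq_zero)
  qed
  then have "x = 0" using e(2) by simp
  have ys: "\<sigma> s = \<phi> y * s" using xy \<open>x = 0\<close> by (simp add: rh_0[OF \<phi>])
  have "s = \<phi> (y * y) * s"
    using inv[of s] by (simp add: ys rh_mult[OF h] fixed rh_mult[OF \<phi>] mult.assoc)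
  then have "\<phi> 0 + \<phi> (y * y - 1) * s = 0" by (simp add: rh_simps[OF \<phi>] algebra_simps)
  from quad_zero(2)[OF \<phi> b this] have "y * y = 1" by simp
  moreover have "y \<noteq> 1"
  proof
    assume "y = 1"
    then have ss: "\<sigma> s = s" by (simp add: ys rh_1[OF \<phi>])
    have "\<sigma> t = t" for t
    proof -
      obtain a b where "t = \<phi> a + \<phi> b * s" by (rule quad_repr[OF b])
      then show ?thesis using ss fixed by (simp add: rh_simps[OF h])
    qed
    then show False using \<open>\<sigma> \<noteq> id\<close> by auto
  qed
  ultimately have "y = -1" by (metis square_eq_1_iff)
  then show ?thesis by (simp add: ys rh_simps[OF \<phi>])
qed

section \<open>Cubic algebras\<close>

definition cubic_basis :: "'a::comm_ring_1 \<Rightarrow> 3 \<Rightarrow> 'a" where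
  "cubic_basis t = (\<lambda>i. if i = 1 then 1 else if i = 2 then t else t * t)"

lemma sum_cubic_basis:
  "(\<Sum>i\<in>UNIV. \<phi> (c i) * cubic_basis t i) = \<phi> (c 1) + \<phi> (c 2) * t + \<phi> (c 3) * (t * t)"
  by (simp add: sum_3 cubic_basis_def)

lemma ex_fun_3: "(\<exists>c :: 3 \<Rightarrow> 'b. P (c 1) (c 2) (c 3)) \<longleftrightarrow> (\<exists>x y z. P x y z)"
proof
  assume "\<exists>x y z. P x y z"
  then obtain x y z where "P x y z" by blast
  then show "\<exists>c :: 3 \<Rightarrow> 'b. P (c 1) (c 2) (c 3)"
    by (intro exI[of _ "\<lambda>i. if i = 1 then x else if i = 2 then y else z"]) simp
qed blast

lemma cubic_basis_iff:
  assumes "ring_hom_map \<phi>"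
  shows "is_basis (act \<phi>) (cubic_basis t) \<longleftrightarrow>
    (\<forall>x. \<exists>a b c. x = \<phi> a + \<phi> b * t + \<phi> c * (t * t)) \<and>
    (\<forall>a b c. \<phi> a + \<phi> b * t + \<phi> c * (t * t) = 0 \<longrightarrow> a = 0 \<and> b = 0 \<and> c = 0)"
proof -
  have "(\<forall>c :: 3 \<Rightarrow> 'a. \<phi> (c 1) + \<phi> (c 2) * t + \<phi> (c 3) * (t * t) = 0 \<longrightarrow> (\<forall>i. c i = 0)) \<longleftrightarrow>
      (\<forall>a b c. \<phi> a + \<phi> b * t + \<phi> c * (t * t) = 0 \<longrightarrow> a = 0 \<and> b = 0 \<and> c = 0)"
    using ex_fun_3[of "\<lambda>a b c. \<phi> a + \<phi> b * t + \<phi> c * (t * t) = 0 \<and> \<not> (a = 0 \<and> b = 0 \<and> c = 0)"]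
    by (auto simp: forall_3)
  moreover have "(\<exists>c :: 3 \<Rightarrow> 'a. x = \<phi> (c 1) + \<phi> (c 2) * t + \<phi> (c 3) * (t * t)) \<longleftrightarrow>
      (\<exists>a b c. x = \<phi> a + \<phi> b * t + \<phi> c * (t * t))" for x
    by (rule ex_fun_3)
  ultimately show ?thesis
    by (simp add: is_basis_act_iff[OF assms] sum_cubic_basis)
qed

lemma cubic_repr:
  assumes "is_basis (act \<phi>) (cubic_basis t)"
  obtains a b c where "x = \<phi> a + \<phi> b * t + \<phi> c * (t * t)"
  using basis_span[OF assms, of x] unfolding sum_cubic_basis by metis

text \<open>The discriminant of \<open>X^3 - a X^2 - b X - c\<close>.\<close>

definition cubic_disc :: "'k::comm_ring_1 \<Rightarrow> 'k \<Rightarrow> 'k \<Rightarrow> 'k" where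
  "cubic_disc a b c = a*a*b*b + 4*b*b*b - 4*a*a*a*c - 18*a*b*c - 27*c*c"

lemma cubic_disc_roots:
  assumes "a = r1 + r2 + r3" "b = - (r1 * r2 + r1 * r3 + r2 * r3)" "c = r1 * r2 * r3"
  shows "cubic_disc a b c = ((r1 - r2) * (r1 - r3) * (r2 - r3))\<^sup>2"
  unfolding cubic_disc_def assms by (simp add: algebra_simps power2_eq_square)

text \<open>The coordinates of a primitive element are three distinct roots of its equation, so the
  coefficients are given by the formulas of Vieta and the discriminant is a product of squared
  differences.\<close>

lemma etale_cubic:
  fixes \<phi> :: "'k::field_char_0 \<Rightarrow> 'a::comm_ring_1"
  assumes "etale_algebra TYPE(3) \<phi>"
  obtains t a b c where "ring_hom_map \<phi>" "is_basis (act \<phi>) (cubic_basis t)"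
    "t * t * t = \<phi> a * (t * t) + \<phi> b * t + \<phi> c" "cubic_disc a b c \<noteq> 0"
proof -
  obtain f :: "'a \<Rightarrow> 'k alg_closure ^ 3" where tp: "is_tensor_product \<phi> to_ac f (\<lambda>z. \<chi> i. z)"
    using assms unfolding etale_algebra_def by blast
  note \<phi> = tp_rhA[OF tp] and f = tp_rh1[OF tp]
  obtain \<xi> where inj: "inj (\<lambda>i. f \<xi> $ i)" by (rule etale_separating[OF tp])
  note P = etale_powers[OF tp inj]
  have B: "is_basis (act \<phi>) (cubic_basis \<xi>)"
  proof (subst cubic_basis_iff[OF \<phi>], intro conjI allI impI)
    fix x
    show "\<exists>a b c. x = \<phi> a + \<phi> b * \<xi> + \<phi> c * (\<xi> * \<xi>)"
      using P(2)[of x] by (auto simp: numeral_3_eq_3)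
  next
    fix a b c assume 0: "\<phi> a + \<phi> b * \<xi> + \<phi> c * (\<xi> * \<xi>) = 0"
    define e where "e = (\<lambda>m::nat. if m = 0 then a else if m = 1 then b else c)"
    have "(\<Sum>m<CARD(3). \<phi> (e m) * \<xi> ^ m) = 0" using 0 by (simp add: e_def numeral_3_eq_3)
    note P(1)[OF this]
    from this[of 0] this[of 1] this[of 2] show "a = 0" "b = 0" "c = 0" by (auto simp: e_def)
  qed
  obtain c b a where abc: "\<xi> * \<xi> * \<xi> = \<phi> c + \<phi> b * \<xi> + \<phi> a * (\<xi> * \<xi>)" by (rule cubic_repr[OF B])
  define x where "x i = f \<xi> $ i" for i
  have x: "x i * x i * x i = to_ac a * (x i * x i) + to_ac b * x i + to_ac c" for i
  proof -
    have "x i * x i * x i = f (\<xi> * \<xi> * \<xi>) $ i" by (simp add: x_def rh_mult[OF f])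
    then show ?thesis unfolding abc by (simp add: x_def rh_simps[OF f] tp_compat[OF tp])
  qed
  have ne: "x i \<noteq> x j" if "i \<noteq> j" for i j using inj that by (auto simp: x_def inj_on_def)
  have pair: "x i * x i + x i * x j + x j * x j = to_ac a * (x i + x j) + to_ac b" if "i \<noteq> j" for i j
  proof -
    have "(x i - x j) * (x i * x i + x i * x j + x j * x j - to_ac a * (x i + x j) - to_ac b) =
      (x i * x i * x i - to_ac a * (x i * x i) - to_ac b * x i) - (x j * x j * x j - to_ac a * (x j * x j) - to_ac b * x j)"
      by (simp add: algebra_simps)
    also have "\<dots> = 0" by (simp add: x)
    finally have "x i * x i + x i * x j + x j * x j - to_ac a * (x i + x j) - to_ac b = 0"
      using ne[OF that] by simp
    then show ?thesis by (simp add: algebra_simps)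
  qed
  have "(x 2 - x 3) * (x 1 + x 2 + x 3 - to_ac a) =
      (x 1 * x 1 + x 1 * x 2 + x 2 * x 2 - to_ac a * (x 1 + x 2)) - (x 1 * x 1 + x 1 * x 3 + x 3 * x 3 - to_ac a * (x 1 + x 3))"
    by (simp add: algebra_simps)
  also have "\<dots> = 0" using pair[of 1 2] pair[of 1 3] by simp
  finally have a: "to_ac a = x 1 + x 2 + x 3" using ne[of 2 3] by simp
  have b: "to_ac b = - (x 1 * x 2 + x 1 * x 3 + x 2 * x 3)"
    using pair[of 1 2] unfolding a eq_neg_iff_add_eq_0 by (simp add: algebra_simps)
  have c: "to_ac c = x 1 * x 2 * x 3"
    using x[of 1] unfolding a b by (simp add: algebra_simps)
  have "to_ac (cubic_disc a b c) = cubic_disc (to_ac a) (to_ac b) (to_ac c)"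
    by (simp add: cubic_disc_def)
  also have "\<dots> = ((x 1 - x 2) * (x 1 - x 3) * (x 2 - x 3))\<^sup>2" by (rule cubic_disc_roots[OF a b c])
  also have "\<dots> \<noteq> 0" using ne[of 1 2] ne[of 1 3] ne[of 2 3] by simp
  finally have "cubic_disc a b c \<noteq> 0" by auto
  moreover have "\<xi> * \<xi> * \<xi> = \<phi> a * (\<xi> * \<xi>) + \<phi> b * \<xi> + \<phi> c" using abc by (simp add: algebra_simps)
  ultimately show ?thesis using that \<phi> B by blast
qed

section \<open>Etale algebras at a real place\<close>

lemma linear_inj_imp_surj_dim:
  fixes L :: "'a::euclidean_space \<Rightarrow> 'b::euclidean_space"
  assumes L: "linear L" "\<And>x. L x = 0 \<Longrightarrow> x = 0" and d: "DIM('a) = DIM('b)"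
  shows "surj L"
proof -
  have inj: "inj L" using L by (simp add: linear_injective_0)
  have "dim (range L) = DIM('b)"
    using dim_image_eq[OF L(1), of UNIV] inj d by (simp add: inj_on_def)
  then have "span (range L) = UNIV" using dim_eq_full by blast
  then show ?thesis using linear_subspace_image[OF L(1) subspace_UNIV] by (metis span_eq_iff)
qed

lemma quadratic_three_roots:
  fixes x y z :: "'f::field"
  assumes "r1 \<noteq> r2" "r1 \<noteq> r3" "r2 \<noteq> r3"
    and 1: "x + y * r1 + z * (r1 * r1) = 0" and 2: "x + y * r2 + z * (r2 * r2) = 0"
    and 3: "x + y * r3 + z * (r3 * r3) = 0"
  shows "x = 0" "y = 0" "z = 0"
proof -
  have "(r1 - r2) * (y + z * (r1 + r2)) = (x + y * r1 + z * (r1 * r1)) - (x + y * r2 + z * (r2 * r2))"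
    by (simp add: algebra_simps)
  then have a: "y + z * (r1 + r2) = 0" using assms(1) 1 2 by simp
  have "(r1 - r3) * (y + z * (r1 + r3)) = (x + y * r1 + z * (r1 * r1)) - (x + y * r3 + z * (r3 * r3))"
    by (simp add: algebra_simps)
  then have b: "y + z * (r1 + r3) = 0" using assms(2) 1 3 by simp
  have "z * (r2 - r3) = (y + z * (r1 + r2)) - (y + z * (r1 + r3))" by (simp add: algebra_simps)
  then show z: "z = 0" using assms(3) a b by simp
  show y: "y = 0" using a z by simp
  show "x = 0" using 1 y z by simp
qed

text \<open>The algebra is the quotient of the polynomial ring by a cubic, so a root \<open>t\<close> of the transported
  cubic defines a homomorphism; products are compared after reduction to degree two.\<close>

lemma cubic_hom:
  fixes \<phi> :: "'k::field \<Rightarrow> 'e::comm_ring_1" and \<kappa> :: "real \<Rightarrow> 'r::comm_ring_1"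
  assumes \<phi>: "ring_hom_map \<phi>" and B: "is_basis (act \<phi>) (cubic_basis \<xi>)"
    and \<xi>: "\<xi> * \<xi> * \<xi> = \<phi> a * (\<xi> * \<xi>) + \<phi> b * \<xi> + \<phi> c"
    and \<nu>: "ring_hom_map \<nu>" and \<kappa>: "ring_hom_map \<kappa>"
    and t: "t * t * t = \<kappa> (\<nu> a) * (t * t) + \<kappa> (\<nu> b) * t + \<kappa> (\<nu> c)"
  obtains F where "ring_hom_map F" "\<And>x. F (\<phi> x) = \<kappa> (\<nu> x)" "F \<xi> = t"
proof -
  define h where "h x = \<kappa> (\<nu> x)" for x
  have h: "ring_hom_map h" unfolding h_def by (rule rh_compose[OF \<nu> \<kappa>])
  define F where "F x = (\<Sum>i\<in>UNIV. h (coords (act \<phi>) (cubic_basis \<xi>) x i) * cubic_basis t i)" for x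
  have FI: "F (\<phi> x + \<phi> y * \<xi> + \<phi> z * (\<xi> * \<xi>)) = h x + h y * t + h z * (t * t)" for x y z
  proof -
    have "coords (act \<phi>) (cubic_basis \<xi>) (\<phi> x + \<phi> y * \<xi> + \<phi> z * (\<xi> * \<xi>)) = (\<lambda>i. if i = 1 then x else if i = 2 then y else z)"
      by (rule coords_act_unique[OF B]) (subst sum_cubic_basis, simp)
    then show ?thesis unfolding F_def sum_cubic_basis by simp
  qed
  have prod: "(x0 + x1 * u + x2 * (u * u)) * (y0 + y1 * u + y2 * (u * u)) =
      (x0 * y0 + C * (x1 * y2 + x2 * y1) + A * C * (x2 * y2)) +
      (x0 * y1 + x1 * y0 + B * (x1 * y2 + x2 * y1) + (A * B + C) * (x2 * y2)) * u +
      (x0 * y2 + x1 * y1 + x2 * y0 + A * (x1 * y2 + x2 * y1) + (A * A + B) * (x2 * y2)) * (u * u)"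
    if u: "u * u * u = A * (u * u) + B * u + C" for x0 x1 x2 y0 y1 y2 u A B C :: "'z::comm_ring_1"
  proof -
    have "(x0 + x1 * u + x2 * (u * u)) * (y0 + y1 * u + y2 * (u * u)) =
      x0 * y0 + (x0 * y1 + x1 * y0) * u + (x0 * y2 + x1 * y1 + x2 * y0) * (u * u) +
      (x1 * y2 + x2 * y1) * (u * u * u) + x2 * y2 * (u * (u * u * u))"
      by (simp add: algebra_simps)
    also have "u * (u * u * u) = A * (u * u * u) + B * (u * u) + C * u"
      by (subst u) (simp add: algebra_simps)
    also have "\<dots> = A * (A * (u * u) + B * u + C) + B * (u * u) + C * u" by (simp only: u)
    also have "u * u * u = A * (u * u) + B * u + C" by (rule u)
    finally show ?thesis by (simp add: algebra_simps)
  qed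
  have "ring_hom_map F"
  proof (rule ring_hom_mapI)
    show "F 1 = 1" using FI[of 1 0 0] by (simp add: rh_simps[OF \<phi>] rh_simps[OF h])
    fix x y
    obtain x0 x1 x2 where x: "x = \<phi> x0 + \<phi> x1 * \<xi> + \<phi> x2 * (\<xi> * \<xi>)" by (rule cubic_repr[OF B])
    obtain y0 y1 y2 where y: "y = \<phi> y0 + \<phi> y1 * \<xi> + \<phi> y2 * (\<xi> * \<xi>)" by (rule cubic_repr[OF B])
    have "x + y = \<phi> (x0 + y0) + \<phi> (x1 + y1) * \<xi> + \<phi> (x2 + y2) * (\<xi> * \<xi>)"
      by (simp add: x y rh_add[OF \<phi>] algebra_simps)
    then have "F (x + y) = h (x0 + y0) + h (x1 + y1) * t + h (x2 + y2) * (t * t)" by (simp only: FI)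
    then show "F (x + y) = F x + F y"
      unfolding x y FI by (simp add: rh_add[OF h] algebra_simps)
    have "x * y = \<phi> (x0 * y0 + c * (x1 * y2 + x2 * y1) + a * c * (x2 * y2)) +
      \<phi> (x0 * y1 + x1 * y0 + b * (x1 * y2 + x2 * y1) + (a * b + c) * (x2 * y2)) * \<xi> +
      \<phi> (x0 * y2 + x1 * y1 + x2 * y0 + a * (x1 * y2 + x2 * y1) + (a * a + b) * (x2 * y2)) * (\<xi> * \<xi>)"
      unfolding x y prod[OF \<xi>] rh_add[OF \<phi>] rh_mult[OF \<phi>] ..
    then have "F (x * y) = h (x0 * y0 + c * (x1 * y2 + x2 * y1) + a * c * (x2 * y2)) +
      h (x0 * y1 + x1 * y0 + b * (x1 * y2 + x2 * y1) + (a * b + c) * (x2 * y2)) * t +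
      h (x0 * y2 + x1 * y1 + x2 * y0 + a * (x1 * y2 + x2 * y1) + (a * a + b) * (x2 * y2)) * (t * t)"
      by (simp only: FI)
    also have "\<dots> = F x * F y"
      unfolding x y FI prod[OF t[folded h_def]] rh_add[OF h] rh_mult[OF h] ..
    finally show "F (x * y) = F x * F y" .
  qed
  moreover have "F (\<phi> x) = \<kappa> (\<nu> x)" for x using FI[of x 0 0] by (simp add: rh_simps[OF \<phi>] rh_simps[OF h] h_def rh_0[OF \<nu>] rh_0[OF \<kappa>])
  moreover have "F \<xi> = t" using FI[of 0 1 0] by (simp add: rh_simps[OF \<phi>] rh_simps[OF h])
  ultimately show ?thesis using that by blast
qed

lemma cubic_tensor:
  fixes \<phi> :: "'k::field \<Rightarrow> 'e::comm_ring_1" and \<kappa> :: "real \<Rightarrow> 'r::comm_ring_1"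
  assumes \<phi>: "ring_hom_map \<phi>" and B: "is_basis (act \<phi>) (cubic_basis \<xi>)"
    and \<xi>: "\<xi> * \<xi> * \<xi> = \<phi> a * (\<xi> * \<xi>) + \<phi> b * \<xi> + \<phi> c"
    and \<nu>: "ring_hom_map \<nu>" and \<kappa>: "ring_hom_map \<kappa>"
    and t: "t * t * t = \<kappa> (\<nu> a) * (t * t) + \<kappa> (\<nu> b) * t + \<kappa> (\<nu> c)"
    and B': "is_basis (act \<kappa>) (cubic_basis t)"
  obtains F where "is_tensor_product \<phi> \<nu> F \<kappa>"
proof -
  obtain F where F: "ring_hom_map F" "\<And>x. F (\<phi> x) = \<kappa> (\<nu> x)" "F \<xi> = t"
    using cubic_hom[OF assms(1-6)] by metis
  have "(\<lambda>i. F (cubic_basis \<xi> i)) = cubic_basis t"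
    by (auto simp: cubic_basis_def rh_simps[OF F(1)] F(3))
  then have "is_tensor_product \<phi> \<nu> F \<kappa>"
    using tp_from_basis[OF \<phi> \<nu> F(1) \<kappa> F(2) B] B' by simp
  then show ?thesis using that by blast
qed

lemma complex_cubic_roots:
  fixes a b c :: complex
  obtains r1 r2 r3 where "a = r1 + r2 + r3" "b = - (r1 * r2 + r1 * r3 + r2 * r3)" "c = r1 * r2 * r3"
proof -
  define p where "p = [:- c, - b, - a, 1:]"
  have p: "p \<noteq> 0" "degree p = 3" "lead_coeff p = 1" by (auto simp: p_def)
  obtain A where A: "size A = degree p" "p = Polynomial.smult (lead_coeff p) (\<Prod>x\<in>#A. [:-x, 1:])"
    using alg_closed_imp_factorization[OF p(1)] by blast
  have "size A = 3" using A(1) p(2) by simp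
  then obtain r1 A1 where A1: "A = add_mset r1 A1" "size A1 = 2"
    by (metis Suc_inject eval_nat_numeral(3) numeral_2_eq_2 size_Suc_Diff1 size_eq_Suc_imp_eq_union size_add_mset)
  then obtain r2 A2 where A2: "A1 = add_mset r2 A2" "size A2 = 1"
    by (metis One_nat_def Suc_inject numeral_2_eq_2 size_eq_Suc_imp_eq_union size_add_mset)
  then obtain r3 where A3: "A2 = {#r3#}" by (meson size_1_singleton_mset)
  have "p = [:-r1, 1:] * ([:-r2, 1:] * [:-r3, 1:])"
    using A(2) p(3) by (simp add: A1 A2 A3)
  then have "[:- c, - b, - a, 1:] = [:- (r1 * r2 * r3), r1 * r2 + r1 * r3 + r2 * r3, - (r1 + r2 + r3), 1:]"
    by (simp add: p_def algebra_simps)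
  then have "- a = - (r1 + r2 + r3)" "- b = r1 * r2 + r1 * r3 + r2 * r3" "- c = - (r1 * r2 * r3)"
    by (simp_all only: pCons_eq_iff)
  then have "a = r1 + r2 + r3" "b = - (r1 * r2 + r1 * r3 + r2 * r3)" "c = r1 * r2 * r3"
    by (metis minus_minus)+
  then show ?thesis using that by blast
qed

lemma cubic_basis_real:
  fixes \<kappa> :: "real \<Rightarrow> 'r::{comm_ring_1, euclidean_space}"
  assumes \<kappa>: "ring_hom_map \<kappa>" "\<And>c x. \<kappa> c * x = c *\<^sub>R x" and dim: "DIM('r) = 3"
    and 0: "\<And>x y z. \<kappa> x + \<kappa> y * t + \<kappa> z * (t * t) = 0 \<Longrightarrow> x = 0 \<and> y = 0 \<and> z = 0"
  shows "is_basis (act \<kappa>) (cubic_basis t)"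
proof (subst cubic_basis_iff[OF \<kappa>(1)], rule conjI)
  define L where "L x = \<kappa> (x $ 1) + \<kappa> (x $ 2) * t + \<kappa> (x $ 3) * (t * t)" for x :: "real ^ 3"
  have "linear L" by (rule linearI) (simp_all add: L_def \<kappa>(2)[symmetric] rh_simps[OF \<kappa>(1)] algebra_simps)
  moreover have "x = 0" if "L x = 0" for x
    using 0 that by (simp add: L_def vec_eq_iff forall_3)
  ultimately have "surj L" by (rule linear_inj_imp_surj_dim) (simp_all add: dim)
  then show "\<forall>x. \<exists>a b c. x = \<kappa> a + \<kappa> b * t + \<kappa> c * (t * t)"
    unfolding surj_def L_def by blast
qed (use 0 in blast)

lemma rh_pair: "ring_hom_map (\<lambda>r::real. (r, complex_of_real r))"
  by (simp add: ring_hom_map_def one_prod_def times_prod_def)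

text \<open>The discriminant is a polynomial in the coefficients of the defining cubic, so it stays non-zero at
  a real place, where the cubic then has distinct roots.  Either all of them are real, or one is real
  and the others are conjugate.\<close>

lemma cubic_real_or_not:
  fixes \<phi> :: "'k::field_char_0 \<Rightarrow> 'e::comm_ring_1"
  assumes et: "etale_algebra TYPE(3) \<phi>" and \<nu>: "ring_hom_map \<nu>"
  shows "cubic_totally_real_at \<phi> \<nu> \<or> cubic_not_totally_real_at \<phi> \<nu>"
proof -
  obtain \<xi> a b c where \<phi>: "ring_hom_map \<phi>" and B: "is_basis (act \<phi>) (cubic_basis \<xi>)"
    and \<xi>: "\<xi> * \<xi> * \<xi> = \<phi> a * (\<xi> * \<xi>) + \<phi> b * \<xi> + \<phi> c" and D: "cubic_disc a b c \<noteq> 0"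
    by (rule etale_cubic[OF et])
  define \<mu> where "\<mu> x = complex_of_real (\<nu> x)" for x
  have \<mu>: "ring_hom_map \<mu>" unfolding \<mu>_def by (rule rh_compose[OF \<nu> rh_of_real])
  obtain r1 r2 r3 where r: "\<mu> a = r1 + r2 + r3" "\<mu> b = - (r1 * r2 + r1 * r3 + r2 * r3)" "\<mu> c = r1 * r2 * r3"
    by (rule complex_cubic_roots)
  have "cubic_disc (\<mu> a) (\<mu> b) (\<mu> c) = \<mu> (cubic_disc a b c)"
    by (simp add: cubic_disc_def rh_simps[OF \<mu>])
  also have "\<dots> \<noteq> 0" using D by (simp add: rh_field_eq_0[OF \<mu>])
  finally have "(r1 - r2) * (r1 - r3) * (r2 - r3) \<noteq> 0"
    unfolding cubic_disc_roots[OF r] by auto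
  then have ne: "r1 \<noteq> r2" "r1 \<noteq> r3" "r2 \<noteq> r3" by auto
  have fact: "z * z * z - \<mu> a * (z * z) - \<mu> b * z - \<mu> c = (z - r1) * (z - r2) * (z - r3)" for z
    unfolding r by (simp add: algebra_simps)
  have root: "z * z * z = \<mu> a * (z * z) + \<mu> b * z + \<mu> c \<longleftrightarrow> z = r1 \<or> z = r2 \<or> z = r3" for z
    unfolding eq_iff_diff_eq_0[of "z * z * z"] fact[of z, unfolded diff_diff_eq] by auto
  have cnj_root: "cnj z = r1 \<or> cnj z = r2 \<or> cnj z = r3" if "z = r1 \<or> z = r2 \<or> z = r3" for z
  proof -
    have "cnj (z * z * z) = cnj (\<mu> a * (z * z) + \<mu> b * z + \<mu> c)" using that root by metis
    then have "cnj z * cnj z * cnj z = \<mu> a * (cnj z * cnj z) + \<mu> b * cnj z + \<mu> c"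
      by (simp add: \<mu>_def)
    then show ?thesis using root by blast
  qed
  show ?thesis
  proof (cases "r1 \<in> \<real> \<and> r2 \<in> \<real> \<and> r3 \<in> \<real>")
    case True
    define t :: "real ^ 3" where "t = (\<chi> i. Re (if i = 1 then r1 else if i = 2 then r2 else r3))"
    have t: "of_real (t $ 1) = r1" "of_real (t $ 2) = r2" "of_real (t $ 3) = r3" using True by (auto simp: t_def)
    have tn: "t $ 1 \<noteq> t $ 2" "t $ 1 \<noteq> t $ 3" "t $ 2 \<noteq> t $ 3" using ne t by metis+
    let ?\<kappa> = "\<lambda>r::real. (\<chi> (i::3). r)"
    have \<kappa>: "ring_hom_map ?\<kappa>" by (rule rh_const_vec)
    have "complex_of_real (t $ i * t $ i * t $ i) = of_real (\<nu> a * (t $ i * t $ i) + \<nu> b * t $ i + \<nu> c)" for i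
      using root[of "of_real (t $ i)"] t exhaust_3[of i] by (auto simp: \<mu>_def)
    then have teq: "t $ i * t $ i * t $ i = \<nu> a * (t $ i * t $ i) + \<nu> b * t $ i + \<nu> c" for i
      using of_real_eq_iff by blast
    have t3: "t * t * t = ?\<kappa> (\<nu> a) * (t * t) + ?\<kappa> (\<nu> b) * t + ?\<kappa> (\<nu> c)"
      by (simp add: vec_eq_iff teq)
    have "is_basis (act ?\<kappa>) (cubic_basis t)"
    proof (rule cubic_basis_real[OF \<kappa>])
      fix x y z assume "?\<kappa> x + ?\<kappa> y * t + ?\<kappa> z * (t * t) = 0"
      then have "x + y * t $ i + z * (t $ i * t $ i) = 0" for i by (auto simp: vec_eq_iff)
      then show "x = 0 \<and> y = 0 \<and> z = 0" using quadratic_three_roots[OF tn, of x y z] by blast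
    qed (auto simp: vec_eq_iff)
    then obtain F where "is_tensor_product \<phi> \<nu> F ?\<kappa>"
      using cubic_tensor[OF \<phi> B \<xi> \<nu> \<kappa> t3] by blast
    then show ?thesis unfolding cubic_totally_real_at_def by blast
  next
    case False
    then obtain z where z: "z = r1 \<or> z = r2 \<or> z = r3" "z \<notin> \<real>" by auto
    have zc: "cnj z \<noteq> z" using z(2) by (metis Reals_cnj_iff)
    \<comment> \<open>the remaining root is \<open>\<mu> a - z - cnj z\<close>, which is real\<close>
    define r where "r = Re (r1 + r2 + r3 - z - cnj z)"
    have "r1 + r2 + r3 - z - cnj z \<in> \<real>"
      unfolding r(1)[symmetric] by (simp add: \<mu>_def complex_is_Real_iff)
    then have r': "of_real r = r1 + r2 + r3 - z - cnj z" unfolding r_def by (rule of_real_Re)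
    have rr: "of_real r = r1 \<or> of_real r = r2 \<or> of_real r = r3"
      using z(1) cnj_root[OF z(1)] zc unfolding r' by auto
    have zr: "z \<noteq> of_real r" using z(2) by auto
    have czr: "cnj z \<noteq> of_real r" using z(2) by (metis Reals_cnj_iff Reals_of_real complex_cnj_cnj complex_cnj_complex_of_real)
    let ?\<kappa> = "\<lambda>r::real. (r, complex_of_real r)"
    define t where "t = (r, z)"
    have "complex_of_real (r * r * r) = of_real (\<nu> a * (r * r) + \<nu> b * r + \<nu> c)"
      using root[of "of_real r"] rr by (auto simp: \<mu>_def)
    then have "r * r * r = \<nu> a * (r * r) + \<nu> b * r + \<nu> c"
      using of_real_eq_iff by blast
    moreover have "z * z * z = \<mu> a * (z * z) + \<mu> b * z + \<mu> c" using root z(1) by blast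
    ultimately have t3: "t * t * t = ?\<kappa> (\<nu> a) * (t * t) + ?\<kappa> (\<nu> b) * t + ?\<kappa> (\<nu> c)"
      by (simp add: t_def times_prod_def \<mu>_def)
    have "is_basis (act ?\<kappa>) (cubic_basis t)"
    proof (rule cubic_basis_real[OF rh_pair])
      fix p q k assume 0: "?\<kappa> p + ?\<kappa> q * t + ?\<kappa> k * (t * t) = 0"
      then have "complex_of_real (p + q * r + k * (r * r)) = 0"
        and z0: "of_real p + of_real q * z + of_real k * (z * z) = 0"
        by (auto simp: t_def times_prod_def zero_prod_def)
      then have r0: "of_real p + of_real q * of_real r + of_real k * (of_real r * complex_of_real r) = 0"
        by simp
      have "cnj (of_real p + of_real q * z + of_real k * (z * z)) = 0" using z0 by simp
      then have c0: "of_real p + of_real q * cnj z + of_real k * (cnj z * cnj z) = 0" by simp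
      show "p = 0 \<and> q = 0 \<and> k = 0"
        using quadratic_three_roots[OF zr zc[symmetric] czr[symmetric] z0 r0 c0] by simp
    qed (auto simp: times_prod_def scaleR_conv_of_real prod_eq_iff)
    then obtain F where "is_tensor_product \<phi> \<nu> F ?\<kappa>"
      using cubic_tensor[OF \<phi> B \<xi> \<nu> rh_pair t3] by blast
    then show ?thesis unfolding cubic_not_totally_real_at_def by blast
  qed
qed

section \<open>The complex places of a cubic algebra\<close>

text \<open>The complex extensions of \<open>\<nu>\<close> to a cubic algebra, with the permutation of them that complex
  conjugation induces.  The determinant condition says that they split the algebra.\<close>

definition complex_splitting ::
    "('k::field \<Rightarrow> 'e::comm_ring_1) \<Rightarrow> ('k \<Rightarrow> real) \<Rightarrow> (3 \<Rightarrow> 'e \<Rightarrow> complex) \<Rightarrow> (3 \<Rightarrow> 3) \<Rightarrow> bool" where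
  "complex_splitting \<phi> \<nu> \<rho> c \<longleftrightarrow>
     (\<forall>r. ring_hom_map (\<rho> r)) \<and> (\<forall>r x. \<rho> r (\<phi> x) = of_real (\<nu> x)) \<and>
     (\<forall>r x. cnj (\<rho> r x) = \<rho> (c r) x) \<and>
     (\<forall>b :: 3 \<Rightarrow> 'e. is_basis (act \<phi>) b \<longrightarrow> det (\<chi> i r. \<rho> r (b i)) \<noteq> 0)"

lemma
  assumes "complex_splitting \<phi> \<nu> \<rho> c"
  shows splitting_hom: "ring_hom_map (\<rho> r)" and splitting_over: "\<rho> r (\<phi> y) = of_real (\<nu> y)"
    and splitting_cnj: "cnj (\<rho> r x) = \<rho> (c r) x"
    and splitting_det: "is_basis (act \<phi>) (b :: 3 \<Rightarrow> _) \<Longrightarrow> det (\<chi> i r. \<rho> r (b i)) \<noteq> 0"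
  using assms unfolding complex_splitting_def by auto

text \<open>Real combinations of the rows of the matrix of values on a basis realise the values of arbitrary
  elements \<open>t j\<close> of the completed algebra, so it suffices to find elements with a regular matrix.\<close>

lemma det_nonzero_from_rows:
  fixes \<phi> :: "'k::field \<Rightarrow> 'e::comm_ring_1" and b :: "3 \<Rightarrow> 'e" and P :: "'r::comm_ring_1 \<Rightarrow> complex ^ 3"
  assumes tp: "is_tensor_product \<phi> \<nu> f \<kappa>" and b: "is_basis (act \<phi>) b"
    and P: "\<And>x y. P (x + y) = P x + P y" "\<And>r x. P (\<kappa> r * x) = of_real r *s P x"
    and M: "det (\<chi> j. P (t j)) \<noteq> 0"
  shows "det (\<chi> i. P (f (b i))) \<noteq> 0"
proof -
  note B = tp_basis[OF tp b]
  have P0: "P 0 = 0" using P(1)[of 0 0] by simp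
  have Psum: "P (sum g A) = (\<Sum>i\<in>A. P (g i))" for g :: "3 \<Rightarrow> _" and A
    by (induction A rule: infinite_finite_induct) (auto simp: P0 P(1))
  have "\<exists>e :: 3 \<Rightarrow> real. t j = (\<Sum>i\<in>UNIV. \<kappa> (e i) * f (b i))" for j
    by (rule basis_span[OF B, of "t j"]) blast
  then obtain e where e: "\<And>j. t j = (\<Sum>i\<in>UNIV. \<kappa> (e j i) * f (b i))" by metis
  have "(\<chi> j. P (t j)) = (\<chi> j i. of_real (e j i)) ** (\<chi> i. P (f (b i)))"
    by (simp add: e Psum P(2) vec_eq_iff matrix_matrix_mult_def)
  then show ?thesis using M by (auto simp: det_mul)
qed

lemma splitting_totally_real:
  assumes tp: "is_tensor_product \<phi> \<nu> f (\<lambda>r. \<chi> (i::3). r)"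
  shows "complex_splitting \<phi> \<nu> (\<lambda>r x. of_real (f x $ r)) id"
proof -
  note f = tp_rh1[OF tp]
  have "ring_hom_map (\<lambda>x. of_real (f x $ r) :: complex)" for r
    by (rule rh_compose[OF rh_compose[OF f rh_component] rh_of_real])
  moreover have "det (\<chi> i r. complex_of_real (f (b i) $ r)) \<noteq> 0" if "is_basis (act \<phi>) b" for b :: "3 \<Rightarrow> _"
  proof -
    let ?P = "\<lambda>v :: real^3. (\<chi> r. complex_of_real (v $ r))"
    have "(\<chi> j. ?P (axis j 1)) = mat 1" by (simp add: vec_eq_iff axis_def mat_def)
    then have "det (\<chi> j. ?P (axis j 1)) \<noteq> 0" by simp
    from det_nonzero_from_rows[OF tp that _ _ this] show ?thesis
      by (simp add: vec_eq_iff)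
  qed
  ultimately show ?thesis
    unfolding complex_splitting_def by (auto simp: tp_compat[OF tp])
qed

definition swap23 :: "3 \<Rightarrow> 3" where "swap23 = Transposition.transpose 2 3"

lemma swap23_simps [simp]: "swap23 1 = 1" "swap23 2 = 3" "swap23 3 = 2"
  by (auto simp: swap23_def Transposition.transpose_def)

definition mixed_places :: "('e \<Rightarrow> real \<times> complex) \<Rightarrow> 3 \<Rightarrow> 'e \<Rightarrow> complex" where
  "mixed_places f r x = (if r = 1 then of_real (fst (f x)) else if r = 2 then snd (f x) else cnj (snd (f x)))"

lemma rh_fst: "ring_hom_map (fst :: 'r::comm_ring_1 \<times> 's::comm_ring_1 \<Rightarrow> 'r)"
  and rh_snd: "ring_hom_map (snd :: 'r::comm_ring_1 \<times> 's::comm_ring_1 \<Rightarrow> 's)"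
  by (auto simp: ring_hom_map_def one_prod_def times_prod_def)

lemma splitting_mixed:
  assumes tp: "is_tensor_product \<phi> \<nu> f (\<lambda>r. (r, complex_of_real r))"
  shows "complex_splitting \<phi> \<nu> (mixed_places f) swap23"
proof -
  note f = tp_rh1[OF tp]
  have "ring_hom_map (\<lambda>x. of_real (fst (f x)) :: complex)" "ring_hom_map (\<lambda>x. snd (f x))"
    "ring_hom_map (\<lambda>x. cnj (snd (f x)))"
    by (rule rh_compose[OF rh_compose[OF f rh_fst] rh_of_real] rh_compose[OF f rh_snd]
        rh_compose[OF rh_compose[OF f rh_snd] rh_cnj])+
  then have "ring_hom_map (mixed_places f r)" for r
    unfolding mixed_places_def by (cases "r = 1"; cases "r = 2") simp_all
  moreover have "det (\<chi> i r. mixed_places f r (b i)) \<noteq> 0" if "is_basis (act \<phi>) b" for b :: "3 \<Rightarrow> _"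
  proof -
    let ?P = "\<lambda>v :: real \<times> complex. (\<chi> r. mixed_places (\<lambda>x. x) r v)"
    \<comment> \<open>a real basis of the completed algebra\<close>
    let ?t = "\<lambda>j::3. if j = 1 then (1, 0) else if j = 2 then (0, 1) else (0, \<i>)"
    have "det (\<chi> j. ?P (?t j)) = - 2 * \<i>" by (simp add: det_3 mixed_places_def)
    then have d: "det (\<chi> j. ?P (?t j)) \<noteq> 0" by simp
    have "det (\<chi> i. ?P (f (b i))) \<noteq> 0"
      by (rule det_nonzero_from_rows[OF tp that _ _ d])
         (auto simp: vec_eq_iff mixed_places_def times_prod_def)
    then show ?thesis by (simp add: mixed_places_def)
  qed
  moreover have "cnj (mixed_places f r x) = mixed_places f (swap23 r) x" for r x
    using exhaust_3[of r] by (auto simp: mixed_places_def)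
  moreover have "mixed_places f r (\<phi> x) = of_real (\<nu> x)" for r x
    by (simp add: mixed_places_def tp_compat[OF tp])
  ultimately show ?thesis
    unfolding complex_splitting_def by blast
qed

text \<open>The real places of a split algebra are its projections to the real factors: an extension of
  the homomorphism to the completion kills all but one of the idempotents.\<close>

lemma real_places_totally_real:
  fixes \<phi> :: "'k::field \<Rightarrow> 'e::comm_ring_1" and b :: "3 \<Rightarrow> 'e"
  assumes tp: "is_tensor_product \<phi> \<nu> f (\<lambda>r. \<chi> (i::3). r)" and b: "is_basis (act \<phi>) b"
  shows "real_places_over \<phi> \<nu> = range (\<lambda>r x. f x $ r)"
proof
  note f = tp_rh1[OF tp]
  show "range (\<lambda>r x. f x $ r) \<subseteq> real_places_over \<phi> \<nu>"
    using rh_compose[OF f rh_component] by (auto simp: real_places_over_def tp_compat[OF tp])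
  show "real_places_over \<phi> \<nu> \<subseteq> range (\<lambda>r x. f x $ r)"
  proof
    fix \<tau> assume "\<tau> \<in> real_places_over \<phi> \<nu>"
    then have \<tau>: "ring_hom_map \<tau>" "\<And>c. \<tau> (\<phi> c) = \<nu> c" by (auto simp: real_places_over_def)
    obtain g where g: "ring_hom_map g" "\<And>x. g (f x) = \<tau> x" "\<And>r. g (\<chi> i. r) = r"
      using tp_universal[OF tp b \<tau>(1) rh_id \<tau>(2)] by metis
    have "(\<Sum>r\<in>UNIV. axis r (1::real)) = (1 :: real^3)" by (simp add: vec_eq_iff axis_def)
    then have "(\<Sum>r\<in>UNIV. g (axis r (1::real) :: real^3)) = 1" by (metis rh_sum[OF g(1)] rh_1[OF g(1)])
    then obtain r where r: "g (axis r 1) \<noteq> 0" by fastforce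
    have "axis r 1 * axis r 1 = (axis r 1 :: real^3)" by (simp add: vec_eq_iff axis_def)
    then have r1: "g (axis r 1) = 1" using r rh_mult[OF g(1), of "axis r 1" "axis r 1"] by simp
    have "g v = v $ r" for v
    proof -
      have "v * axis r 1 = (\<chi> i. v $ r) * axis r 1" by (auto simp: vec_eq_iff axis_def)
      then have "g v * g (axis r 1) = v $ r * g (axis r 1)" by (metis rh_mult[OF g(1)] g(3))
      then show ?thesis by (simp add: r1)
    qed
    then have "\<tau> = (\<lambda>x. f x $ r)" using g(2) by (auto simp: fun_eq_iff)
    then show "\<tau> \<in> range (\<lambda>r x. f x $ r)" by blast
  qed
qed

text \<open>The square of \<open>(0, \<i>)\<close> is the negative of the idempotent \<open>(0, 1)\<close>, so a homomorphism to the reals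
  kills the complex factor.\<close>

lemma real_places_mixed:
  fixes \<phi> :: "'k::field \<Rightarrow> 'e::comm_ring_1" and b :: "3 \<Rightarrow> 'e"
  assumes tp: "is_tensor_product \<phi> \<nu> f (\<lambda>r. (r, complex_of_real r))" and b: "is_basis (act \<phi>) b"
  shows "real_places_over \<phi> \<nu> = {\<lambda>x. fst (f x)}"
proof
  note f = tp_rh1[OF tp]
  show "{\<lambda>x. fst (f x)} \<subseteq> real_places_over \<phi> \<nu>"
    using rh_compose[OF f rh_fst] by (auto simp: real_places_over_def tp_compat[OF tp])
  show "real_places_over \<phi> \<nu> \<subseteq> {\<lambda>x. fst (f x)}"
  proof
    fix \<tau> assume "\<tau> \<in> real_places_over \<phi> \<nu>"
    then have \<tau>: "ring_hom_map \<tau>" "\<And>c. \<tau> (\<phi> c) = \<nu> c" by (auto simp: real_places_over_def)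
    obtain g where g: "ring_hom_map g" "\<And>x. g (f x) = \<tau> x" "\<And>r. g (r, of_real r) = r"
      using tp_universal[OF tp b \<tau>(1) rh_id \<tau>(2)] by metis
    have "g ((0, \<i>) * (0, \<i>)) + g (0, 1) = g ((0, \<i>) * (0, \<i>) + (0, 1))" by (rule rh_add[OF g(1), symmetric])
    then have "g (0, \<i>) * g (0, \<i>) + g (0, 1) = 0"
      by (simp add: rh_mult[OF g(1)]) (simp add: times_prod_def rh_0[OF g(1)] flip: zero_prod_def)
    moreover have "(0::real, 1::complex) * (0, 1) = (0, 1)" by (simp add: times_prod_def)
    then have "g (0, 1) * g (0, 1) = g (0, 1)" by (simp add: rh_mult[OF g(1), symmetric] times_prod_def)
    ultimately have g01: "g (0, 1) = 0"
      by (metis add_nonneg_eq_0_iff zero_le_square)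
    have "g v = fst v" for v
    proof -
      have "g v = g (fst v, of_real (fst v)) + g (v * (0, 1)) - g ((fst v, of_real (fst v)) * (0, 1))"
        by (simp add: rh_add[OF g(1), symmetric] rh_diff[OF g(1), symmetric] times_prod_def prod_eq_iff)
      then show ?thesis by (simp add: rh_mult[OF g(1)] g01 g(3))
    qed
    then show "\<tau> \<in> {\<lambda>x. fst (f x)}" using g(2) by (auto simp: fun_eq_iff)
  qed
qed

section \<open>Gram matrices\<close>

text \<open>The form is diagonal up to a permutation \<open>c\<close> of the conjugated coordinates.  Its Gram matrix is the
  product of \<open>G\<close>, a diagonal matrix and the adjoint of \<open>G\<close> with permuted rows, and the permutation
  contributes its sign.\<close>

lemma det_gram:
  fixes G :: "complex ^ 'n ^ 'n"
  assumes c: "c permutes UNIV"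
  shows "det (\<chi> i j. \<Sum>r\<in>UNIV. \<mu> r * G $ i $ r * cnj (G $ j $ c r)) =
    of_int (sign c) * (\<Prod>r\<in>UNIV. \<mu> r) * of_real ((cmod (det G))\<^sup>2)"
proof -
  define L :: "complex ^ 'n ^ 'n" where "L = (\<chi> i j. if i = j then \<mu> i else 0)"
  define K :: "complex ^ 'n ^ 'n" where "K = (\<chi> i j. cnj (G $ i $ j))"
  have K: "det K = cnj (det G)" unfolding K_def rh_det[OF rh_cnj] ..
  have L: "det L = (\<Prod>r\<in>UNIV. \<mu> r)"
    by (subst det_diagonal) (auto simp: L_def)
  have "(\<chi> i j. \<Sum>r\<in>UNIV. \<mu> r * G $ i $ r * cnj (G $ j $ c r)) =
      G ** L ** transpose (\<chi> i j. K $ i $ c j)"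
    by (simp add: matrix_matrix_mult_def L_def K_def vec_eq_iff transpose_def mult_ac
        if_distrib[of "\<lambda>x. _ * x"] cong: if_cong)
  then have "det (\<chi> i j. \<Sum>r\<in>UNIV. \<mu> r * G $ i $ r * cnj (G $ j $ c r)) =
      det G * (\<Prod>r\<in>UNIV. \<mu> r) * (of_int (sign c) * cnj (det G))"
    by (simp add: det_mul det_transpose L det_permute_columns[OF c] K)
  also have "\<dots> = of_int (sign c) * (\<Prod>r\<in>UNIV. \<mu> r) * (det G * cnj (det G))" by (simp add: mult_ac)
  finally show ?thesis by (simp only: complex_norm_square)
qed

lemma prod_UNIV_3: "prod F (UNIV :: 3 set) = F 1 * F 2 * F 3"
  unfolding UNIV_3 by (simp add: mult.assoc)

lemma splitting_det_any_basis:
  fixes b b' :: "'n::finite \<Rightarrow> 's::comm_ring_1" and g :: "'n \<Rightarrow> 's \<Rightarrow> 'f::field"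
  assumes \<phi>: "ring_hom_map \<phi>" and b: "is_basis (act \<phi>) b" and b': "is_basis (act \<phi>) b'"
    and g: "\<And>r. ring_hom_map (g r)" "\<And>r c. g r (\<phi> c) = h c"
    and G: "det (\<chi> i r. g r (b i)) \<noteq> 0"
  shows "det (\<chi> i r. g r (b' i)) \<noteq> 0"
proof -
  let ?N = "\<chi> i j. h (coords (act \<phi>) b' (b i) j)"
  have "g r (b i) = (\<Sum>j\<in>UNIV. h (coords (act \<phi>) b' (b i) j) * g r (b' j))" for i r
    by (subst coords_act[OF b', of "b i"]) (simp add: rh_simps[OF g(1)] g(2))
  then have "(\<chi> i r. g r (b i)) = ?N ** (\<chi> i r. g r (b' i))"
    by (simp add: matrix_matrix_mult_def vec_eq_iff)
  then show ?thesis using G by (auto simp: det_mul)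
qed

lemma swap23_permutes: "swap23 permutes UNIV" and sign_swap23: "sign swap23 = -1"
  and swap23_swap23: "swap23 (swap23 r) = r"
  by (auto simp: swap23_def sign_swap_id permutes_swap_id)

text \<open>Complex conjugation permutes the places, so the values of the trace form have the shape of the
  previous Gram matrix.  For \<open>l = 1\<close> this gives the sign of the discriminant of the cubic algebra.\<close>

lemma trace_gram:
  fixes b :: "3 \<Rightarrow> 'e::comm_ring_1" and \<phi> :: "'k::field \<Rightarrow> 'e"
  assumes \<phi>: "ring_hom_map \<phi>" and \<nu>: "ring_hom_map \<nu>" and \<rho>: "complex_splitting \<phi> \<nu> \<rho> c"
    and c: "c permutes UNIV" "\<And>r. c (c r) = r" and b: "is_basis (act \<phi>) b"
  shows "complex_of_real (\<nu> (det (\<chi> i j. alg_trace TYPE(3) \<phi> (l * (b i * b j))))) =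
    of_int (sign c) * (\<Prod>r\<in>UNIV. \<rho> r l) * of_real ((cmod (det (\<chi> i r. \<rho> r (b i))))\<^sup>2)"
proof -
  let ?h = "\<lambda>x. complex_of_real (\<nu> x)"
  have h: "ring_hom_map ?h" by (rule rh_compose[OF \<nu> rh_of_real])
  have tr: "?h (alg_trace TYPE(3) \<phi> x) = (\<Sum>r\<in>UNIV. \<rho> r x)" for x
    by (rule alg_trace_split[OF \<phi> b h splitting_hom[OF \<rho>] splitting_over[OF \<rho>] splitting_det[OF \<rho> b]])
  have "cnj (\<rho> (c r) x) = \<rho> r x" for r x using splitting_cnj[OF \<rho>, of "c r" x] c(2) by simp
  then have "?h (alg_trace TYPE(3) \<phi> (l * (b i * b j))) =
      (\<Sum>r\<in>UNIV. \<rho> r l * (\<chi> i r. \<rho> r (b i)) $ i $ r * cnj ((\<chi> i r. \<rho> r (b i)) $ j $ c r))" for i j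
    by (simp add: tr rh_mult[OF splitting_hom[OF \<rho>]] mult_ac)
  then have "?h (det (\<chi> i j. alg_trace TYPE(3) \<phi> (l * (b i * b j)))) =
      det (\<chi> i j. \<Sum>r\<in>UNIV. \<rho> r l * (\<chi> i r. \<rho> r (b i)) $ i $ r * cnj ((\<chi> i r. \<rho> r (b i)) $ j $ c r))"
    using rh_det[OF h, of "\<chi> i j. alg_trace TYPE(3) \<phi> (l * (b i * b j))"] by simp
  then show ?thesis unfolding det_gram[OF c(1)] .
qed

section \<open>The quadratic algebra at a real place\<close>

lemma quad_CM_negative:
  fixes \<phi> :: "'k::field \<Rightarrow> 'a::comm_ring_1"
  assumes b: "is_basis (act \<phi>) (quad_basis s)" and s: "s * s = \<phi> d"
    and f: "is_tensor_product \<phi> \<nu> f complex_of_real"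
  shows "\<nu> d < 0" "cnj (f s) = - f s"
proof -
  have "(\<lambda>i. f (quad_basis s i)) = quad_basis (f s)"
    by (auto simp: quad_basis_def rh_1[OF tp_rh1[OF f]])
  then have B: "is_basis (act complex_of_real) (quad_basis (f s))" using tp_basis[OF f b] by simp
  have "f s * f s = of_real (\<nu> d)"
    using s by (metis rh_mult[OF tp_rh1[OF f]] tp_compat[OF f])
  then have re: "Re (f s) * Re (f s) - Im (f s) * Im (f s) = \<nu> d" "Re (f s) * Im (f s) = 0"
    by (auto simp: complex_eq_iff)
  have "Im (f s) \<noteq> 0"
  proof
    assume "Im (f s) = 0"
    then have "complex_of_real (- Re (f s)) + complex_of_real 1 * f s = 0" by (simp add: complex_eq_iff)
    from quad_zero(2)[OF rh_of_real B this] show False by simp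
  qed
  then have r: "Re (f s) = 0" "\<nu> d = - (Im (f s) * Im (f s))" using re by auto
  show "\<nu> d < 0" using \<open>Im (f s) \<noteq> 0\<close> unfolding r(2) by (auto simp: zero_less_mult_iff)
  show "cnj (f s) = - f s" using r(1) by (simp add: complex_eq_iff)
qed

text \<open>Send \<open>s\<close> to the square root of \<open>\<nu> d\<close> on the imaginary axis.\<close>

lemma quad_CM_intro:
  fixes \<phi> :: "'k::field \<Rightarrow> 'a::comm_ring_1"
  assumes \<phi>: "ring_hom_map \<phi>" and b: "is_basis (act \<phi>) (quad_basis s)" and s: "s * s = \<phi> d"
    and \<nu>: "ring_hom_map \<nu>" and d: "\<nu> d < 0"
  shows "quadratic_CM_at \<phi> \<nu>"
proof -
  define w where "w = \<i> * of_real (sqrt (- \<nu> d))"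
  have ww: "w * w = of_real (\<nu> d)"
  proof -
    have "w * w = \<i> * \<i> * of_real (sqrt (- \<nu> d) * sqrt (- \<nu> d))"
      by (simp only: w_def of_real_mult mult_ac)
    also have "sqrt (- \<nu> d) * sqrt (- \<nu> d) = - \<nu> d" using d by simp
    finally show ?thesis by simp
  qed
  have Iw: "Im w \<noteq> 0" using d by (simp add: w_def)
  define f where "f x = (\<Sum>i\<in>UNIV. complex_of_real (\<nu> (coords (act \<phi>) (quad_basis s) x i)) * quad_basis w i)" for x
  have fI: "f (\<phi> x + \<phi> y * s) = of_real (\<nu> x) + of_real (\<nu> y) * w" for x y
  proof -
    have "coords (act \<phi>) (quad_basis s) (\<phi> x + \<phi> y * s) = (\<lambda>i. if i = 1 then x else y)"
      by (rule coords_act_unique[OF b]) (subst sum_quad_basis, simp)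
    then show ?thesis unfolding f_def by (subst sum_quad_basis[of "\<lambda>x. complex_of_real (\<nu> x)"]) simp
  qed
  have f: "ring_hom_map f"
  proof (rule ring_hom_mapI)
    show "f 1 = 1" using fI[of 1 0] by (simp add: rh_simps[OF \<phi>] rh_simps[OF \<nu>])
    fix x y
    obtain x0 x1 where x: "x = \<phi> x0 + \<phi> x1 * s" by (rule quad_repr[OF b])
    obtain y0 y1 where y: "y = \<phi> y0 + \<phi> y1 * s" by (rule quad_repr[OF b])
    have "x + y = \<phi> (x0 + y0) + \<phi> (x1 + y1) * s" by (simp add: x y rh_add[OF \<phi>] algebra_simps)
    then have "f (x + y) = of_real (\<nu> (x0 + y0)) + of_real (\<nu> (x1 + y1)) * w" by (simp only: fI)
    then show "f (x + y) = f x + f y" unfolding x y fI by (simp add: rh_add[OF \<nu>] algebra_simps)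
    show "f (x * y) = f x * f y"
      unfolding x y quad_mult[OF \<phi> s] fI quad_mult[OF rh_compose[OF \<nu> rh_of_real] ww] ..
  qed
  have f\<phi>: "f (\<phi> x) = of_real (\<nu> x)" for x using fI[of x 0] by (simp add: rh_simps[OF \<phi>] rh_simps[OF \<nu>])
  have "f s = w" using fI[of 0 1] by (simp add: rh_simps[OF \<phi>] rh_simps[OF \<nu>])
  then have qb: "(\<lambda>i. f (quad_basis s i)) = quad_basis w" by (auto simp: quad_basis_def rh_1[OF f])
  have "is_basis (act complex_of_real) (quad_basis w)"
  proof (subst quad_basis_iff[OF rh_of_real], intro conjI allI impI)
    fix z :: complex
    have "z = of_real (Re z - Im z / Im w * Re w) + of_real (Im z / Im w) * w"
      using Iw by (simp add: complex_eq_iff)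
    then show "\<exists>a b. z = of_real a + of_real b * w" by blast
  next
    fix a b assume 0: "of_real a + of_real b * w = 0"
    then have "Im (of_real a + of_real b * w) = 0" by simp
    then show "b = 0" using Iw by simp
    then show "a = 0" using 0 by simp
  qed
  then have "is_tensor_product \<phi> \<nu> f complex_of_real"
    using tp_from_basis[OF \<phi> \<nu> f rh_of_real f\<phi> b] qb by simp
  then show ?thesis unfolding quadratic_CM_at_def by blast
qed

lemma quad_real_positive:
  fixes \<phi> :: "'k::field \<Rightarrow> 'a::comm_ring_1"
  assumes s: "s * s = \<phi> d" "d \<noteq> 0" and re: "quadratic_totally_real_at \<phi> \<nu>"
  shows "\<nu> d > 0"
proof -
  obtain f :: "'a \<Rightarrow> real \<times> real" where f: "is_tensor_product \<phi> \<nu> f (\<lambda>r. (r, r))"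
    using re unfolding quadratic_totally_real_at_def by blast
  have "f s * f s = (\<nu> d, \<nu> d)"
    using s(1) by (metis rh_mult[OF tp_rh1[OF f]] tp_compat[OF f])
  then have "\<nu> d = fst (f s) * fst (f s)" by (simp add: times_prod_def)
  then have "\<nu> d \<ge> 0" by simp
  moreover have "\<nu> d \<noteq> 0" using s(2) rh_field_eq_0[OF tp_rhB[OF f]] by blast
  ultimately show ?thesis by simp
qed

lemma quad_unit_from_norm:
  assumes \<phi>: "ring_hom_map \<phi>" and s: "s * s = \<phi> d" and n: "(x * x - d * (y * y)) dvd 1"
  shows "(\<phi> x + \<phi> y * s) dvd 1"
proof -
  have "(\<phi> x + \<phi> y * s) * (\<phi> x - \<phi> y * s) = \<phi> x * \<phi> x - \<phi> y * \<phi> y * (s * s)"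
    by (simp add: algebra_simps)
  also have "\<dots> = \<phi> (x * x - d * (y * y))" by (simp add: s rh_simps[OF \<phi>] mult_ac)
  finally show ?thesis using rh_unit[OF \<phi> n] by (metis dvd_triv_left dvd_trans)
qed

lemma quad_norm_mult:
  assumes \<phi>: "ring_hom_map \<phi>" and b: "is_basis (act \<phi>) (quad_basis s)" and s: "s * s = \<phi> d"
  shows "alg_norm TYPE(2) \<phi> (u * v) = alg_norm TYPE(2) \<phi> u * alg_norm TYPE(2) \<phi> v"
proof -
  obtain x y where u: "u = \<phi> x + \<phi> y * s" by (rule quad_repr[OF b])
  obtain x' y' where v: "v = \<phi> x' + \<phi> y' * s" by (rule quad_repr[OF b])
  show ?thesis
    unfolding u v quad_mult[OF \<phi> s] quad_norm[OF \<phi> b s] by (simp add: algebra_simps)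
qed

lemma quad_norm_one:
  assumes \<phi>: "ring_hom_map \<phi>" and b: "is_basis (act \<phi>) (quad_basis s)" and s: "s * s = \<phi> d"
  shows "alg_norm TYPE(2) \<phi> 1 = 1"
  using quad_norm[OF \<phi> b s, of 1 0] by (simp add: rh_simps[OF \<phi>])

text \<open>At such a place the norm form \<open>x^2 - d y^2\<close> takes no negative values, and the norm of a unit is a
  unit.\<close>

lemma quad_norm_pos:
  assumes \<phi>: "ring_hom_map \<phi>" and b: "is_basis (act \<phi>) (quad_basis s)" and s: "s * s = \<phi> d"
    and \<tau>: "ring_hom_map \<tau>" and d: "\<tau> d < (0::real)" and u: "u dvd 1"
  shows "\<tau> (alg_norm TYPE(2) \<phi> u) > 0"
proof -
  obtain x y where xy: "u = \<phi> x + \<phi> y * s" by (rule quad_repr[OF b])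
  have "\<tau> d * (\<tau> y * \<tau> y) \<le> 0" using d by (intro mult_nonpos_nonneg) auto
  then have "\<tau> (alg_norm TYPE(2) \<phi> u) \<ge> 0"
    unfolding xy quad_norm[OF \<phi> b s]
    by (simp add: rh_simps[OF \<tau>]) (rule order_trans[OF _ zero_le_square])
  moreover have "\<tau> (alg_norm TYPE(2) \<phi> u) \<noteq> 0"
    using rh_unit[OF \<tau> quad_norm_unit[OF \<phi> b s u]] by auto
  ultimately show ?thesis by linarith
qed

section \<open>The Hermitian form at a CM place\<close>

text \<open>The algebras of a triple with explicit generators: a square root \<open>s\<close> of \<open>d\<close> generates \<open>A\<close>, and \<open>bE\<close>
  is a basis of \<open>E\<close>.\<close>

locale hermitian_data =
  fixes \<phi>A :: "'k::field_char_0 \<Rightarrow> 'a::comm_ring_1" and \<sigma> :: "'a \<Rightarrow> 'a"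
    and \<phi>E :: "'k \<Rightarrow> 'e::comm_ring_1" and iE :: "'e \<Rightarrow> 't::comm_ring_1" and iA :: "'a \<Rightarrow> 't"
    and s :: 'a and d :: 'k and bE :: "3 \<Rightarrow> 'e"
  assumes tp: "is_tensor_product \<phi>E \<phi>A iE iA"
    and bA: "is_basis (act \<phi>A) (quad_basis s)" and s: "s * s = \<phi>A d"
    and \<sigma>: "nontrivial_involution \<phi>A \<sigma>" and bE: "is_basis (act \<phi>E) bE"
begin

abbreviation "herm l \<equiv> herm_form iE iA \<sigma> l"

lemmas hE = tp_rhA[OF tp] and hA = tp_rhB[OF tp] and hiE = tp_rh1[OF tp] and hiA = tp_rh2[OF tp]

lemma h\<sigma>: "ring_hom_map \<sigma>" and \<sigma>_fixes: "\<sigma> (\<phi>A c) = \<phi>A c"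
  using \<sigma> by (auto simp: nontrivial_involution_def)

lemma bT_A: "is_basis (act iA) (\<lambda>i. iE (bE i))"
  by (rule tp_basis[OF tp bE])

lemma bT_E: "is_basis (act iE) (quad_basis (iA s))"
proof -
  have "(\<lambda>i. iA (quad_basis s i)) = quad_basis (iA s)"
    by (auto simp: quad_basis_def rh_1[OF hiA])
  then show ?thesis using tp_basis_right[OF tp bE bA] by simp
qed

lemma sT: "iA s * iA s = iE (\<phi>E d)"
  using s by (metis rh_mult[OF hiA] tp_compat[OF tp])

lemma sigma_ext:
  shows h\<sigma>T: "ring_hom_map (sigma_ext iE iA \<sigma>)" and sigma_ext_E: "sigma_ext iE iA \<sigma> (iE e) = iE e"
    and sigma_ext_A: "sigma_ext iE iA \<sigma> (iA a) = iA (\<sigma> a)"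
proof -
  let ?P = "\<lambda>s. ring_hom_map s \<and> (\<forall>e. s (iE e) = iE e) \<and> (\<forall>a. s (iA a) = iA (\<sigma> a))"
  obtain g where g: "ring_hom_map g" "\<And>e. g (iE e) = iE e" "\<And>a. g (iA a) = iA (\<sigma> a)"
  proof (rule tp_universal[OF tp bE hiE rh_compose[OF h\<sigma> hiA]])
    show "iE (\<phi>E c) = iA (\<sigma> (\<phi>A c))" for c by (simp add: \<sigma>_fixes tp_compat[OF tp])
  qed blast
  have "?P (THE s. ?P s)"
  proof (rule theI[of ?P g])
    show "?P g" using g by blast
    show "g' = g" if "?P g'" for g'
      by (rule ext, rule tp_hom_eq[OF tp]) (use that g in auto)
  qed
  then show "ring_hom_map (sigma_ext iE iA \<sigma>)" "sigma_ext iE iA \<sigma> (iE e) = iE e" "sigma_ext iE iA \<sigma> (iA a) = iA (\<sigma> a)"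
    unfolding sigma_ext_def by blast+
qed

lemma trace_T_E: "alg_trace TYPE(3) iA (iE x) = \<phi>A (alg_trace TYPE(3) \<phi>E x)"
  by (rule alg_trace_base_change[OF hE bE hiA bT_A hA hiE tp_compat[OF tp]])

lemma herm_on_E: "herm l (iE x) (iE y) = \<phi>A (alg_trace TYPE(3) \<phi>E (l * (x * y)))"
  unfolding herm_form_def sigma_ext_E by (simp add: trace_T_E[symmetric] rh_mult[OF hiE] mult_ac)

lemma norm_T_pos:
  assumes "\<tau> \<in> real_places_over \<phi>E \<nu>" "\<nu> d < 0" "u dvd 1"
  shows "\<tau> (alg_norm TYPE(2) iE u) > 0"
  using assms by (intro quad_norm_pos[OF hiE bT_E sT]) (auto simp: real_places_over_def)

lemma norm_class_one_pos:
  assumes "norm_class \<phi>A e = norm_class \<phi>A 1" and \<nu>: "ring_hom_map \<nu>" "\<nu> d < (0::real)"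
  shows "\<nu> e > 0"
proof -
  have "e \<in> norm_class \<phi>A e"
    unfolding norm_class_def using quad_norm_one[OF hA bA s] by (intro CollectI exI[of _ 1]) simp
  then obtain a where "e = alg_norm TYPE(2) \<phi>A a" "a dvd 1"
    using assms(1) unfolding norm_class_def by auto
  then show ?thesis using quad_norm_pos[OF hA bA s \<nu>] by simp
qed

end

text \<open>A real place \<open>\<nu>\<close> at which \<open>A\<close> is CM through \<open>f\<close>, with the complex places \<open>\<rho>\<close> of \<open>E\<close> over it.\<close>

locale hermitian_at_CM = hermitian_data \<phi>A \<sigma> \<phi>E iE iA s d bE
  for \<phi>A :: "'k::field_char_0 \<Rightarrow> 'a::comm_ring_1" and \<sigma>
    and \<phi>E :: "'k \<Rightarrow> 'e::comm_ring_1" and iE :: "'e \<Rightarrow> 't::comm_ring_1" and iA s d bE +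
  fixes \<nu> :: "'k \<Rightarrow> real" and f :: "'a \<Rightarrow> complex" and \<rho> :: "3 \<Rightarrow> 'e \<Rightarrow> complex" and c :: "3 \<Rightarrow> 3"
  assumes f: "is_tensor_product \<phi>A \<nu> f complex_of_real"
    and \<rho>: "complex_splitting \<phi>E \<nu> \<rho> c" and c: "c permutes UNIV" "\<And>r. c (c r) = r"
begin

lemmas h\<nu> = tp_rhB[OF f] and hf = tp_rh1[OF f]
lemmas \<nu>d = quad_CM_negative(1)[OF bA s f]

lemma f_\<sigma>: "f (\<sigma> a) = cnj (f a)"
proof -
  obtain x y where "a = \<phi>A x + \<phi>A y * s" by (rule quad_repr[OF bA])
  then show ?thesis
    using quad_CM_negative(2)[OF bA s f] involution_root[OF hA bA s \<sigma>]
    by (simp add: rh_simps[OF h\<sigma>] rh_simps[OF hf] \<sigma>_fixes tp_compat[OF f])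
qed

text \<open>The places of the tensor product over the pair of \<open>\<rho> r\<close> and \<open>f\<close>.\<close>

definition g :: "3 \<Rightarrow> 't \<Rightarrow> complex" where
  "g r = (SOME g. ring_hom_map g \<and> (\<forall>x. g (iE x) = \<rho> r x) \<and> (\<forall>a. g (iA a) = f a))"

lemma g: "ring_hom_map (g r)" "g r (iE x) = \<rho> r x" "g r (iA a) = f a"
proof -
  have "\<exists>g. ring_hom_map g \<and> (\<forall>x. g (iE x) = \<rho> r x) \<and> (\<forall>a. g (iA a) = f a)"
  proof (rule tp_universal[OF tp bE splitting_hom[OF \<rho>] hf])
    show "\<rho> r (\<phi>E x) = f (\<phi>A x)" for x by (simp add: splitting_over[OF \<rho>] tp_compat[OF f])
  qed blast
  from someI_ex[OF this, folded g_def]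
  show "ring_hom_map (g r)" "g r (iE x) = \<rho> r x" "g r (iA a) = f a" by blast+
qed

lemma g_sigma: "g r (sigma_ext iE iA \<sigma> t) = cnj (g (c r) t)"
proof -
  have *: "cnj (\<rho> (c r) x) = \<rho> r x" for x using splitting_cnj[OF \<rho>, of "c r" x] c(2) by simp
  show ?thesis
    by (rule tp_hom_eq[OF tp rh_compose[OF h\<sigma>T g(1)] rh_compose[OF g(1) rh_cnj]])
       (simp_all add: sigma_ext_E sigma_ext_A g f_\<sigma> *)
qed

lemma g_det:
  assumes "is_basis (act iA) (b' :: 3 \<Rightarrow> 't)"
  shows "det (\<chi> i r. g r (b' i)) \<noteq> 0"
proof (rule splitting_det_any_basis[OF hiA bT_A assms g(1,3)])
  show "det (\<chi> i r. g r (iE (bE i))) \<noteq> 0" using splitting_det[OF \<rho> bE] by (simp add: g)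
qed

text \<open>The trace over \<open>A\<close> becomes the sum over the places \<open>g r\<close>, and the extended involution conjugates and
  permutes them.\<close>

lemma herm_at: "f (herm l x y) = (\<Sum>r\<in>UNIV. \<rho> r l * g r x * cnj (g (c r) y))"
proof -
  have "f (alg_trace TYPE(3) iA t) = (\<Sum>r\<in>UNIV. g r t)" for t
    by (rule alg_trace_split[OF hiA bT_A hf g(1,3) g_det[OF bT_A]])
  then show ?thesis
    unfolding herm_form_def by (simp add: rh_mult[OF g(1)] g(2) g_sigma mult.assoc)
qed

lemma herm_det_at:
  "f (det (\<chi> i j. herm l (b' i) (b' j))) =
    of_int (sign c) * (\<Prod>r\<in>UNIV. \<rho> r l) * of_real ((cmod (det (\<chi> i r. g r (b' i))))\<^sup>2)"
proof -
  have "f (det (\<chi> i j. herm l (b' i) (b' j))) =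
      det (\<chi> i j. \<Sum>r\<in>UNIV. \<rho> r l * (\<chi> i r. g r (b' i)) $ i $ r * cnj ((\<chi> i r. g r (b' i)) $ j $ c r))"
    by (simp add: rh_det[OF hf] herm_at)
  then show ?thesis unfolding det_gram[OF c(1)] .
qed

text \<open>Discriminant one means that a Gram determinant is a norm from \<open>A\<close>, hence positive at a CM place.
  Comparison with the diagonal form fixes the sign of the product of the values of \<open>l\<close>.\<close>

lemma disc_one_sign:
  assumes "herm_has_disc \<phi>A iA (herm l) 1"
  obtains p where "p > 0" "of_int (sign c) * (\<Prod>r\<in>UNIV. \<rho> r l) = complex_of_real p"
proof -
  obtain b' :: "3 \<Rightarrow> 't" and e where b': "is_basis (act iA) b'"
    and e: "\<phi>A e = det (\<chi> i j. herm l (b' i) (b' j))" "norm_class \<phi>A e = norm_class \<phi>A 1"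
    using assms unfolding herm_has_disc_def by blast
  have pos: "\<nu> e > 0" by (rule norm_class_one_pos[OF e(2) h\<nu> \<nu>d])
  define m where "m = (cmod (det (\<chi> i r. g r (b' i))))\<^sup>2"
  have m: "m > 0" unfolding m_def using g_det[OF b'] by simp
  have "complex_of_real (\<nu> e) = of_int (sign c) * (\<Prod>r\<in>UNIV. \<rho> r l) * of_real m"
    using herm_det_at[of l b'] unfolding e(1)[symmetric] tp_compat[OF f] m_def .
  then have "of_int (sign c) * (\<Prod>r\<in>UNIV. \<rho> r l) = complex_of_real (\<nu> e / m)"
    using m by (simp add: field_simps)
  then show ?thesis using that[of "\<nu> e / m"] pos m by simp
qed

lemma herm_value_at:
  "herm_value f (herm l) b' v =
    Re (\<Sum>r\<in>UNIV. \<rho> r l * (\<Sum>i\<in>UNIV. v $ i * g r (b' i)) * cnj (\<Sum>i\<in>UNIV. v $ i * g (c r) (b' i)))"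
proof -
  have "(\<Sum>i\<in>UNIV. \<Sum>j\<in>UNIV. v $ i * cnj (v $ j) * f (herm l (b' i) (b' j))) =
      (\<Sum>i\<in>UNIV. \<Sum>j\<in>UNIV. \<Sum>r\<in>UNIV. \<rho> r l * (v $ i * g r (b' i)) * (cnj (v $ j * g (c r) (b' j))))"
    by (simp add: herm_at sum_distrib_left mult_ac)
  also have "\<dots> = (\<Sum>i\<in>UNIV. \<Sum>r\<in>UNIV. \<Sum>j\<in>UNIV. \<rho> r l * (v $ i * g r (b' i)) * (cnj (v $ j * g (c r) (b' j))))"
    by (intro sum.cong refl sum.swap)
  also have "\<dots> = (\<Sum>r\<in>UNIV. \<Sum>i\<in>UNIV. \<Sum>j\<in>UNIV. \<rho> r l * (v $ i * g r (b' i)) * (cnj (v $ j * g (c r) (b' j))))"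
    by (rule sum.swap)
  also have "\<dots> = (\<Sum>r\<in>UNIV. \<rho> r l * (\<Sum>i\<in>UNIV. v $ i * g r (b' i)) * cnj (\<Sum>i\<in>UNIV. v $ i * g (c r) (b' i)))"
    by (simp add: sum_distrib_left sum_distrib_right cnj_sum mult_ac)
  finally show ?thesis unfolding herm_value_def by simp
qed

text \<open>The diagonalising coordinates \<open>w\<close> of a vector can be prescribed because the matrix of the places on
  a basis is invertible.\<close>

lemma herm_value_diagonal:
  assumes b': "is_basis (act iA) (b' :: 3 \<Rightarrow> 't)"
  obtains v where "herm_value f (herm l) b' v = Re (\<Sum>r\<in>UNIV. \<rho> r l * w $ r * cnj (w $ c r))"
    and "w \<noteq> 0 \<longrightarrow> v \<noteq> 0"
proof -
  define G where "G = transpose (\<chi> i r. g r (b' i))"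
  have "det G \<noteq> 0" unfolding G_def det_transpose by (rule g_det[OF b'])
  then obtain H where "G ** H = mat 1" using invertible_det_nz[of G] unfolding invertible_def by blast
  define v where "v = H *v w"
  have "G *v v = w" by (simp add: v_def matrix_vector_mul_assoc \<open>G ** H = mat 1\<close>)
  then have w: "(\<Sum>i\<in>UNIV. v $ i * g r (b' i)) = w $ r" for r
    by (auto simp: G_def matrix_vector_mult_def transpose_def mult.commute)
  show ?thesis
  proof (rule that[of v])
    show "herm_value f (herm l) b' v = Re (\<Sum>r\<in>UNIV. \<rho> r l * w $ r * cnj (w $ c r))"
      by (simp only: herm_value_at w)
    show "w \<noteq> 0 \<longrightarrow> v \<noteq> 0" using \<open>G *v v = w\<close> by auto
  qed
qed

text \<open>Evaluate the form at a coordinate vector.  A place that is not its own conjugate gives an isotropic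
  vector, which a definite form does not have.\<close>

lemma pos_def_values:
  assumes "herm_pos_def_at \<phi>A iA (herm l) \<nu>"
  shows "c r = r" and "Re (\<rho> r l) > 0"
proof -
  obtain b' :: "3 \<Rightarrow> 't" where b': "is_basis (act iA) b'"
    and pos: "\<And>v. v \<noteq> 0 \<Longrightarrow> herm_value f (herm l) b' v > 0"
    using assms f unfolding herm_pos_def_at_def by blast
  obtain v where v: "herm_value f (herm l) b' v =
      Re (\<Sum>s\<in>UNIV. \<rho> s l * axis r 1 $ s * cnj (axis r 1 $ c s))" "(axis r 1 :: complex^3) \<noteq> 0 \<longrightarrow> v \<noteq> 0"
    by (rule herm_value_diagonal[OF b', of l "axis r 1"])
  have "(\<Sum>s\<in>UNIV. \<rho> s l * axis r 1 $ s * cnj (axis r 1 $ c s)) = (if c r = r then \<rho> r l else 0)"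
  proof -
    have "(\<Sum>s\<in>UNIV. \<rho> s l * axis r 1 $ s * cnj (axis r 1 $ c s)) =
        (\<Sum>s\<in>UNIV. if s = r then (if c r = r then \<rho> r l else 0) else 0)"
      by (intro sum.cong) (auto simp: axis_def)
    then show ?thesis by simp
  qed
  moreover have "herm_value f (herm l) b' v > 0" using pos v(2) by (simp add: axis_eq_0_iff)
  ultimately show "c r = r" "Re (\<rho> r l) > 0" using v(1) by (auto split: if_splits)
qed

lemma indefinite_negative_value:
  assumes "herm_indefinite_at \<phi>A iA (herm l) \<nu>" and "\<And>r. c r = r"
  obtains r where "Re (\<rho> r l) < 0"
proof -
  obtain b' :: "3 \<Rightarrow> 't" and v where neg: "herm_value f (herm l) b' v < 0"
    using assms(1) f unfolding herm_indefinite_at_def by blast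
  let ?w = "\<lambda>r. \<Sum>i\<in>UNIV. v $ i * g r (b' i)"
  have "Re (a * z * cnj z) = Re a * (cmod z)\<^sup>2" for a z
  proof -
    have "a * z * cnj z = a * of_real ((cmod z)\<^sup>2)" by (simp only: mult.assoc complex_norm_square)
    then show ?thesis
      by (simp only: times_complex.sel Re_complex_of_real Im_complex_of_real mult_zero_right diff_0_right)
  qed
  then have "herm_value f (herm l) b' v = (\<Sum>r\<in>UNIV. Re (\<rho> r l) * (cmod (?w r))\<^sup>2)"
    unfolding herm_value_at assms(2) Re_sum by (simp only:)
  then have "(\<Sum>r\<in>UNIV. Re (\<rho> r l) * (cmod (?w r))\<^sup>2) < 0" using neg by simp
  then obtain r where "Re (\<rho> r l) * (cmod (?w r))\<^sup>2 < 0"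
    by (meson not_le sum_nonneg)
  then have "\<exists>r. Re (\<rho> r l) < 0" by (meson mult_nonneg_nonneg not_le zero_le_power2)
  then show ?thesis using that by blast
qed

end

section \<open>Octonion algebras\<close>

lemma linear_expand:
  assumes "Vector_Spaces.linear s1 s2 f"
  shows "f (x + y) = f x + f y" "f (s1 c x) = s2 c (f x)" "f (sum g A) = (\<Sum>i\<in>A. f (g i))"
    "f 0 = 0" "f (x - y) = f x - f y"
proof -
  interpret Vector_Spaces.linear s1 s2 f by fact
  show "f (x + y) = f x + f y" "f (s1 c x) = s2 c (f x)" "f (sum g A) = (\<Sum>i\<in>A. f (g i))"
    "f 0 = 0" "f (x - y) = f x - f y"
    by (auto simp: add scale sum zero diff)
qed

locale octonion =
  fixes Oc :: "('k::field_char_0, 'o::ab_group_add) octonions"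
  assumes oct: "octonion_algebra Oc"
begin

abbreviation "sc \<equiv> oct_scale Oc"
abbreviation "mu \<equiv> oct_mult Oc"
abbreviation "e \<equiv> oct_one Oc"
abbreviation "N \<equiv> oct_norm Oc"
abbreviation "B \<equiv> oct_polar Oc"

lemma
  shows vs: "vector_space sc"
    and ex_basis: "\<exists>b :: 8 \<Rightarrow> 'o. is_basis sc b"
    and mu_right: "Vector_Spaces.linear sc sc (\<lambda>y. mu x y)"
    and mu_left: "Vector_Spaces.linear sc sc (\<lambda>x. mu x y)"
    and mu_e: "mu e x = x" "mu x e = x"
    and N_scale: "N (sc c x) = c\<^sup>2 * N x"
    and B_right: "Vector_Spaces.linear sc (*) (\<lambda>y. B x y)"
    and nondegenerate: "(\<And>y. B x y = 0) \<Longrightarrow> x = 0"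
    and N_mult: "N (mu x y) = N x * N y"
  using oct[unfolded octonion_algebra_def] by (elim conjE; simp)+

lemma B_sym: "B x y = B y x"
  by (simp add: oct_polar_def add.commute)

lemma B_left: "Vector_Spaces.linear sc (*) (\<lambda>x. B x y)"
  using B_right[of y] by (subst B_sym)

lemmas mu_simps = linear_expand[OF mu_right] linear_expand[OF mu_left]
lemmas B_simps = linear_expand[OF B_right] linear_expand[OF B_left]

interpretation vector_space sc by (rule vs)

lemmas scale_simps = scale_zero_left scale_one scale_right_distrib scale_left_distrib scale_scale
  scale_zero_right scale_eq_0_iff scale_left_diff_distrib
lemmas scale_sum = scale_sum_right

lemma B_self: "B x x = 2 * N x"
proof -
  have "x + x = sc 2 x" using scale_simps(4)[of 1 1 x] by (simp add: scale_simps)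
  then show ?thesis by (simp add: oct_polar_def N_scale)
qed

lemma N_add: "N (x + y) = N x + N y + B x y"
  by (simp add: oct_polar_def)

lemma e_nonzero: "e \<noteq> 0"
proof
  assume "e = 0"
  then have z: "x = 0" for x :: 'o using mu_e(1)[of x] mu_simps(9)[of x] by metis
  obtain b :: "8 \<Rightarrow> 'o" where "is_basis sc b" using ex_basis by blast
  then have "coords sc b 0 = c" for c
    by (rule coords_unique) (rule sym, rule z)
  then have "(\<lambda>_. 0) = (\<lambda>_::8. 1 :: 'k)" by metis
  then show False by (metis zero_neq_one)
qed

lemma N_e: "N e = 1"
proof -
  have "N e \<noteq> 0"
  proof
    assume "N e = 0"
    then have "N x = 0" for x using N_mult[of e x] mu_e(1) by simp
    then have "B e y = 0" for y by (simp add: oct_polar_def)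
    then show False using nondegenerate e_nonzero by blast
  qed
  moreover have "N e * N e = N e" using N_mult[of e e] mu_e(1) by simp
  ultimately show ?thesis by simp
qed

text \<open>Polarising the multiplicativity of the norm gives the quadratic equation of an element.\<close>

lemma quadratic_equation: "mu x x = sc (B x e) x - sc (N x) e"
proof -
  have P1: "B (mu x y) (mu x z) = N x * B y z" for x y z
  proof -
    have "B (mu x y) (mu x z) = N (mu x (y + z)) - N (mu x y) - N (mu x z)"
      by (simp add: oct_polar_def mu_simps)
    then show ?thesis by (simp add: N_mult oct_polar_def algebra_simps)
  qed
  have P1': "B (mu x y) (mu z y) = B x z * N y" for x y z
  proof -
    have "B (mu x y) (mu z y) = N (mu (x + z) y) - N (mu x y) - N (mu z y)"
      by (simp add: oct_polar_def mu_simps)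
    then show ?thesis by (simp add: N_mult oct_polar_def algebra_simps)
  qed
  have P2: "B (mu x y) (mu z w) + B (mu x w) (mu z y) = B x z * B y w" for x y z w
  proof -
    have "B (mu x (y + w)) (mu z (y + w)) = B x z * N (y + w)" by (rule P1')
    then show ?thesis
      using B_sym[of y w] by (simp add: mu_simps B_simps P1' N_add algebra_simps)
  qed
  have "B (mu x x - (sc (B x e) x - sc (N x) e)) z = 0" for z
  proof -
    have "B (mu x x) z + B (mu x z) x = B x e * B x z" using P2[of x x e z] by (simp add: mu_e)
    moreover have "B (mu x z) x = N x * B z e" using P1[of x z e] by (simp add: mu_e)
    ultimately show ?thesis by (simp add: B_simps B_sym[of e z] algebra_simps)
  qed
  from nondegenerate[OF this] show ?thesis by simp
qed

lemma pure_square: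
  assumes "mu x x = sc d e" "\<And>c. x \<noteq> sc c e"
  shows "B x e = 0" "N x = - d"
proof -
  have eq: "sc (B x e) x = sc (d + N x) e"
    using quadratic_equation[of x] assms(1) by (simp add: scale_simps algebra_simps)
  show 0: "B x e = 0"
  proof (rule ccontr)
    assume n: "B x e \<noteq> 0"
    have "x = sc (inverse (B x e)) (sc (B x e) x)" using n by (simp add: scale_simps)
    also have "\<dots> = sc (inverse (B x e) * (d + N x)) e" by (simp add: eq scale_simps distrib_left)
    finally show False using assms(2) by blast
  qed
  have "sc (d + N x) e = 0" unfolding eq[symmetric] 0 by (rule scale_simps(1))
  then have "d + N x = 0" using e_nonzero scale_simps(7) by blast
  then show "N x = - d" by (simp add: eq_neg_iff_add_eq_0 add.commute)
qed

lemma square_pure: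
  assumes "B x e = 0" shows "mu x x = sc (- N x) e"
proof -
  have "sc (- N x) e = - sc (N x) e" using scale_simps(8)[of 0 "N x" e] by (simp add: scale_simps)
  then show ?thesis using quadratic_equation[of x] assms by (simp add: scale_simps)
qed

lemma embeds_quadratic:
  fixes \<phi> :: "'k \<Rightarrow> 'a::comm_ring_1"
  assumes \<phi>: "ring_hom_map \<phi>" and b: "is_basis (act \<phi>) (quad_basis s)" and s: "s * s = \<phi> d"
    and x: "B x e = 0" "N x = - d" "x \<noteq> 0"
  shows "embeds_in_octonions \<phi> Oc"
proof -
  have xx: "mu x x = sc d e" using square_pure[OF x(1)] x(2) by simp
  define f where "f z = sc (coords (act \<phi>) (quad_basis s) z 1) e + sc (coords (act \<phi>) (quad_basis s) z 2) x" for z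
  have fI: "f (\<phi> p + \<phi> q * s) = sc p e + sc q x" for p q
  proof -
    have "coords (act \<phi>) (quad_basis s) (\<phi> p + \<phi> q * s) = (\<lambda>i. if i = 1 then p else q)"
      by (rule coords_act_unique[OF b]) (subst sum_quad_basis, simp)
    then show ?thesis unfolding f_def by simp
  qed
  have add: "f (y + z) = f y + f z" for y z
  proof -
    obtain p q where y: "y = \<phi> p + \<phi> q * s" by (rule quad_repr[OF b])
    obtain p' q' where z: "z = \<phi> p' + \<phi> q' * s" by (rule quad_repr[OF b])
    have "y + z = \<phi> (p + p') + \<phi> (q + q') * s" by (simp add: y z rh_add[OF \<phi>] algebra_simps)
    then have "f (y + z) = sc (p + p') e + sc (q + q') x" by (simp only: fI)
    then show ?thesis unfolding y z fI by (simp add: scale_simps algebra_simps)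
  qed
  have mult: "f (y * z) = mu (f y) (f z)" for y z
  proof -
    obtain p q where y: "y = \<phi> p + \<phi> q * s" by (rule quad_repr[OF b])
    obtain p' q' where z: "z = \<phi> p' + \<phi> q' * s" by (rule quad_repr[OF b])
    have "f (y * z) = sc (p * p' + d * (q * q')) e + sc (p * q' + q * p') x"
      unfolding y z quad_mult[OF \<phi> s] by (rule fI)
    also have "\<dots> = mu (f y) (f z)"
      unfolding y z fI by (simp add: mu_simps mu_e xx scale_simps mult_ac add_ac)
    finally show ?thesis .
  qed
  have f1: "f 1 = e" using fI[of 1 0] by (simp add: rh_simps[OF \<phi>] scale_simps)
  have scale: "f (\<phi> c * y) = sc c (f y)" for c y
    using mult[of "\<phi> c" y] fI[of c 0] by (simp add: rh_0[OF \<phi>] scale_simps mu_simps mu_e)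
  have inj: "inj f"
  proof -
    have z0: "z = 0" if "f z = 0" for z
    proof -
      obtain p q where z: "z = \<phi> p + \<phi> q * s" by (rule quad_repr[OF b])
      have 0: "sc p e + sc q x = 0" using that unfolding z fI .
      then have "B (sc p e + sc q x) e = 0" by (simp add: B_simps)
      then have "p = 0" using B_self[of e] N_e x(1) by (simp add: B_simps)
      then have "q = 0" using 0 x(3) by (simp add: scale_simps)
      then show ?thesis using \<open>p = 0\<close> by (simp add: z rh_0[OF \<phi>])
    qed
    show ?thesis
    proof (rule injI)
      fix y z assume "f y = f z"
      then have "f (y - z) = 0" using add[of "y - z" z] by simp
      then show "y = z" using z0 by fastforce
    qed
  qed
  show ?thesis
    unfolding embeds_in_octonions_def using inj f1 add scale mult by blast
qed

end

section \<open>Base change of octonion algebras to the reals\<close>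

lemma rh_of_rat:
  fixes \<nu> :: "'k::field_char_0 \<Rightarrow> real"
  assumes \<nu>: "ring_hom_map \<nu>" shows "\<nu> (of_rat q) = of_rat q"
proof -
  have i: "\<nu> (of_int n) = of_int n" for n
    by (cases n) (simp_all add: rh_of_nat[OF \<nu>] rh_diff[OF \<nu>] rh_minus[OF \<nu>] rh_add[OF \<nu>] rh_1[OF \<nu>])
  obtain a b where q: "q = Rat.Fract a b" "b > 0" by (cases q) auto
  have "of_rat q * of_int b = (of_int a :: 'k)" using q by (simp add: of_rat_rat)
  then have "\<nu> (of_rat q * of_int b) = of_int a" using i by simp
  then have "\<nu> (of_rat q) * of_int b = of_int a" by (simp add: rh_mult[OF \<nu>] i)
  then show ?thesis using q by (simp add: of_rat_rat field_simps)
qed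

text \<open>A ring endomorphism of the reals maps squares to squares, so it preserves the order, and it fixes
  the rational numbers.\<close>

lemma real_place_real:
  assumes \<nu>: "ring_hom_map (\<nu> :: real \<Rightarrow> real)" shows "\<nu> x = x"
proof -
  have mono: "\<nu> x \<le> \<nu> y" if "x \<le> y" for x y
  proof -
    have "y - x = sqrt (y - x) * sqrt (y - x)" using that by simp
    then have "\<nu> (y - x) = \<nu> (sqrt (y - x)) * \<nu> (sqrt (y - x))" by (metis rh_mult[OF \<nu>])
    then have "\<nu> (y - x) \<ge> 0" by simp
    then show ?thesis by (simp add: rh_diff[OF \<nu>])
  qed
  have rat: "\<nu> (of_rat q) = of_rat q" for q by (rule rh_of_rat[OF \<nu>])
  show ?thesis
  proof (rule antisym; rule ccontr)
    assume "\<not> \<nu> x \<le> x"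
    then obtain q where "x < of_rat q" "of_rat q < \<nu> x" using of_rat_dense[of x "\<nu> x"] by auto
    then show False using mono[of x "of_rat q"] rat by simp
  next
    assume "\<not> x \<le> \<nu> x"
    then obtain q where "\<nu> x < of_rat q" "of_rat q < x" using of_rat_dense[of "\<nu> x" x] by auto
    then show False using mono[of "of_rat q" x] rat by simp
  qed
qed

lemma axis_basis: "is_basis (*\<^sub>R) (\<lambda>i::'n::finite. axis i (1::real))"
proof -
  have expand: "(\<Sum>i\<in>UNIV. c i *\<^sub>R axis i (1::real)) = (\<chi> i. c i)" for c :: "'n \<Rightarrow> real"
    by (simp add: vec_eq_iff axis_def if_distrib cong: if_cong)
  have "(x = (\<Sum>i\<in>UNIV. c i *\<^sub>R axis i (1::real))) \<longleftrightarrow> c = (\<lambda>i. x $ i)" for x :: "real ^ 'n" and c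
    unfolding expand by (auto simp: vec_eq_iff fun_eq_iff)
  then show ?thesis unfolding is_basis_def by simp
qed

locale octonion_place = octonion Oc for Oc :: "('k::field_char_0, 'o::ab_group_add) octonions" +
  fixes \<nu> :: "'k \<Rightarrow> real"
  assumes \<nu>: "ring_hom_map \<nu>"
begin

definition b0 :: "8 \<Rightarrow> 'o" where "b0 = (SOME b. is_basis sc b)"

text \<open>The image of an octonion in the base change, in the coordinates that define the latter.\<close>

definition V :: "'o \<Rightarrow> real ^ 8" where "V x = (\<chi> l. \<nu> (coords sc b0 x l))"

abbreviation "Ov \<equiv> octonions_at Oc \<nu>"

lemma b0: "is_basis sc b0"
  unfolding b0_def using ex_basis by (rule someI_ex)

lemma repr: "x = (\<Sum>i\<in>UNIV. sc (coords sc b0 x i) (b0 i))"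
  by (rule coords_eq[OF b0])

lemma
  shows Ov_scale: "oct_scale Ov = (*\<^sub>R)"
    and Ov_mult: "oct_mult Ov x y = (\<Sum>i\<in>UNIV. \<Sum>j\<in>UNIV. (x $ i * y $ j) *\<^sub>R V (mu (b0 i) (b0 j)))"
    and Ov_one: "oct_one Ov = V e"
    and Ov_norm: "oct_norm Ov x = (\<Sum>i\<in>UNIV. \<Sum>j\<in>UNIV. x $ i * x $ j * \<nu> (B (b0 i) (b0 j))) / 2"
  by (simp_all add: octonions_at_def b0_def V_def Let_def vec_eq_iff)

lemma Ov_polar: "oct_polar Ov x y = (\<Sum>i\<in>UNIV. \<Sum>j\<in>UNIV. x $ i * y $ j * \<nu> (B (b0 i) (b0 j)))"
proof -
  define S where "S x y = (\<Sum>i\<in>UNIV. \<Sum>j\<in>UNIV. x $ i * y $ j * \<nu> (B (b0 i) (b0 j)))" for x y :: "real^8"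
  have "S y x = (\<Sum>i\<in>UNIV. \<Sum>j\<in>UNIV. x $ i * y $ j * \<nu> (B (b0 j) (b0 i)))"
    unfolding S_def by (subst sum.swap) (simp add: mult_ac)
  also have "\<dots> = S x y" unfolding S_def by (subst B_sym) (rule refl)
  finally have sym: "S y x = S x y" .
  have "S (x + y) (x + y) = S x x + S y y + (S x y + S y x)"
    by (simp add: S_def distrib_right distrib_left sum.distrib)
  then have "(S (x + y) (x + y)) / 2 - S x x / 2 - S y y / 2 = S x y"
    using sym by linarith
  then show ?thesis unfolding oct_polar_def[of Ov] Ov_norm S_def .
qed

lemma coords_add: "coords sc b0 (x + y) i = coords sc b0 x i + coords sc b0 y i"
proof -
  have "x + y = (\<Sum>i\<in>UNIV. sc (coords sc b0 x i + coords sc b0 y i) (b0 i))"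
    using repr[of x] repr[of y] by (simp add: scale_simps sum.distrib)
  from coords_unique[OF b0 this] show ?thesis by simp
qed

lemma coords_scale: "coords sc b0 (sc c x) i = c * coords sc b0 x i"
proof -
  have "sc c x = (\<Sum>i\<in>UNIV. sc (c * coords sc b0 x i) (b0 i))"
    by (subst repr[of x]) (simp add: scale_simps scale_sum)
  from coords_unique[OF b0 this] show ?thesis by simp
qed

lemma V_add: "V (x + y) = V x + V y"
  by (simp add: V_def vec_eq_iff coords_add rh_add[OF \<nu>])

lemma V_scale: "V (sc c x) = \<nu> c *\<^sub>R V x"
  by (simp add: V_def vec_eq_iff coords_scale rh_mult[OF \<nu>])

lemma V_0: "V 0 = 0"
  using V_add[of 0 0] by simp

lemma V_sum: "V (sum g A) = (\<Sum>i\<in>A. V (g i))"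
  by (induction A rule: infinite_finite_induct) (auto simp: V_0 V_add)

lemma V_mult: "oct_mult Ov (V x) (V y) = V (mu x y)"
proof -
  have "mu x y = (\<Sum>i\<in>UNIV. \<Sum>j\<in>UNIV. sc (coords sc b0 x i * coords sc b0 y j) (mu (b0 i) (b0 j)))"
  proof -
    have "mu x y = mu (\<Sum>i\<in>UNIV. sc (coords sc b0 x i) (b0 i)) (\<Sum>i\<in>UNIV. sc (coords sc b0 y i) (b0 i))"
      using repr[of x] repr[of y] by simp
    also have "\<dots> = (\<Sum>i\<in>UNIV. sc (coords sc b0 x i) (\<Sum>j\<in>UNIV. sc (coords sc b0 y j) (mu (b0 i) (b0 j))))"
      by (simp only: linear_expand(2,3)[OF mu_left]) (simp only: linear_expand(2,3)[OF mu_right])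
    finally show ?thesis by (simp add: scale_sum scale_simps)
  qed
  then show ?thesis
    by (simp add: Ov_mult V_sum V_scale rh_mult[OF \<nu>]) (simp add: V_def)
qed

lemma V_polar: "oct_polar Ov (V x) (V y) = \<nu> (B x y)"
proof -
  have "B x y = B (\<Sum>i\<in>UNIV. sc (coords sc b0 x i) (b0 i)) (\<Sum>i\<in>UNIV. sc (coords sc b0 y i) (b0 i))"
    using repr[of x] repr[of y] by simp
  also have "\<dots> = (\<Sum>i\<in>UNIV. coords sc b0 x i * (\<Sum>j\<in>UNIV. coords sc b0 y j * B (b0 i) (b0 j)))"
    by (simp only: linear_expand(2,3)[OF B_left]) (simp only: linear_expand(2,3)[OF B_right])
  finally show ?thesis
    by (simp add: Ov_polar V_def rh_sum[OF \<nu>] rh_mult[OF \<nu>] sum_distrib_left mult_ac)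
qed

lemma V_norm: "oct_norm Ov (V x) = \<nu> (N x)"
proof -
  have "2 * oct_norm Ov (V x) = oct_polar Ov (V x) (V x)" by (simp add: Ov_norm Ov_polar)
  also have "\<dots> = 2 * \<nu> (N x)" by (simp add: V_polar B_self rh_simps[OF \<nu>])
  finally show ?thesis by simp
qed

text \<open>The image of the algebra contains all rational vectors, so it is dense and polynomial
  identities pass to the base change.\<close>

lemma closure_V: "closure (range V) = UNIV"
proof -
  have "\<exists>x. dist (V x) v < \<epsilon>" if "\<epsilon> > 0" for v \<epsilon>
  proof -
    have "\<exists>q::rat. v $ i < of_rat q \<and> of_rat q < v $ i + \<epsilon> / 8" for i
      using of_rat_dense[of "v $ i" "v $ i + \<epsilon> / 8"] that by auto
    then obtain q :: "8 \<Rightarrow> rat" where q: "\<And>i. v $ i < of_rat (q i)" "\<And>i. of_rat (q i) < v $ i + \<epsilon> / 8" by metis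
    define x where "x = (\<Sum>i\<in>UNIV. sc (of_rat (q i)) (b0 i))"
    have "coords sc b0 x = (\<lambda>i. of_rat (q i))" by (rule coords_unique[OF b0]) (simp add: x_def)
    then have Vx: "V x $ i = of_rat (q i)" for i by (simp add: V_def rh_of_rat[OF \<nu>])
    have "dist (V x) v \<le> (\<Sum>i\<in>UNIV. \<bar>(V x - v) $ i\<bar>)" unfolding dist_norm by (rule norm_le_l1_cart)
    also have "\<dots> < (\<Sum>i\<in>(UNIV :: 8 set). \<epsilon> / 8)"
    proof (rule sum_strict_mono)
      fix i :: 8
      show "\<bar>(V x - v) $ i\<bar> < \<epsilon> / 8" using q[of i] by (simp add: Vx)
    qed auto
    also have "\<dots> = \<epsilon>" by simp
    finally show ?thesis by blast
  qed
  then show ?thesis by (auto simp: closure_approachable)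
qed

lemma density:
  fixes F G :: "real ^ 8 \<Rightarrow> 'c::t2_space"
  assumes "continuous_on UNIV F" "continuous_on UNIV G" "\<And>x. F (V x) = G (V x)"
  shows "F v = G v"
proof -
  have "closed {v. F v = G v}" using assms(1,2) by (rule closed_Collect_eq)
  then have "closure (range V) \<subseteq> {v. F v = G v}" using assms(3) by (intro closure_minimal) auto
  then show ?thesis using closure_V by auto
qed

lemma continuous_mult: "continuous_on UNIV (\<lambda>y. oct_mult Ov x y)" "continuous_on UNIV (\<lambda>x. oct_mult Ov x y)"
  unfolding Ov_mult by (intro continuous_intros)+

lemma continuous_norm: "continuous_on UNIV (oct_norm Ov)"
  unfolding Ov_norm[abs_def] by (intro continuous_intros) auto

lemma Ov_norm_mult: "oct_norm Ov (oct_mult Ov x y) = oct_norm Ov x * oct_norm Ov y"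
proof -
  have comp: "continuous_on UNIV (\<lambda>x. oct_norm Ov (F x))" if "continuous_on UNIV F" for F :: "real^8 \<Rightarrow> _"
    by (rule continuous_on_compose2[OF continuous_norm that]) auto
  have 1: "oct_norm Ov (oct_mult Ov (V x) y) = oct_norm Ov (V x) * oct_norm Ov y" for x y
    by (rule density[where v = y, OF comp[OF continuous_mult(1)] continuous_on_mult_left[OF continuous_norm]])
       (simp add: V_mult V_norm N_mult rh_mult[OF \<nu>])
  show ?thesis
    by (rule density[where v = x, OF comp[OF continuous_mult(2)] continuous_on_mult_right[OF continuous_norm]])
       (rule 1)
qed

lemma Ov_mult_one: "oct_mult Ov (oct_one Ov) x = x" "oct_mult Ov x (oct_one Ov) = x"
proof -
  show "oct_mult Ov (oct_one Ov) x = x"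
    by (rule density[where v = x, OF continuous_mult(1) continuous_on_id]) (simp add: Ov_one V_mult mu_e)
  show "oct_mult Ov x (oct_one Ov) = x"
    by (rule density[where v = x, OF continuous_mult(2) continuous_on_id]) (simp add: Ov_one V_mult mu_e)
qed

lemma Ov_nondegenerate:
  assumes "\<And>y. oct_polar Ov x y = 0" shows "x = 0"
proof -
  define \<Gamma> :: "'k ^ 8 ^ 8" where "\<Gamma> = (\<chi> i j. B (b0 i) (b0 j))"
  have "det \<Gamma> \<noteq> 0"
  proof -
    have "v = 0" if "\<Gamma> *v v = 0" for v
    proof -
      define z where "z = (\<Sum>j\<in>UNIV. sc (v $ j) (b0 j))"
      have "B z (b0 i) = 0" for i
      proof -
        have "B z (b0 i) = (\<Sum>j\<in>UNIV. v $ j * B (b0 j) (b0 i))"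
          by (simp only: z_def linear_expand(2,3)[OF B_left])
        also have "\<dots> = (\<Gamma> *v v) $ i" by (simp add: \<Gamma>_def matrix_vector_mult_def B_sym[of "b0 i"] mult.commute)
        finally show ?thesis using that by simp
      qed
      then have "B z y = 0" for y
        by (subst repr[of y]) (simp only: linear_expand(2,3)[OF B_right] mult_zero_right sum.neutral_const)
      then have "z = 0" by (rule nondegenerate)
      then have "0 = (\<Sum>j\<in>UNIV. sc (v $ j) (b0 j))" by (simp add: z_def)
      from coords_unique[OF b0 this] have "coords sc b0 0 = (\<lambda>j. v $ j)" .
      moreover have "coords sc b0 0 = (\<lambda>j. 0)" by (rule coords_unique[OF b0]) (simp add: scale_simps)
      ultimately show ?thesis by (simp add: vec_eq_iff fun_eq_iff)
    qed
    then show ?thesis using matrix_left_invertible_ker[of \<Gamma>] invertible_left_inverse[of \<Gamma>] invertible_det_nz[of \<Gamma>] by blast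
  qed
  define \<Gamma>' :: "real ^ 8 ^ 8" where "\<Gamma>' = (\<chi> i j. \<nu> (\<Gamma> $ i $ j))"
  have "det \<Gamma>' \<noteq> 0" using \<open>det \<Gamma> \<noteq> 0\<close> rh_det[OF \<nu>, of \<Gamma>] rh_field_eq_0[OF \<nu>] by (metis \<Gamma>'_def)
  then obtain H where H: "H ** \<Gamma>' = mat 1" using invertible_det_nz[of \<Gamma>'] unfolding invertible_def by blast
  have "(\<Gamma>' *v x) $ i = oct_polar Ov x (axis i 1)" for i
    by (simp add: \<Gamma>'_def \<Gamma>_def Ov_polar matrix_vector_mult_def axis_def B_sym[of "b0 i"] mult_ac
        if_distrib[of "\<lambda>x. _ * x"] if_distrib[of "\<lambda>x. x * _"] cong: if_cong)
  then have "\<Gamma>' *v x = 0" using assms by (simp add: vec_eq_iff)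
  then have "(H ** \<Gamma>') *v x = 0" by (simp add: matrix_vector_mul_assoc[symmetric])
  then show ?thesis by (simp add: H)
qed

theorem octonions_at_octonion: "octonion_algebra Ov"
proof -
  have vsR: "vector_space ((*\<^sub>R) :: real \<Rightarrow> real^8 \<Rightarrow> _)" by (rule real_vector.vector_space_axioms)
  have vsr: "vector_space ((*) :: real \<Rightarrow> real \<Rightarrow> _)" by unfold_locales (auto simp: algebra_simps)
  have lin: "Vector_Spaces.linear (*\<^sub>R) (*\<^sub>R) F" if "\<And>x y. F (x + y) = F x + F y" "\<And>c x. F (c *\<^sub>R x) = c *\<^sub>R F x"
    for F :: "real^8 \<Rightarrow> real^8"
    using vsR that by (intro Vector_Spaces.linear_iff[THEN iffD2]) auto
  have lin': "Vector_Spaces.linear (*\<^sub>R) (*) F" if "\<And>x y. F (x + y) = F x + F y" "\<And>c x. F (c *\<^sub>R x) = c * F x"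
    for F :: "real^8 \<Rightarrow> real"
    using vsR vsr that by (intro Vector_Spaces.linear_iff[THEN iffD2]) auto
  show ?thesis
    unfolding octonion_algebra_def Ov_scale
  proof (intro conjI allI impI)
    show "\<exists>b :: 8 \<Rightarrow> real^8. is_basis (*\<^sub>R) b" using axis_basis by blast
    show "Vector_Spaces.linear (*\<^sub>R) (*\<^sub>R) (oct_mult Ov x)" for x
      by (rule lin) (simp_all add: Ov_mult algebra_simps sum.distrib scaleR_sum_right)
    show "Vector_Spaces.linear (*\<^sub>R) (*\<^sub>R) (\<lambda>x. oct_mult Ov x y)" for y
      by (rule lin) (simp_all add: Ov_mult algebra_simps sum.distrib scaleR_sum_right)
    show "Vector_Spaces.linear (*\<^sub>R) (*) (oct_polar Ov x)" for x
      by (rule lin') (simp_all add: Ov_polar algebra_simps sum.distrib sum_distrib_left)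
    show "oct_norm Ov (c *\<^sub>R x) = c\<^sup>2 * oct_norm Ov x" for c x
      by (simp add: Ov_norm sum_distrib_left power2_eq_square mult_ac)
  qed (auto simp: vsR Ov_mult_one Ov_norm_mult intro: Ov_nondegenerate)
qed

end

text \<open>The root \<open>s\<close> becomes a pure octonion of norm \<open>- d\<close>, and a definite norm is positive because its
  value at the unit is \<open>1\<close>.\<close>

lemma definite_quadratic:
  fixes Oc :: "('k::field_char_0, 'o::ab_group_add) octonions" and \<phi> :: "'k \<Rightarrow> 'a::comm_ring_1"
  assumes oct: "octonion_algebra Oc" and \<nu>: "ring_hom_map \<nu>" and def: "oct_definite_at Oc \<nu>"
    and \<phi>: "ring_hom_map \<phi>" and b: "is_basis (act \<phi>) (quad_basis s)" and s: "s * s = \<phi> d"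
    and emb: "embeds_in_octonions \<phi> Oc"
  shows "\<nu> d < 0"
proof -
  interpret octonion_place Oc \<nu> using oct \<nu> by unfold_locales
  obtain f where f: "inj f" "f 1 = e" "\<And>x y. f (x + y) = f x + f y" "\<And>c x. f (\<phi> c * x) = sc c (f x)"
    "\<And>x y. f (x * y) = mu (f x) (f y)"
    using emb unfolding embeds_in_octonions_def by blast
  have fc: "f (\<phi> c) = sc c e" for c using f(4)[of c 1] f(2) by simp
  have "mu (f s) (f s) = sc d e" using f(5)[of s s] s fc by metis
  moreover have "f s \<noteq> sc c e" for c
  proof
    assume "f s = sc c e"
    then have "s = \<phi> c" using f(1) fc by (metis injD)
    then have "\<phi> (- c) + \<phi> 1 * s = 0" by (simp add: rh_simps[OF \<phi>])
    then show False using quad_zero(2)[OF \<phi> b] by (metis one_neq_zero)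
  qed
  ultimately have Ns: "N (f s) = - d" by (rule pure_square(2))
  have "f s \<noteq> sc 0 e" by fact
  then have s0: "f s \<noteq> 0" by (simp add: scale_simps)
  have V0: "V x \<noteq> 0" if "x \<noteq> 0" for x
  proof
    assume "V x = 0"
    then have "coords sc b0 x i = 0" for i
      using rh_field_eq_0[OF \<nu>] by (simp add: V_def vec_eq_iff)
    then show False using that repr[of x] by (simp add: scale_simps)
  qed
  have "oct_norm Ov (V e) = 1" by (simp add: V_norm N_e rh_1[OF \<nu>])
  then have "oct_norm Ov (V (f s)) > 0"
    using def V0[OF s0] V0[OF e_nonzero] unfolding oct_definite_at_def definite_form_def by force
  then show ?thesis by (simp add: V_norm Ns rh_minus[OF \<nu>])
qed

text \<open>The plane spanned by two diagonalising vectors of the required sign meets the space of pure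
  octonions, which has codimension one; scaling then gives every value of that sign.\<close>

lemma split_represents:
  fixes Oc :: "(real, real ^ 8) octonions"
  assumes oct: "octonion_algebra Oc" and sc: "oct_scale Oc = (*\<^sub>R)" and sig: "has_signature (oct_norm Oc) (4, 4)"
    and a: "a \<noteq> 0"
  obtains x where "oct_polar Oc x (oct_one Oc) = 0" "oct_norm Oc x = a"
proof -
  interpret octonion Oc by unfold_locales (rule oct)
  obtain u :: "8 \<Rightarrow> real^8" and d :: "8 \<Rightarrow> real"
    where q: "\<And>x. N (\<Sum>i\<in>UNIV. x i *\<^sub>R u i) = (\<Sum>i\<in>UNIV. d i * (x i)\<^sup>2)"
    and pos: "card {i. d i > 0} = 4" and neg: "card {i. d i < 0} = 4"
    using sig unfolding has_signature_def by auto
  have "{i. a * d i > 0} = (if a > 0 then {i. d i > 0} else {i. d i < 0})"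
    using a by (auto simp: zero_less_mult_iff)
  then have "card {i. a * d i > 0} = 4" using pos neg by simp
  then obtain i j where ij: "i \<noteq> j" "a * d i > 0" "a * d j > 0"
  proof -
    assume c: "card {i. a * d i > 0} = 4"
    then have "card {i. a * d i > 0} > Suc 0" by simp
    then obtain i j where "i \<in> {i. a * d i > 0}" "j \<in> {i. a * d i > 0}" "i \<noteq> j"
      using card_le_Suc0_iff_eq[of "{i. a * d i > 0}"] by (metis finite not_le)
    then show ?thesis using that by blast
  qed
  obtain \<alpha> \<beta> where ab: "\<alpha> * B (u i) e + \<beta> * B (u j) e = 0" "\<alpha> \<noteq> 0 \<or> \<beta> \<noteq> 0"
  proof (cases "B (u i) e = 0")
    case True
    then show ?thesis using that[of 1 0] by simp
  next
    case False
    then show ?thesis using that[of "B (u j) e" "- B (u i) e"] by simp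
  qed
  define x where "x = \<alpha> *\<^sub>R u i + \<beta> *\<^sub>R u j"
  have Bx: "B x e = 0" using ab(1) linear_expand(1,2)[OF B_left, unfolded sc] by (simp add: x_def)
  have Nx: "N x = d i * \<alpha>\<^sup>2 + d j * \<beta>\<^sup>2"
  proof -
    define y where "y = (\<lambda>k. if k = i then \<alpha> else if k = j then \<beta> else 0)"
    have "(\<Sum>k\<in>UNIV. y k *\<^sub>R u k) = (\<Sum>k\<in>{i,j}. y k *\<^sub>R u k)"
      by (rule sum.mono_neutral_right) (auto simp: y_def)
    then have "x = (\<Sum>k\<in>UNIV. y k *\<^sub>R u k)" using ij(1) by (simp add: x_def y_def)
    then have "N x = (\<Sum>k\<in>UNIV. d k * (y k)\<^sup>2)" using q by simp
    also have "\<dots> = (\<Sum>k\<in>{i,j}. d k * (y k)\<^sup>2)"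
      by (rule sum.mono_neutral_right) (auto simp: y_def)
    finally show ?thesis using ij(1) by (simp add: y_def)
  qed
  have "a * N x > 0"
  proof -
    have "a * N x = (a * d i) * \<alpha>\<^sup>2 + (a * d j) * \<beta>\<^sup>2" by (simp add: Nx algebra_simps)
    moreover have "(a * d i) * \<alpha>\<^sup>2 \<ge> 0" "(a * d j) * \<beta>\<^sup>2 \<ge> 0" using ij by auto
    moreover have "(a * d i) * \<alpha>\<^sup>2 > 0 \<or> (a * d j) * \<beta>\<^sup>2 > 0" using ij ab(2) by auto
    ultimately show ?thesis by linarith
  qed
  then have r: "a / N x > 0" by (simp add: zero_less_divide_iff zero_less_mult_iff)
  define z where "z = sqrt (a / N x) *\<^sub>R x"
  have "B z e = 0" using Bx linear_expand(2)[OF B_left, unfolded sc] by (simp add: z_def)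
  moreover have "N z = a"
  proof -
    have "N z = (sqrt (a / N x))\<^sup>2 * N x" using N_scale[of "sqrt (a / N x)" x] by (simp add: z_def sc)
    then show ?thesis using r by (auto simp: real_sqrt_pow2)
  qed
  ultimately show ?thesis using that by blast
qed

lemma split_not_definite:
  fixes Oc :: "(real, real ^ 8) octonions"
  assumes oct: "octonion_algebra Oc" and sc: "oct_scale Oc = (*\<^sub>R)" and sig: "has_signature (oct_norm Oc) (4, 4)"
    and \<nu>: "ring_hom_map \<nu>"
  shows "\<not> oct_definite_at Oc \<nu>"
proof
  interpret octonion_place Oc \<nu> using oct \<nu> by unfold_locales
  assume def: "oct_definite_at Oc \<nu>"
  obtain x where "N x = 1" using split_represents[OF oct sc sig, of 1] by auto
  obtain y where "N y = -1" using split_represents[OF oct sc sig, of "-1"] by auto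
  have "oct_norm Ov 0 = 0" by (simp add: Ov_norm)
  moreover have "oct_norm Ov (V x) = 1" "oct_norm Ov (V y) = -1"
    using \<open>N x = 1\<close> \<open>N y = -1\<close> by (simp_all add: V_norm real_place_real[OF \<nu>])
  ultimately show False
    using def unfolding oct_definite_at_def definite_form_def
    by (metis less_numeral_extra(1) less_minus_one_simps(1) not_less_iff_gr_or_eq zero_neq_neg_one zero_neq_one)
qed

section \<open>Representatives of a class\<close>

lemma automorphism_inverse:
  assumes "algebra_automorphism \<phi> \<alpha>"
  obtains \<alpha>' where "algebra_automorphism \<phi> \<alpha>'" "\<And>x. \<alpha>' (\<alpha> x) = x" "\<And>x. \<alpha> (\<alpha>' x) = x"
proof -
  have h: "ring_hom_map \<alpha>" and \<phi>: "\<And>c. \<alpha> (\<phi> c) = \<phi> c" and bij: "bij \<alpha>"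
    using assms by (auto simp: algebra_automorphism_def)
  define \<alpha>' where "\<alpha>' = inv_into UNIV \<alpha>"
  have 1: "\<alpha>' (\<alpha> x) = x" for x unfolding \<alpha>'_def using bij by (simp add: bij_is_inj)
  have 2: "\<alpha> (\<alpha>' x) = x" for x unfolding \<alpha>'_def using bij by (simp add: bij_is_surj f_inv_into_f)
  have "ring_hom_map \<alpha>'"
    by (rule ring_hom_mapI; rule injD[OF bij_is_inj[OF bij]]) (simp_all add: rh_simps[OF h] 2)
  moreover have "\<alpha>' (\<phi> c) = \<phi> c" for c using 1[of "\<phi> c"] \<phi> by simp
  moreover have "bij \<alpha>'"
    by (rule bijI[OF inj_on_inverseI[of UNIV \<alpha> \<alpha>', OF 2] surjI[of \<alpha>' \<alpha>, OF 1]])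
  ultimately have "algebra_automorphism \<phi> \<alpha>'" by (simp add: algebra_automorphism_def)
  then show ?thesis using that 1 2 by blast
qed

lemma real_place_automorphism:
  assumes "algebra_automorphism \<phi> \<alpha>" "\<tau> \<in> real_places_over \<phi> \<nu>"
  shows "(\<lambda>x. \<tau> (\<alpha> x)) \<in> real_places_over \<phi> \<nu>"
  using assms rh_compose[of \<alpha> \<tau>] by (auto simp: algebra_automorphism_def real_places_over_def)

text \<open>Two representatives differ by an automorphism and by norms, and norms are positive at the real
  places over a CM place.\<close>

lemma (in hermitian_data) lambda_class_signs:
  assumes \<Lambda>: "\<Lambda> \<in> lambda_classes \<phi>E iE" and l: "l0 \<in> \<Lambda>" "l \<in> \<Lambda>" and \<nu>: "\<nu> d < 0"
  obtains \<gamma> \<gamma>' where "algebra_automorphism \<phi>E \<gamma>" "algebra_automorphism \<phi>E \<gamma>'"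
    "\<And>x. \<gamma>' (\<gamma> x) = x" "\<And>x. \<gamma> (\<gamma>' x) = x"
    "\<And>\<tau>. \<tau> \<in> real_places_over \<phi>E \<nu> \<Longrightarrow> \<exists>p>0. \<tau> l = \<tau> (\<gamma> l0) * p"
proof -
  obtain x where "\<Lambda> = lambda_rel \<phi>E iE `` {x}"
    using \<Lambda> unfolding lambda_classes_def by (rule quotientE)
  then obtain \<alpha> u \<beta> v where \<alpha>: "algebra_automorphism \<phi>E \<alpha>" and \<beta>: "algebra_automorphism \<phi>E \<beta>"
    and u: "u dvd 1" and v: "v dvd 1"
    and l0: "l0 = \<alpha> x * alg_norm TYPE(2) iE u" and l': "l = \<beta> x * alg_norm TYPE(2) iE v"
    using l unfolding lambda_rel_def by auto
  obtain \<alpha>' where \<alpha>': "algebra_automorphism \<phi>E \<alpha>'" "\<And>x. \<alpha>' (\<alpha> x) = x" "\<And>x. \<alpha> (\<alpha>' x) = x"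
    using automorphism_inverse[OF \<alpha>] by blast
  obtain \<beta>' where \<beta>': "algebra_automorphism \<phi>E \<beta>'" "\<And>x. \<beta>' (\<beta> x) = x" "\<And>x. \<beta> (\<beta>' x) = x"
    using automorphism_inverse[OF \<beta>] by blast
  have comp: "algebra_automorphism \<phi>E (\<lambda>x. \<alpha>1 (\<alpha>2 x))"
    if "algebra_automorphism \<phi>E \<alpha>1" "algebra_automorphism \<phi>E \<alpha>2" for \<alpha>1 \<alpha>2
    using that rh_compose[of \<alpha>2 \<alpha>1] bij_comp[of \<alpha>2 \<alpha>1] by (auto simp: algebra_automorphism_def o_def)
  define \<gamma> where "\<gamma> y = \<beta> (\<alpha>' y)" for y
  have \<gamma>: "algebra_automorphism \<phi>E \<gamma>" unfolding \<gamma>_def by (rule comp[OF \<beta> \<alpha>'(1)])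
  have h\<gamma>: "ring_hom_map \<gamma>" using \<gamma> by (simp add: algebra_automorphism_def)
  have "\<exists>p>0. \<tau> l = \<tau> (\<gamma> l0) * p" if \<tau>: "\<tau> \<in> real_places_over \<phi>E \<nu>" for \<tau>
  proof -
    have h: "ring_hom_map \<tau>" using \<tau> by (simp add: real_places_over_def)
    have pu: "\<tau> (\<gamma> (alg_norm TYPE(2) iE u)) > 0"
      using norm_T_pos[OF real_place_automorphism[OF \<gamma> \<tau>] \<nu> u] .
    have pv: "\<tau> (alg_norm TYPE(2) iE v) > 0" by (rule norm_T_pos[OF \<tau> \<nu> v])
    have "\<tau> (\<gamma> l0) = \<tau> (\<beta> x) * \<tau> (\<gamma> (alg_norm TYPE(2) iE u))"
      by (simp add: l0 rh_mult[OF h\<gamma>] rh_mult[OF h]) (simp add: \<gamma>_def \<alpha>'(2))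
    moreover have "\<tau> l = \<tau> (\<beta> x) * \<tau> (alg_norm TYPE(2) iE v)" by (simp add: l' rh_mult[OF h])
    ultimately have "\<tau> l = \<tau> (\<gamma> l0) * (\<tau> (alg_norm TYPE(2) iE v) / \<tau> (\<gamma> (alg_norm TYPE(2) iE u)))"
      using pu by simp
    then show ?thesis using pu pv by (intro exI[of _ "\<tau> (alg_norm TYPE(2) iE v) / \<tau> (\<gamma> (alg_norm TYPE(2) iE u))"]) simp
  qed
  moreover have "algebra_automorphism \<phi>E (\<lambda>y. \<alpha> (\<beta>' y))" by (rule comp[OF \<alpha> \<beta>'(1)])
  ultimately show ?thesis using that[of \<gamma> "\<lambda>y. \<alpha> (\<beta>' y)"] \<gamma> \<alpha>' \<beta>' by (simp add: \<gamma>_def)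
qed

section \<open>Split quadratic algebras\<close>

lemma sum_UNIV_pair2:
  fixes F :: "'n::finite \<times> 2 \<Rightarrow> 'z::comm_monoid_add"
  shows "(\<Sum>p\<in>UNIV. F p) = (\<Sum>j\<in>UNIV. F (j, 1)) + (\<Sum>j\<in>UNIV. F (j, 2))"
proof -
  have "(\<Sum>p\<in>UNIV. F p) = (\<Sum>j\<in>UNIV. \<Sum>m\<in>UNIV. F (j, m))"
    unfolding UNIV_Times_UNIV[symmetric] by (simp add: sum.cartesian_product)
  then show ?thesis by (simp add: sum_2 sum.distrib)
qed

text \<open>Independence is tested over \<open>k\<close>: the six products of the basis of \<open>E\<close> with \<open>1\<close> and \<open>s\<close> are
  independent in the tensor product, so they stay independent after the base change.\<close>

lemma (in hermitian_data) base_change_basis: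
  assumes jE: "is_tensor_product \<phi>E \<nu> jE rE" and jT: "is_tensor_product (\<lambda>c. iE (\<phi>E c)) \<nu> jT rT"
    and i: "ring_hom_map i" "\<And>x. i (jE x) = jT (iE x)" "\<And>r. i (rE r) = rT r"
  shows "is_basis (act i) (quad_basis (jT (iA s)))"
proof (subst quad_basis_iff[OF i(1)], intro conjI allI impI)
  note hjT = tp_rh1[OF jT]
  fix t
  obtain n :: nat and a \<beta> where t: "t = (\<Sum>m<n. jT (a m) * rT (\<beta> m))" using tp_generated[OF jT] by blast
  have "\<exists>x y. a m = iE x + iE y * iA s" for m by (rule quad_repr[OF bT_E, of "a m"]) blast
  then obtain x y where a: "\<And>m. a m = iE (x m) + iE (y m) * iA s" by metis
  have "jT (a m) * rT (\<beta> m) = i (jE (x m) * rE (\<beta> m)) + i (jE (y m) * rE (\<beta> m)) * jT (iA s)" for m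
    by (simp add: a rh_simps[OF hjT] rh_simps[OF i(1)] i(2,3) algebra_simps)
  then have "t = i (\<Sum>m<n. jE (x m) * rE (\<beta> m)) + i (\<Sum>m<n. jE (y m) * rE (\<beta> m)) * jT (iA s)"
    by (simp add: t rh_sum[OF i(1)] sum.distrib sum_distrib_right)
  then show "\<exists>p q. t = i p + i q * jT (iA s)" by blast
next
  note hjT = tp_rh1[OF jT]
  fix p q assume 0: "i p + i q * jT (iA s) = 0"
  note BE = tp_basis[OF jE bE]
  obtain x where p: "p = (\<Sum>j\<in>UNIV. rE (x j) * jE (bE j))" by (rule basis_span[OF BE])
  obtain y where q: "q = (\<Sum>j\<in>UNIV. rE (y j) * jE (bE j))" by (rule basis_span[OF BE])
  define a where "a m = iE (bE (fst m)) * (if snd m = 1 then 1 else iA s)" for m :: "3 \<times> 2"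
  define \<beta> where "\<beta> m = (if snd m = 1 then x (fst m) else y (fst m))" for m :: "3 \<times> 2"
  have ind: "\<forall>m. c m = 0" if "(\<Sum>m\<in>UNIV. iE (\<phi>E (c m)) * a m) = 0" for c
  proof -
    have "iE (\<Sum>j\<in>UNIV. \<phi>E (c (j, 1)) * bE j) + iE (\<Sum>j\<in>UNIV. \<phi>E (c (j, 2)) * bE j) * iA s = 0"
      using that by (simp add: sum_UNIV_pair2 a_def rh_sum[OF hiE] rh_mult[OF hiE] sum_distrib_right mult.assoc)
    then have "(\<Sum>j\<in>UNIV. \<phi>E (c (j, 1)) * bE j) = 0" "(\<Sum>j\<in>UNIV. \<phi>E (c (j, 2)) * bE j) = 0"
      using quad_zero[OF hiE bT_E] by blast+
    then have "c (j, 1) = 0 \<and> c (j, 2) = 0" for j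
      using basis_indep[OF hE bE, of "\<lambda>j. c (j, 1)"] basis_indep[OF hE bE, of "\<lambda>j. c (j, 2)"] by blast
    then show ?thesis by (metis exhaust_2 prod.collapse)
  qed
  have "(\<Sum>m\<in>UNIV. jT (a m) * rT (\<beta> m)) = 0"
    using 0 by (simp add: p q sum_UNIV_pair2 a_def \<beta>_def rh_simps[OF hjT] rh_simps[OF i(1)] i(2,3) sum_distrib_right sum_distrib_left mult_ac)
  from tp_independent[OF jT ind this] have "\<beta> m = 0" for m .
  from this[of "(_, 1)"] this[of "(_, 2)"] have "x j = 0" "y j = 0" for j by (simp_all add: \<beta>_def)
  then show "p = 0" "q = 0" by (simp_all add: p q rh_0[OF tp_rh2[OF jE]])
qed

text \<open>If \<open>d\<close> has a square root \<open>\<delta>\<close>, the norm form factors as \<open>(x - \<delta> y) (x + \<delta> y)\<close>, whose factors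
  can be prescribed.\<close>

lemma (in hermitian_data) split_norm_surjective:
  assumes jE: "is_tensor_product \<phi>E \<nu> jE rE" and jT: "is_tensor_product (\<lambda>c. iE (\<phi>E c)) \<nu> jT rT"
    and i: "ring_hom_map i" "\<And>x. i (jE x) = jT (iE x)" "\<And>r. i (rE r) = rT r" and pos: "\<nu> d > (0::real)"
  shows "\<exists>u. alg_norm TYPE(2) i u = w \<and> (w dvd 1 \<longrightarrow> u dvd 1)"
proof -
  note B = base_change_basis[OF jE jT i]
  note hr = tp_rh2[OF jE]
  have S: "jT (iA s) * jT (iA s) = i (rE (\<nu> d))"
    by (simp add: rh_mult[OF tp_rh1[OF jT], symmetric] sT i(2)[symmetric] tp_compat[OF jE])
  define \<delta> where "\<delta> = sqrt (\<nu> d)"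
  have \<delta>: "\<delta> * \<delta> = \<nu> d" "\<delta> > 0" using pos by (auto simp: \<delta>_def)
  \<comment> \<open>chosen to make the factors \<open>x + \<delta> y\<close> and \<open>x - \<delta> y\<close> equal to \<open>w\<close> and \<open>1\<close>\<close>
  define x where "x = rE (1/2) * (w + 1)"
  define y where "y = rE (1 / (2 * \<delta>)) * (w - 1)"
  have dy: "rE \<delta> * y = rE (1/2) * (w - 1)"
    using \<delta>(2) by (simp add: y_def mult.assoc[symmetric] rh_mult[OF hr, symmetric])
  have half: "rE (1/2) + rE (1/2) = 1" by (simp add: rh_add[OF hr, symmetric] rh_1[OF hr])
  have "x + rE \<delta> * y = (rE (1/2) + rE (1/2)) * w" unfolding dy x_def by (simp add: algebra_simps)
  then have 1: "x + rE \<delta> * y = w" by (simp add: half)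
  have "x - rE \<delta> * y = rE (1/2) + rE (1/2)" unfolding dy x_def by (simp add: algebra_simps)
  then have 2: "x - rE \<delta> * y = 1" by (simp add: half)
  have "x * x - rE (\<nu> d) * (y * y) = (x - rE \<delta> * y) * (x + rE \<delta> * y)"
    by (simp add: \<delta>(1)[symmetric] rh_mult[OF hr] algebra_simps)
  then have n: "x * x - rE (\<nu> d) * (y * y) = w" by (simp add: 1 2)
  have "alg_norm TYPE(2) i (i x + i y * jT (iA s)) = w" by (simp add: quad_norm[OF i(1) B S] n)
  moreover have "(i x + i y * jT (iA s)) dvd 1" if "w dvd 1"
    by (rule quad_unit_from_norm[OF i(1) S]) (simp add: n that)
  ultimately show ?thesis by blast
qed

section \<open>Real triples\<close>

text \<open>Over the identity of the reals, the coordinates of an element are those of its image.\<close>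

lemma real_tensor_bij:
  fixes \<phi> :: "real \<Rightarrow> 'e::comm_ring_1" and b :: "'n::finite \<Rightarrow> 'e"
  assumes tp: "is_tensor_product \<phi> (\<lambda>x. x) f \<kappa>" and b: "is_basis (act \<phi>) b"
  shows "bij f"
proof (rule bijI)
  note f = tp_rh1[OF tp] and B = tp_basis[OF tp b]
  have fsum: "f (\<Sum>i\<in>UNIV. \<phi> (c i) * b i) = (\<Sum>i\<in>UNIV. \<kappa> (c i) * f (b i))" for c
    by (simp add: rh_simps[OF f] tp_compat[OF tp])
  show "surj f"
  proof (rule surjI)
    show "f (\<Sum>i\<in>UNIV. \<phi> (coords (act \<kappa>) (\<lambda>i. f (b i)) v i) * b i) = v" for v
      unfolding fsum by (rule coords_act[OF B, symmetric])
  qed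
  show "inj f"
  proof (rule injI)
    fix x y assume eq: "f x = f y"
    obtain c where c: "x - y = (\<Sum>i\<in>UNIV. \<phi> (c i) * b i)" by (rule basis_span[OF b])
    have "(\<Sum>i\<in>UNIV. \<kappa> (c i) * f (b i)) = 0" unfolding fsum[symmetric] c[symmetric] by (simp add: rh_diff[OF f] eq)
    from basis_indep[OF tp_rh2[OF tp] B this] have "x - y = 0" by (simp add: c rh_0[OF tp_rhA[OF tp]])
    then show "x = y" by simp
  qed
qed

text \<open>The element is \<open>(1, -1, -1)\<close> in the totally real algebra and \<open>(-1, 1)\<close> in the other one; its
  signs make the discriminant positive and the form indefinite.\<close>

lemma real_cubic_element:
  fixes \<phi> :: "real \<Rightarrow> 'e::comm_ring_1" and b :: "3 \<Rightarrow> 'e"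
  assumes et: "etale_algebra TYPE(3) \<phi>" and b: "is_basis (act \<phi>) b"
  obtains \<rho> c l w1 w2 where "complex_splitting \<phi> (\<lambda>x. x) \<rho> c" "c permutes UNIV" "\<And>r. c (c r) = r"
    "l * l = 1" "of_int (sign c) * (\<Prod>r\<in>UNIV. \<rho> r l) = 1"
    "Re (\<Sum>r\<in>UNIV. \<rho> r l * w1 $ r * cnj (w1 $ c r)) > 0"
    "Re (\<Sum>r\<in>UNIV. \<rho> r l * w2 $ r * cnj (w2 $ c r)) < 0"
proof -
  have "cubic_totally_real_at \<phi> (\<lambda>x. x) \<or> cubic_not_totally_real_at \<phi> (\<lambda>x. x)"
    by (rule cubic_real_or_not[OF et rh_id])
  then show ?thesis
  proof
    assume "cubic_totally_real_at \<phi> (\<lambda>x. x)"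
    then obtain f where tp: "is_tensor_product \<phi> (\<lambda>x. x) f (\<lambda>r. \<chi> (i::3). r)"
      unfolding cubic_totally_real_at_def by blast
    have bij: "bij f" by (rule real_tensor_bij[OF tp b])
    define v :: "real ^ 3" where "v = (\<chi> i. if i = 1 then 1 else -1)"
    obtain l where l: "f l = v" using bij by (metis bij_pointE)
    have "f (l * l) = f 1"
      by (simp add: rh_mult[OF tp_rh1[OF tp]] rh_1[OF tp_rh1[OF tp]] l) (simp add: v_def vec_eq_iff)
    then have ll: "l * l = 1" using bij by (metis bij_is_inj injD)
    show ?thesis
      by (rule that[OF splitting_totally_real[OF tp], of l "axis 1 1" "axis 2 1"])
         (simp_all add: permutes_id ll l v_def sum_3 axis_def prod_UNIV_3)
  next
    assume "cubic_not_totally_real_at \<phi> (\<lambda>x. x)"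
    then obtain f where tp: "is_tensor_product \<phi> (\<lambda>x. x) f (\<lambda>r. (r, complex_of_real r))"
      unfolding cubic_not_totally_real_at_def by blast
    have bij: "bij f" by (rule real_tensor_bij[OF tp b])
    obtain l where l: "f l = (-1, 1)" using bij by (metis bij_pointE)
    have "f (l * l) = f 1"
      by (simp add: rh_mult[OF tp_rh1[OF tp]] rh_1[OF tp_rh1[OF tp]] l times_prod_def one_prod_def)
    then have ll: "l * l = 1" using bij by (metis bij_is_inj injD)
    \<comment> \<open>the form has the value \<open>2\<close> at \<open>(0, 1, 1)\<close> and \<open>-1\<close> at \<open>(1, 0, 0)\<close>\<close>
    show ?thesis
      by (rule that[OF splitting_mixed[OF tp] swap23_permutes swap23_swap23 ll, of "1 - axis 1 1" "axis 1 1"])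
         (simp_all add: sign_swap23 l mixed_places_def sum_3 axis_def prod_UNIV_3)
  qed
qed

text \<open>A pure octonion of norm \<open>- d\<close> serves as the image of \<open>s\<close>.  The Gram determinant of the form is
  positive, so it is the norm of its square root and its class is trivial whether or not \<open>A\<close> is
  split.\<close>

lemma real_triple_exists:
  fixes Oc :: "(real, real ^ 8) octonions"
    and \<phi>A :: "real \<Rightarrow> 'a::comm_ring_1" and \<phi>E :: "real \<Rightarrow> 'e::comm_ring_1" and iE :: "'e \<Rightarrow> 't::comm_ring_1"
  assumes oct: "octonion_algebra Oc" and sc: "oct_scale Oc = (*\<^sub>R)" and sig: "has_signature (oct_norm Oc) (4, 4)"
    and A: "etale_algebra TYPE(2) \<phi>A" and \<sigma>: "nontrivial_involution \<phi>A \<sigma>"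
    and E: "etale_algebra TYPE(3) \<phi>E" and tp: "is_tensor_product \<phi>E \<phi>A iE iA"
  shows "\<exists>\<Lambda>. octonion_triple Oc \<phi>A \<sigma> \<phi>E iE iA \<Lambda>"
proof -
  interpret octonion Oc by unfold_locales (rule oct)
  obtain s d where hA: "ring_hom_map \<phi>A" and bA: "is_basis (act \<phi>A) (quad_basis s)"
    and s: "s * s = \<phi>A d" and d0: "d \<noteq> 0"
    by (rule etale_quadratic[OF A])
  obtain \<xi> a' b' c' where bE: "is_basis (act \<phi>E) (cubic_basis \<xi>)" by (rule etale_cubic[OF E])
  interpret H: hermitian_data \<phi>A \<sigma> \<phi>E iE iA s d "cubic_basis \<xi>"
    by unfold_locales (fact tp bA s \<sigma> bE)+
  obtain x where x: "oct_polar Oc x (oct_one Oc) = 0" "oct_norm Oc x = - d"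
    using split_represents[OF oct sc sig, of "- d"] d0 by auto
  have "x \<noteq> 0" using x(2) d0 N_scale[of 0 x] by (auto simp: sc)
  then have emb: "embeds_in_octonions \<phi>A Oc" by (rule embeds_quadratic[OF hA bA s x])
  obtain \<rho> c l w1 w2 where \<rho>: "complex_splitting \<phi>E (\<lambda>x. x) \<rho> c" and c: "c permutes UNIV" "\<And>r. c (c r) = r"
    and l: "l * l = 1" and sgn: "of_int (sign c) * (\<Prod>r\<in>UNIV. \<rho> r l) = 1"
    and w1: "Re (\<Sum>r\<in>UNIV. \<rho> r l * w1 $ r * cnj (w1 $ c r)) > 0"
    and w2: "Re (\<Sum>r\<in>UNIV. \<rho> r l * w2 $ r * cnj (w2 $ c r)) < 0"
    by (rule real_cubic_element[OF E bE]) (rule that; assumption)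
  define \<Lambda> where "\<Lambda> = lambda_rel \<phi>E iE `` {l}"
  have lu: "l dvd 1" using l by (metis dvd_triv_left)
  have "(l, l) \<in> lambda_rel \<phi>E iE"
    unfolding lambda_rel_def algebra_automorphism_def
    using lu quad_norm_one[OF H.hiE H.bT_E H.sT] rh_id
    by (auto intro!: exI[of _ "\<lambda>x. x"] exI[of _ 1] simp: bij_id[unfolded id_def])
  then have "l \<in> \<Lambda>" by (simp add: \<Lambda>_def)
  have \<Lambda>: "\<Lambda> \<in> lambda_classes \<phi>E iE"
    unfolding lambda_classes_def \<Lambda>_def using lu by (intro quotientI) simp
  define e where "e = det (\<chi> i j. alg_trace TYPE(3) \<phi>E (l * (cubic_basis \<xi> i * cubic_basis \<xi> j)))"
  have "complex_of_real e = of_real ((cmod (det (\<chi> i r. \<rho> r (cubic_basis \<xi> i))))\<^sup>2)"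
    using trace_gram[OF H.hE rh_id \<rho> c bE, of l] unfolding e_def[symmetric] sgn by simp
  then have "e = (cmod (det (\<chi> i r. \<rho> r (cubic_basis \<xi> i))))\<^sup>2" by (simp only: of_real_eq_iff)
  then have e: "e > 0" using splitting_det[OF \<rho> bE] by simp
  have disc: "herm_has_disc \<phi>A iA (herm_form iE iA \<sigma> l) 1"
    unfolding herm_has_disc_def
  proof (intro exI conjI)
    show "is_basis (act iA) (\<lambda>i. iE (cubic_basis \<xi> i))" by (rule H.bT_A)
    show "e \<noteq> 0" using e by simp
    show "\<phi>A e = det (\<chi> i j. herm_form iE iA \<sigma> l (iE (cubic_basis \<xi> i)) (iE (cubic_basis \<xi> j)))"
      unfolding e_def by (simp add: rh_det[OF hA] H.herm_on_E)
    \<comment> \<open>\<open>e\<close> is the norm of its square root\<close>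
    define a where "a = \<phi>A (sqrt e)"
    have a: "alg_norm TYPE(2) \<phi>A a = e"
      using quad_norm[OF hA bA s, of "sqrt e" 0] e by (simp add: a_def rh_0[OF hA])
    define a' where "a' = \<phi>A (1 / sqrt e)"
    have aa': "a * a' = 1" using e by (simp add: a_def a'_def rh_mult[OF hA, symmetric] rh_1[OF hA])
    have N: "alg_norm TYPE(2) \<phi>A (y * z) = alg_norm TYPE(2) \<phi>A y * alg_norm TYPE(2) \<phi>A z" for y z
      by (rule quad_norm_mult[OF hA bA s])
    have u: "(v * y) dvd 1" if "v * v' = 1" "y dvd 1" for v v' y :: 'a
      using mult_dvd_mono[of v 1 y 1] that by (metis dvd_triv_left mult_1)
    show "norm_class \<phi>A e = norm_class \<phi>A 1"
    proof (intro equalityI subsetI)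
      fix z assume "z \<in> norm_class \<phi>A e"
      then obtain y where "z = alg_norm TYPE(2) \<phi>A (a * y)" "y dvd 1" unfolding norm_class_def N a by blast
      then show "z \<in> norm_class \<phi>A 1" unfolding norm_class_def using u[OF aa'] by auto
    next
      fix z assume "z \<in> norm_class \<phi>A 1"
      then obtain y where y: "z = alg_norm TYPE(2) \<phi>A y" "y dvd 1" unfolding norm_class_def by auto
      have "y = a * (a' * y)" using aa' by (simp add: mult.assoc[symmetric])
      then have "z = e * alg_norm TYPE(2) \<phi>A (a' * y)" using y(1) N[of a "a' * y"] a by simp
      moreover have "a' * a = 1" using aa' by (simp add: mult.commute)
      then have "(a' * y) dvd 1" by (rule u) (rule y(2))
      ultimately show "z \<in> norm_class \<phi>A e" unfolding norm_class_def by blast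
    qed
  qed
  have indef: "herm_indefinite_at \<phi>A iA (herm_form iE iA \<sigma> l) \<nu>" if \<nu>: "ring_hom_map \<nu>" for \<nu>
    unfolding herm_indefinite_at_def
  proof (intro allI impI)
    fix f :: "'a \<Rightarrow> complex" assume f: "is_tensor_product \<phi>A \<nu> f complex_of_real"
    have \<nu>id: "\<nu> = (\<lambda>x. x)" using real_place_real[OF \<nu>] by auto
    interpret C: hermitian_at_CM \<phi>A \<sigma> \<phi>E iE iA s d "cubic_basis \<xi>" \<nu> f \<rho> c
      by unfold_locales (use f \<rho> c \<nu>id in auto)
    have "\<exists>v. herm_value f (herm_form iE iA \<sigma> l) (\<lambda>i. iE (cubic_basis \<xi> i)) v > 0"
      using C.herm_value_diagonal[OF H.bT_A, of l w1] w1 by metis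
    moreover have "\<exists>v. herm_value f (herm_form iE iA \<sigma> l) (\<lambda>i. iE (cubic_basis \<xi> i)) v < 0"
      using C.herm_value_diagonal[OF H.bT_A, of l w2] w2 by metis
    ultimately show "\<exists>b :: 3 \<Rightarrow> 't. is_basis (act iA) b \<and> (\<exists>v. herm_value f (herm_form iE iA \<sigma> l) b v > 0) \<and>
        (\<exists>v. herm_value f (herm_form iE iA \<sigma> l) b v < 0)"
      using H.bT_A by blast
  qed
  have "octonion_triple Oc \<phi>A \<sigma> \<phi>E iE iA \<Lambda>"
    unfolding octonion_triple_def real_place_def
    using A \<sigma> emb E tp \<Lambda> \<open>l \<in> \<Lambda>\<close> disc indef split_not_definite[OF oct sc sig] by blast
  then show ?thesis by blast
qed

section \<open>Signs of the representatives\<close>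

lemma three_signs:
  fixes v :: "real ^ 3"
  assumes "v $ 1 * v $ 2 * v $ 3 > 0" "v $ i < 0"
  shows "\<exists>!r. v $ r > 0"
proof -
  have nz: "v $ 1 \<noteq> 0" "v $ 2 \<noteq> 0" "v $ 3 \<noteq> 0" using assms(1) by auto
  have "v $ 1 < 0 \<or> v $ 2 < 0 \<or> v $ 3 < 0" using assms(2) exhaust_3[of i] by auto
  then have "(v $ 1 > 0 \<and> \<not> v $ 2 > 0 \<and> \<not> v $ 3 > 0) \<or> (\<not> v $ 1 > 0 \<and> v $ 2 > 0 \<and> \<not> v $ 3 > 0) \<or>
      (\<not> v $ 1 > 0 \<and> \<not> v $ 2 > 0 \<and> v $ 3 > 0)"
    using assms(1) nz by (cases "v $ 1 > 0"; cases "v $ 2 > 0"; cases "v $ 3 > 0") (simp_all add: zero_less_mult_iff mult_less_0_iff)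
  then have "\<exists>i. v $ i > 0 \<and> (\<forall>r. v $ r > 0 \<longrightarrow> r = i)"
    unfolding forall_3 by (elim disjE) (intro exI[of _ 1], simp, intro exI[of _ 2], simp, intro exI[of _ 3], simp)
  then show ?thesis by blast
qed

text \<open>The three values of \<open>l\<close> have a positive product because the discriminant is one.  Definiteness makes
  all of them positive; indefiniteness makes one of them negative, which leaves exactly one positive
  value.\<close>

lemma (in hermitian_data) totally_real_signs:
  assumes CM: "quadratic_CM_at \<phi>A \<nu>" and E: "is_tensor_product \<phi>E \<nu> f (\<lambda>r. \<chi> (i::3). r)"
  shows "herm_pos_def_at \<phi>A iA (herm l) \<nu> \<Longrightarrow> \<tau> \<in> real_places_over \<phi>E \<nu> \<Longrightarrow> \<tau> l > 0"
    and "herm_has_disc \<phi>A iA (herm l) 1 \<Longrightarrow> herm_indefinite_at \<phi>A iA (herm l) \<nu> \<Longrightarrow>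
      \<exists>!\<tau>. \<tau> \<in> real_places_over \<phi>E \<nu> \<and> \<tau> l > 0"
proof -
  obtain h where h: "is_tensor_product \<phi>A \<nu> h complex_of_real" using CM unfolding quadratic_CM_at_def by blast
  interpret C: hermitian_at_CM \<phi>A \<sigma> \<phi>E iE iA s d bE \<nu> h "\<lambda>r x. of_real (f x $ r)" id
    by unfold_locales (use h splitting_totally_real[OF E] permutes_id in auto)
  note R = real_places_totally_real[OF E bE]
  show "\<tau> l > 0" if "herm_pos_def_at \<phi>A iA (herm l) \<nu>" "\<tau> \<in> real_places_over \<phi>E \<nu>"
    using C.pos_def_values(2)[OF that(1)] that(2) by (auto simp: R)
  assume disc: "herm_has_disc \<phi>A iA (herm l) 1" and ind: "herm_indefinite_at \<phi>A iA (herm l) \<nu>"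
  obtain p where p: "p > 0" "of_int (sign (id :: 3 \<Rightarrow> 3)) * (\<Prod>r\<in>UNIV. complex_of_real (f l $ r)) = complex_of_real p"
    by (rule C.disc_one_sign[OF disc])
  have "(\<Prod>r\<in>UNIV. complex_of_real (f l $ r)) = of_real (f l $ 1 * f l $ 2 * f l $ 3)"
    by (simp add: prod_UNIV_3)
  then have "complex_of_real (f l $ 1 * f l $ 2 * f l $ 3) = of_real p" using p(2) by simp
  then have "f l $ 1 * f l $ 2 * f l $ 3 > 0" using p(1) by (simp only: of_real_eq_iff)
  moreover obtain r where "Re (complex_of_real (f l $ r)) < 0"
    by (rule C.indefinite_negative_value[OF ind]) auto
  ultimately obtain r where r: "f l $ r > 0" "\<And>r'. f l $ r' > 0 \<Longrightarrow> r' = r"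
    using three_signs[of "f l"] by (metis Re_complex_of_real)
  show "\<exists>!\<tau>. \<tau> \<in> real_places_over \<phi>E \<nu> \<and> \<tau> l > 0"
  proof (rule ex1I[of _ "\<lambda>x. f x $ r"])
    show "(\<lambda>x. f x $ r) \<in> real_places_over \<phi>E \<nu> \<and> f l $ r > 0" using r(1) by (auto simp: R)
  next
    fix \<tau> assume "\<tau> \<in> real_places_over \<phi>E \<nu> \<and> \<tau> l > 0"
    then obtain r' where "\<tau> = (\<lambda>x. f x $ r')" "f l $ r' > 0" by (auto simp: R)
    then show "\<tau> = (\<lambda>x. f x $ r)" using r(2) by auto
  qed
qed

text \<open>The values of \<open>l\<close> at the conjugate pair multiply to an absolute square, and the transposition of the
  pair has sign \<open>-1\<close>.  Hence discriminant one makes the real value negative; for the same reason the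
  discriminant of \<open>E\<close> is negative.\<close>

lemma (in hermitian_data) mixed_signs:
  assumes CM: "quadratic_CM_at \<phi>A \<nu>" and E: "is_tensor_product \<phi>E \<nu> f (\<lambda>r. (r, complex_of_real r))"
  shows "\<not> herm_pos_def_at \<phi>A iA (herm l) \<nu>"
    and "herm_has_disc \<phi>A iA (herm l) 1 \<Longrightarrow> fst (f l) < 0"
    and "is_basis (act \<phi>E) b \<Longrightarrow> \<nu> (alg_disc \<phi>E (b :: 3 \<Rightarrow> 'e)) < 0"
proof -
  obtain h where h: "is_tensor_product \<phi>A \<nu> h complex_of_real" using CM unfolding quadratic_CM_at_def by blast
  interpret C: hermitian_at_CM \<phi>A \<sigma> \<phi>E iE iA s d bE \<nu> h "mixed_places f" swap23
    by unfold_locales (use h splitting_mixed[OF E] swap23_permutes swap23_swap23 in auto)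
  show "\<not> herm_pos_def_at \<phi>A iA (herm l) \<nu>"
    using C.pos_def_values(1)[of l 2] by auto
  show "fst (f l) < 0" if disc: "herm_has_disc \<phi>A iA (herm l) 1"
  proof -
    obtain p where p: "p > 0" "of_int (sign swap23) * (\<Prod>r\<in>UNIV. mixed_places f r l) = complex_of_real p"
      by (rule C.disc_one_sign[OF disc])
    have "(\<Prod>r\<in>UNIV. mixed_places f r l) = of_real (fst (f l)) * (snd (f l) * cnj (snd (f l)))"
      by (simp add: prod_UNIV_3 mixed_places_def)
    also have "\<dots> = of_real (fst (f l) * (cmod (snd (f l)))\<^sup>2)"
      by (simp only: complex_norm_square of_real_mult)
    finally have "complex_of_real (- (fst (f l) * (cmod (snd (f l)))\<^sup>2)) = of_real p"
      using p(2) by (simp add: sign_swap23)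
    then have "fst (f l) * (cmod (snd (f l)))\<^sup>2 < 0" using p(1) by (simp only: of_real_eq_iff)
    then show ?thesis by (meson mult_nonneg_nonneg not_le zero_le_power2)
  qed
  show "\<nu> (alg_disc \<phi>E b) < 0" if b: "is_basis (act \<phi>E) b" for b :: "3 \<Rightarrow> 'e"
  proof -
    have "complex_of_real (\<nu> (alg_disc \<phi>E b)) = of_real (- (cmod (det (\<chi> i r. mixed_places f r (b i))))\<^sup>2)"
      using trace_gram[OF hE C.h\<nu> C.\<rho> C.c b, of 1]
      by (simp add: alg_disc_def sign_swap23 rh_1[OF splitting_hom[OF C.\<rho>]])
    then have "\<nu> (alg_disc \<phi>E b) = - (cmod (det (\<chi> i r. mixed_places f r (b i))))\<^sup>2" by (simp only: of_real_eq_iff)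
    then show ?thesis using splitting_det[OF C.\<rho> b] by simp
  qed
qed

theorem proposition5p11:
  fixes Oc :: "('k::field_char_0, 'o::ab_group_add) octonions"
    and \<phi>A :: "'k \<Rightarrow> 'a::comm_ring_1" and \<sigma> :: "'a \<Rightarrow> 'a"
    and \<phi>E :: "'k \<Rightarrow> 'e::comm_ring_1"
    and iE :: "'e \<Rightarrow> 't::comm_ring_1" and iA :: "'a \<Rightarrow> 't"
    and \<Lambda> :: "'e set"
    and \<nu> :: "'k \<Rightarrow> real"
  assumes "number_field_or_completion TYPE('k)"
    and "octonion_algebra Oc"
    and "octonion_triple Oc \<phi>A \<sigma> \<phi>E iE iA \<Lambda>"
    and "real_place \<nu>"
  shows
    "(oct_definite_at Oc \<nu> \<longrightarrow>
        quadratic_CM_at \<phi>A \<nu> \<and> cubic_totally_real_at \<phi>E \<nu> \<and>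
        (\<forall>l\<in>\<Lambda>. \<forall>\<tau>\<in>real_places_over \<phi>E \<nu>. \<tau> l > 0))
     \<and>
     (oct_split_at Oc \<nu> \<longrightarrow>
        (\<comment> \<open>arbitrary: all pairs of algebras over the reals occur in triples at \<open>\<nu>\<close>\<close>
         \<forall>(\<phi>A' :: real \<Rightarrow> 'ar::comm_ring_1) \<sigma>' (\<phi>E' :: real \<Rightarrow> 'er::comm_ring_1)
           (iE' :: 'er \<Rightarrow> 'tr::comm_ring_1) iA'.
           etale_algebra TYPE(2) \<phi>A' \<longrightarrow> nontrivial_involution \<phi>A' \<sigma>' \<longrightarrow>
           etale_algebra TYPE(3) \<phi>E' \<longrightarrow> is_tensor_product \<phi>E' \<phi>A' iE' iA' \<longrightarrow>
           (\<exists>\<Lambda>'. octonion_triple (octonions_at Oc \<nu>) \<phi>A' \<sigma>' \<phi>E' iE' iA' \<Lambda>')) \<and>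
        (quadratic_CM_at \<phi>A \<nu> \<and> cubic_totally_real_at \<phi>E \<nu> \<longrightarrow>
           (\<forall>l\<in>\<Lambda>. \<exists>!\<tau>. \<tau> \<in> real_places_over \<phi>E \<nu> \<and> \<tau> l > 0)) \<and>
        (quadratic_CM_at \<phi>A \<nu> \<and> cubic_not_totally_real_at \<phi>E \<nu> \<longrightarrow>
           (\<exists>!\<tau>. \<tau> \<in> real_places_over \<phi>E \<nu>) \<and>
           (\<forall>l\<in>\<Lambda>. \<forall>\<tau>\<in>real_places_over \<phi>E \<nu>.
              \<tau> l < 0 \<and>
              (\<forall>b :: 3 \<Rightarrow> 'e. is_basis (act \<phi>E) b \<longrightarrow> \<tau> (\<phi>E (alg_disc \<phi>E b) * l) > 0))) \<and>
        (quadratic_totally_real_at \<phi>A \<nu> \<longrightarrow>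
           \<comment> \<open>\<open>jE\<close>, \<open>jT\<close> are the base changes of \<open>E\<close> and its tensor product with \<open>A\<close>, \<open>i\<close> that of \<open>iE\<close>\<close>
           (\<forall>(jE :: 'e \<Rightarrow> 'ev::comm_ring_1) rE (jT :: 't \<Rightarrow> 'tv::comm_ring_1) rT i.
              is_tensor_product \<phi>E \<nu> jE rE \<longrightarrow>
              is_tensor_product (\<lambda>c. iE (\<phi>E c)) \<nu> jT rT \<longrightarrow>
              ring_hom_map i \<longrightarrow> (\<forall>x. i (jE x) = jT (iE x)) \<longrightarrow> (\<forall>r. i (rE r) = rT r) \<longrightarrow>
              surj (alg_norm TYPE(2) i) \<and>
              (\<forall>x y. x dvd 1 \<longrightarrow> y dvd 1 \<longrightarrow> (x, y) \<in> lambda_rel rE i))))"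
proof -
  have \<nu>: "ring_hom_map \<nu>" using assms(4) by (simp add: real_place_def)
  have A: "etale_algebra TYPE(2) \<phi>A" and \<sigma>: "nontrivial_involution \<phi>A \<sigma>" and emb: "embeds_in_octonions \<phi>A Oc"
    and E: "etale_algebra TYPE(3) \<phi>E" and tp: "is_tensor_product \<phi>E \<phi>A iE iA"
    and \<Lambda>: "\<Lambda> \<in> lambda_classes \<phi>E iE"
    using assms(3) unfolding octonion_triple_def by blast+
  obtain l0 where l0: "l0 \<in> \<Lambda>" and disc: "herm_has_disc \<phi>A iA (herm_form iE iA \<sigma> l0) 1"
    and pos: "oct_definite_at Oc \<nu> \<Longrightarrow> herm_pos_def_at \<phi>A iA (herm_form iE iA \<sigma> l0) \<nu>"
    and ind: "oct_split_at Oc \<nu> \<Longrightarrow> herm_indefinite_at \<phi>A iA (herm_form iE iA \<sigma> l0) \<nu>"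
    using assms(3,4) unfolding octonion_triple_def by blast
  obtain s d where hA: "ring_hom_map \<phi>A" and bA: "is_basis (act \<phi>A) (quad_basis s)"
    and s: "s * s = \<phi>A d" and d0: "d \<noteq> 0"
    by (rule etale_quadratic[OF A])
  obtain \<xi> a' b' c' where bE: "is_basis (act \<phi>E) (cubic_basis \<xi>)" by (rule etale_cubic[OF E])
  interpret H: hermitian_data \<phi>A \<sigma> \<phi>E iE iA s d "cubic_basis \<xi>"
    by unfold_locales (fact tp bA s \<sigma> bE)+
  interpret O: octonion_place Oc \<nu> by unfold_locales (fact assms(2) \<nu>)+
  let ?R = "real_places_over \<phi>E \<nu>"
  have CMd: "\<nu> d < 0" if "quadratic_CM_at \<phi>A \<nu>"
    using that quad_CM_negative(1)[of \<phi>A s d \<nu>] bA s unfolding quadratic_CM_at_def by blast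

  have definite: "quadratic_CM_at \<phi>A \<nu> \<and> cubic_totally_real_at \<phi>E \<nu> \<and> (\<forall>l\<in>\<Lambda>. \<forall>\<tau>\<in>?R. \<tau> l > 0)"
    if def: "oct_definite_at Oc \<nu>"
  proof -
    have d: "\<nu> d < 0" by (rule definite_quadratic[OF assms(2) \<nu> def hA bA s emb])
    have CM: "quadratic_CM_at \<phi>A \<nu>" by (rule quad_CM_intro[OF hA bA s \<nu> d])
    have "\<not> cubic_not_totally_real_at \<phi>E \<nu>"
      using H.mixed_signs(1)[OF CM] pos[OF def] unfolding cubic_not_totally_real_at_def by blast
    then have re: "cubic_totally_real_at \<phi>E \<nu>" using cubic_real_or_not[OF E \<nu>] by blast
    then obtain f where f: "is_tensor_product \<phi>E \<nu> f (\<lambda>r. \<chi> (i::3). r)"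
      unfolding cubic_totally_real_at_def by blast
    have "\<tau> l > 0" if l: "l \<in> \<Lambda>" and \<tau>: "\<tau> \<in> ?R" for l \<tau>
    proof -
      obtain \<gamma> \<gamma>' where \<gamma>: "algebra_automorphism \<phi>E \<gamma>" and sg: "\<And>\<tau>. \<tau> \<in> ?R \<Longrightarrow> \<exists>p>0. \<tau> l = \<tau> (\<gamma> l0) * p"
        by (rule H.lambda_class_signs[where \<nu> = \<nu>, OF \<Lambda> l0 l d]) blast
      have "\<tau> (\<gamma> l0) > 0"
        using H.totally_real_signs(1)[OF CM f pos[OF def] real_place_automorphism[OF \<gamma> \<tau>]] .
      then show ?thesis using sg[OF \<tau>] by auto
    qed
    then show ?thesis using CM re by blast
  qed

  have exist: "\<exists>\<Lambda>'. octonion_triple (octonions_at Oc \<nu>) \<phi>A' \<sigma>' \<phi>E' iE' iA' \<Lambda>'"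
    if "oct_split_at Oc \<nu>" "etale_algebra TYPE(2) \<phi>A'" "nontrivial_involution \<phi>A' \<sigma>'"
      "etale_algebra TYPE(3) \<phi>E'" "is_tensor_product \<phi>E' \<phi>A' iE' iA'"
    for \<phi>A' :: "real \<Rightarrow> 'ar" and \<sigma>' and \<phi>E' :: "real \<Rightarrow> 'er" and iE' :: "'er \<Rightarrow> 'tr" and iA'
    by (rule real_triple_exists[OF O.octonions_at_octonion O.Ov_scale that(1)[unfolded oct_split_at_def] that(2-5)])

  have one_positive: "\<exists>!\<tau>. \<tau> \<in> ?R \<and> \<tau> l > 0"
    if split: "oct_split_at Oc \<nu>" and CM: "quadratic_CM_at \<phi>A \<nu>" and re: "cubic_totally_real_at \<phi>E \<nu>"
      and l: "l \<in> \<Lambda>" for l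
  proof -
    obtain f where f: "is_tensor_product \<phi>E \<nu> f (\<lambda>r. \<chi> (i::3). r)"
      using re unfolding cubic_totally_real_at_def by blast
    have "\<exists>!\<tau>. \<tau> \<in> ?R \<and> \<tau> l0 > 0" by (rule H.totally_real_signs(2)[OF CM f disc ind[OF split]])
    then obtain \<tau>0 where \<tau>0: "\<tau>0 \<in> ?R" "\<tau>0 l0 > 0" and unique: "\<And>\<tau>. \<tau> \<in> ?R \<Longrightarrow> \<tau> l0 > 0 \<Longrightarrow> \<tau> = \<tau>0"
      by blast
    obtain \<gamma> \<gamma>' where \<gamma>: "algebra_automorphism \<phi>E \<gamma>" "algebra_automorphism \<phi>E \<gamma>'"
      and inv: "\<And>x. \<gamma>' (\<gamma> x) = x" "\<And>x. \<gamma> (\<gamma>' x) = x"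
      and sg: "\<And>\<tau>. \<tau> \<in> ?R \<Longrightarrow> \<exists>p>0. \<tau> l = \<tau> (\<gamma> l0) * p"
      by (rule H.lambda_class_signs[where \<nu> = \<nu>, OF \<Lambda> l0 l CMd[OF CM]]) blast
    have sg': "\<tau> l > 0 \<longleftrightarrow> \<tau> (\<gamma> l0) > 0" if "\<tau> \<in> ?R" for \<tau>
      using sg[OF that] by (auto simp: zero_less_mult_iff)
    show ?thesis
    proof (rule ex1I[of _ "\<lambda>x. \<tau>0 (\<gamma>' x)"])
      have "(\<lambda>x. \<tau>0 (\<gamma>' x)) \<in> ?R" by (rule real_place_automorphism[OF \<gamma>(2) \<tau>0(1)])
      then show "(\<lambda>x. \<tau>0 (\<gamma>' x)) \<in> ?R \<and> \<tau>0 (\<gamma>' l) > 0" using sg'[of "\<lambda>x. \<tau>0 (\<gamma>' x)"] \<tau>0(2) inv by simp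
    next
      fix \<tau> assume \<tau>: "\<tau> \<in> ?R \<and> \<tau> l > 0"
      then have "(\<lambda>x. \<tau> (\<gamma> x)) = \<tau>0"
        using sg' real_place_automorphism[OF \<gamma>(1)] by (intro unique) auto
      then have "\<tau> (\<gamma> (\<gamma>' x)) = \<tau>0 (\<gamma>' x)" for x by metis
      then show "\<tau> = (\<lambda>x. \<tau>0 (\<gamma>' x))" using inv by auto
    qed
  qed

  have mixed: "(\<exists>!\<tau>. \<tau> \<in> ?R) \<and> (\<forall>l\<in>\<Lambda>. \<forall>\<tau>\<in>?R. \<tau> l < 0 \<and>
      (\<forall>b :: 3 \<Rightarrow> 'e. is_basis (act \<phi>E) b \<longrightarrow> \<tau> (\<phi>E (alg_disc \<phi>E b) * l) > 0))"
    if split: "oct_split_at Oc \<nu>" and CM: "quadratic_CM_at \<phi>A \<nu>" and nre: "cubic_not_totally_real_at \<phi>E \<nu>"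
  proof -
    obtain f where f: "is_tensor_product \<phi>E \<nu> f (\<lambda>r. (r, complex_of_real r))"
      using nre unfolding cubic_not_totally_real_at_def by blast
    have R: "?R = {\<lambda>x. fst (f x)}" by (rule real_places_mixed[OF f bE])
    have "\<tau> l < 0 \<and> (\<forall>b :: 3 \<Rightarrow> 'e. is_basis (act \<phi>E) b \<longrightarrow> \<tau> (\<phi>E (alg_disc \<phi>E b) * l) > 0)"
      if l: "l \<in> \<Lambda>" and \<tau>: "\<tau> \<in> ?R" for l \<tau>
    proof -
      obtain \<gamma> \<gamma>' where \<gamma>: "algebra_automorphism \<phi>E \<gamma>"
        and sg: "\<And>\<tau>. \<tau> \<in> ?R \<Longrightarrow> \<exists>p>0. \<tau> l = \<tau> (\<gamma> l0) * p"
        by (rule H.lambda_class_signs[where \<nu> = \<nu>, OF \<Lambda> l0 l CMd[OF CM]]) blast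
      have "(\<lambda>x. \<tau> (\<gamma> x)) = (\<lambda>x. fst (f x))" using real_place_automorphism[OF \<gamma> \<tau>] R by blast
      then have "\<tau> (\<gamma> l0) = fst (f l0)" by metis
      then have "\<tau> (\<gamma> l0) < 0" using H.mixed_signs(2)[OF CM f disc] by simp
      then have neg: "\<tau> l < 0" using sg[OF \<tau>] by (auto simp: mult_less_0_iff)
      have "\<tau> (\<phi>E (alg_disc \<phi>E b) * l) > 0" if b: "is_basis (act \<phi>E) b" for b :: "3 \<Rightarrow> 'e"
      proof -
        have "\<tau> (\<phi>E (alg_disc \<phi>E b) * l) = \<nu> (alg_disc \<phi>E b) * \<tau> l"
          using \<tau> by (simp add: real_places_over_def rh_mult)
        then show ?thesis using H.mixed_signs(3)[OF CM f b] neg by (simp add: mult_neg_neg)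
      qed
      then show ?thesis using neg by blast
    qed
    then show ?thesis using R by auto
  qed

  have irrelevant: "surj (alg_norm TYPE(2) i) \<and> (\<forall>x y. x dvd 1 \<longrightarrow> y dvd 1 \<longrightarrow> (x, y) \<in> lambda_rel rE i)"
    if re: "quadratic_totally_real_at \<phi>A \<nu>"
      and jE: "is_tensor_product \<phi>E \<nu> jE rE" and jT: "is_tensor_product (\<lambda>c. iE (\<phi>E c)) \<nu> jT rT"
      and i: "ring_hom_map i" "\<forall>x. i (jE x) = jT (iE x)" "\<forall>r. i (rE r) = rT r"
    for jE :: "'e \<Rightarrow> 'ev" and rE and jT :: "'t \<Rightarrow> 'tv" and rT i
  proof -
    have d: "\<nu> d > 0" by (rule quad_real_positive[OF s d0 re])
    have surj: "\<exists>u. alg_norm TYPE(2) i u = w \<and> (w dvd 1 \<longrightarrow> u dvd 1)" for w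
      by (rule H.split_norm_surjective[OF jE jT i(1) i(2)[rule_format] i(3)[rule_format] d])
    have "(x, y) \<in> lambda_rel rE i" if x: "x dvd 1" and y: "y dvd 1" for x y
    proof -
      obtain x' where x': "1 = x * x'" using x by (rule dvdE)
      have "x' dvd 1" using x' by (metis dvd_triv_right)
      then have "(x' * y) dvd 1" using y mult_dvd_mono[of x' 1 y 1] by simp
      then obtain u where u: "alg_norm TYPE(2) i u = x' * y" "u dvd 1" using surj by blast
      have "y = x * alg_norm TYPE(2) i u" unfolding u(1) using x' by (simp add: mult.assoc[symmetric])
      moreover have "algebra_automorphism rE (\<lambda>x. x)"
        unfolding algebra_automorphism_def using rh_id bij_id[unfolded id_def] by auto
      ultimately show ?thesis
        unfolding lambda_rel_def using x u(2) by (auto intro!: exI[of _ "\<lambda>x. x"])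
    qed
    moreover have "surj (alg_norm TYPE(2) i)" using surj unfolding surj_def by metis
    ultimately show ?thesis by blast
  qed

  show ?thesis
    apply (rule conjI, rule impI, erule definite, rule impI, intro conjI)
       apply (intro allI impI, rule exist; assumption)
      apply (intro impI ballI, elim conjE, rule one_positive; assumption)
     apply (intro impI, elim conjE, rule mixed; assumption)
    apply (intro impI allI, rule irrelevant; assumption)
    done
qed

end
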